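(* Let $m,n\ge1$ be integers. Suppose $X,X_1,\ldots,X_m,Y,Y_1,\ldots,Y_n$ are independent random variables with zero mean, unit variance and finite sixth moment, with $X_i\stackrel{\mathcal D}{=}X$ for all $i=1,\ldots,m$ and $Y_j\stackrel{\mathcal D}{=}Y$ for all $j=1,\ldots,n$. Let $W=\frac{1}{\sqrt{mn}}\sum_{i=1}^m\sum_{j=1}^nX_iY_j$. Then, for $h\in C_b^3(\mathbb{R})$, $$|\mathbb{E}h(W)-\mathrm{VG}^{1,0}_{1,0}h|\le\gamma^1_{m,n}(X,Y)M^2_1(h)+\gamma^2_{m,n}(X,Y)M^3_1(h)+\gamma^3_{m,n}(X,Y)M^4_1(h),$$ where $$\gamma^1_{m,n}(X,Y)=\frac{10}{n}|\mathbb{E}Y^3|\mathbb{E}|Y^3|+\frac{11}{\sqrt{mn}}|\mathbb{E}X^3|\mathbb{E}Y^4,$$ $$\gamma^2_{m,n}(X,Y)=\frac9m\mathbb{E}X^4\mathbb{E}Y^4+\frac{30}n|\mathbb{E}Y^3|\mathbb{E}Y^4+\frac{85}{\sqrt{mn}}|\mathbb{E}X^3|\mathbb{E}|Y^5|+\frac{46}{\sqrt{mn}}\mathbb{E}|X^3||\mathbb{E}Y^3|\mathbb{E}Y^4,$$ $$\gamma^3_{m,n}(X,Y)=\frac1n\mathbb{E}X^4\mathbb{E}Y^4(1+15|\mathbb{E}Y^3|)+\frac{284}m|\mathbb{E}X^3|\mathbb{E}|X^3|\mathbb{E}Y^6+\frac{148}n\mathbb{E}X^4|\mathbb{E}Y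^3|\mathbb{E}|Y^5|+\frac{135}{\sqrt{mn}}|\mathbb{E}X^3|\mathbb{E}X^4\mathbb{E}|Y^3|+\frac{248}{\sqrt{mn}}\mathbb{E}X^4|\mathbb{E}Y^3|.$$
   Context: $\|\cdot\|$ is the supremum norm on $\mathbb{R}$; $C_b^3(\mathbb{R})$ is the set of bounded three times continuously differentiable real functions with bounded derivatives up to order three. $\mathrm{VG}^{1,0}_{1,0}h=\mathbb{E}h(Z)$ where $Z\sim\mathrm{VG}_1(1,0,1,0)$, i.e. $Z$ has density $\frac1\pi K_0(|x|)$ on $\mathbb{R}$ ($K_0$ the modified Bessel function of the second kind of order $0$). With $\tilde h=h-\mathrm{VG}^{1,0}_{1,0}h$ and $c=\sqrt{\pi/2}+1$, $$M_1^2(h)=c\,[3\|h'\|+4\|\tilde h\|],\quad M_1^3(h)=c\,[5\|h''\|+18\|h'\|+19\|\tilde h\|],$$ $$M_1^4(h)=c\,[8\|h^{(3)}\|+52\|h''\|+124\|h'\|+124\|\tilde h\|].$$ *)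

theory Defs
  imports "HOL-Probability.Probability"
begin

text \<open>
  Modified Bessel functions of real order at a positive real argument. The reciprocal Gamma
  function \<open>rGamma\<close> makes the terms with \<open>\<nu> + k + 1\<close> a pole of \<open>Gamma\<close> vanish, as usual.
  At integer order the function of the second kind is the limit over non-integer orders.
  The value at the argument \<open>0\<close>, where the true \<open>K\<^sub>0\<close> is infinite, is a dummy value; it is
  irrelevant below because it only changes a density on a null set.
\<close>

definition bessel_I :: "real \<Rightarrow> real \<Rightarrow> real" where
  "bessel_I \<nu> x = (\<Sum>k. rGamma (\<nu> + real k + 1) / fact k * (x / 2) powr (\<nu> + 2 * real k))"

definition bessel_K_nonint :: "real \<Rightarrow> real \<Rightarrow> real" where
  "bessel_K_nonint \<nu> x = pi / (2 * sin (\<nu> * pi)) * (bessel_I (- \<nu>) x - bessel_I \<nu> x)"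

definition bessel_K :: "real \<Rightarrow> real \<Rightarrow> real" where
  "bessel_K \<nu> x =
     (if \<nu> \<in> \<int> then Lim (at \<nu>) (\<lambda>\<mu>. bessel_K_nonint \<mu> x) else bessel_K_nonint \<nu> x)"

text \<open>The law \<open>VG\<^sub>1(1,0,1,0)\<close>, and \<open>VG_expect h = E h(Z)\<close> for \<open>Z\<close> with this law.\<close>

definition VG_law :: "real measure" where
  "VG_law = density lborel (\<lambda>x. ennreal (1 / pi * bessel_K 0 \<bar>x\<bar>))"

definition VG_expect :: "(real \<Rightarrow> real) \<Rightarrow> real" where
  "VG_expect h = (LINT x|VG_law. h x)"

text \<open>Real-valued supremum; only meaningful for bounded functions.\<close>

definition sup_norm :: "(real \<Rightarrow> real) \<Rightarrow> real" where
  "sup_norm f = (SUP x. \<bar>f x\<bar>)"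

definition C_b :: "nat \<Rightarrow> (real \<Rightarrow> real) set" where
  "C_b k = {h. (\<forall>j<k. \<forall>x. (deriv ^^ j) h differentiable (at x)) \<and>
               (\<forall>j\<le>k. continuous_on UNIV ((deriv ^^ j) h) \<and> bounded (range ((deriv ^^ j) h)))}"

definition vg_c :: real where
  "vg_c = sqrt (pi / 2) + 1"

definition vg_centred :: "(real \<Rightarrow> real) \<Rightarrow> real \<Rightarrow> real" where
  "vg_centred h = (\<lambda>x. h x - VG_expect h)"

text \<open>\<open>vg_M2\<close>, \<open>vg_M3\<close>, \<open>vg_M4\<close> are the quantities \<open>M\<^sub>1\<^sup>2\<close>, \<open>M\<^sub>1\<^sup>3\<close>, \<open>M\<^sub>1\<^sup>4\<close> (superscripts, not powers).\<close>

definition vg_M2 :: "(real \<Rightarrow> real) \<Rightarrow> real" where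
  "vg_M2 h = vg_c * (3 * sup_norm (deriv h) + 4 * sup_norm (vg_centred h))"

definition vg_M3 :: "(real \<Rightarrow> real) \<Rightarrow> real" where
  "vg_M3 h = vg_c * (5 * sup_norm ((deriv ^^ 2) h) + 18 * sup_norm (deriv h)
                     + 19 * sup_norm (vg_centred h))"

definition vg_M4 :: "(real \<Rightarrow> real) \<Rightarrow> real" where
  "vg_M4 h = vg_c * (8 * sup_norm ((deriv ^^ 3) h) + 52 * sup_norm ((deriv ^^ 2) h)
                     + 124 * sup_norm (deriv h) + 124 * sup_norm (vg_centred h))"

definition moment :: "'a measure \<Rightarrow> ('a \<Rightarrow> real) \<Rightarrow> nat \<Rightarrow> real" where
  "moment M X k = (LINT \<omega>|M. X \<omega> ^ k)"

definition abs_moment :: "'a measure \<Rightarrow> ('a \<Rightarrow> real) \<Rightarrow> nat \<Rightarrow> real" where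
  "abs_moment M X k = (LINT \<omega>|M. \<bar>X \<omega> ^ k\<bar>)"

definition gamma1 ::
  "'a measure \<Rightarrow> nat \<Rightarrow> nat \<Rightarrow> ('a \<Rightarrow> real) \<Rightarrow> ('a \<Rightarrow> real) \<Rightarrow> real" where
  "gamma1 M m n X Y =
     10 / real n * \<bar>moment M Y 3\<bar> * abs_moment M Y 3
   + 11 / sqrt (real m * real n) * \<bar>moment M X 3\<bar> * moment M Y 4"

definition gamma2 ::
  "'a measure \<Rightarrow> nat \<Rightarrow> nat \<Rightarrow> ('a \<Rightarrow> real) \<Rightarrow> ('a \<Rightarrow> real) \<Rightarrow> real" where
  "gamma2 M m n X Y =
     9 / real m * moment M X 4 * moment M Y 4
   + 30 / real n * \<bar>moment M Y 3\<bar> * moment M Y 4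
   + 85 / sqrt (real m * real n) * \<bar>moment M X 3\<bar> * abs_moment M Y 5
   + 46 / sqrt (real m * real n) * abs_moment M X 3 * \<bar>moment M Y 3\<bar> * moment M Y 4"

definition gamma3 ::
  "'a measure \<Rightarrow> nat \<Rightarrow> nat \<Rightarrow> ('a \<Rightarrow> real) \<Rightarrow> ('a \<Rightarrow> real) \<Rightarrow> real" where
  "gamma3 M m n X Y =
     1 / real n * moment M X 4 * moment M Y 4 * (1 + 15 * \<bar>moment M Y 3\<bar>)
   + 284 / real m * \<bar>moment M X 3\<bar> * abs_moment M X 3 * moment M Y 6
   + 148 / real n * moment M X 4 * \<bar>moment M Y 3\<bar> * abs_moment M Y 5
   + 135 / sqrt (real m * real n) * \<bar>moment M X 3\<bar> * moment M X 4 * abs_moment M Y 3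
   + 248 / sqrt (real m * real n) * moment M X 4 * \<bar>moment M Y 3\<bar>"

text \<open>Labels for the joint family \<open>X, X\<^sub>1, \<dots>, X\<^sub>m, Y, Y\<^sub>1, \<dots>, Y\<^sub>n\<close>, used to state mutual independence.\<close>

datatype rv_index = IX | IXs nat | IY | IYs nat

fun joint_family ::
  "('a \<Rightarrow> real) \<Rightarrow> (nat \<Rightarrow> 'a \<Rightarrow> real) \<Rightarrow> ('a \<Rightarrow> real) \<Rightarrow> (nat \<Rightarrow> 'a \<Rightarrow> real)
   \<Rightarrow> rv_index \<Rightarrow> 'a \<Rightarrow> real" where
  "joint_family X Xs Y Ys IX = X"
| "joint_family X Xs Y Ys (IXs i) = Xs i"
| "joint_family X Xs Y Ys IY = Y"
| "joint_family X Xs Y Ys (IYs j) = Ys j"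

end

theory Submission
  imports Defs "HOL-Real_Asymp.Real_Asymp"
begin

text \<open>
  The law \<open>VG\<^sub>1(1,0,1,0)\<close> is the law of the product of two independent standard normal variables
  \<open>N\<close> and \<open>N'\<close>, and \<open>W\<close> is the product \<open>U V\<close> of the independent normalised sums of the \<open>X\<^sub>i\<close> and of
  the \<open>Y\<^sub>j\<close>. So \<open>U\<close> is replaced by \<open>N\<close> conditionally on \<open>V\<close>, and then \<open>V\<close> by \<open>N'\<close>, each time with
  Stein's method for the normal law, expanded one order further than usual; the error is of order
  \<open>1/m\<close> (or \<open>1/n\<close>) apart from a correction proportional to the third moment and to
  \<open>E[He\<^sub>3(N) k(N)]\<close>, where \<open>He\<^sub>3\<close> is the third Hermite polynomial. In the first replacement the
  correction is \<open>E[G(V)]\<close> for the odd function \<open>G(v) = E[He\<^sub>3(N) h(N v)]\<close>; since \<open>E[G(N')] = 0\<close>, it gains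
  another factor \<open>1/sqrt n\<close>. In the second one the test function \<open>v \<mapsto> E[h(N v)]\<close> is even and
  the correction vanishes.

  The identification of the density \<open>K\<^sub>0(|x|)/\<pi>\<close> with that of \<open>N N'\<close> goes through
  \<open>K\<^sub>0(x) = \<integral> exp(- x cosh t)/2 dt\<close>: both sides solve the modified Bessel equation and behave like
  \<open>- ln(x/2) - \<gamma>\<close> at \<open>0\<close>, which determines a solution.
\<close>

section \<open>An integral that solves the modified Bessel equation\<close>

text \<open>A single application of Stein's method leaves errors of order 1/sqrt m and 1/sqrt n,
  whereas the claim only has room for 1/m, 1/n and 1/sqrt(m n). The skewness term must therefore be
  isolated exactly. It first appears as E f''(N) for the Stein solution f; integration by parts
  against the normal density turns it into E[He3(N) k(N)], which involves the test function alone,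
  so that its parity becomes visible. The bounds for f'' and f''' involve k only through the suprema
  of k - E k(N) and of k''. For k(u) = h(u v) the latter grows like v^2, and this growth is
  integrated out by E V^2 = 1. \<open>bessel_K\<close> at order 0 is a limit over the order, hence a
  derivative of I_nu in nu. This produces a series with a logarithm, which has no visible link to a
  density; the differential equation provides the link. The constants come out of the argument in
  their own form and are fitted to those of the theorem only at the end, where E X^2 = E Y^2 = 1
  makes the higher absolute and even moments at least 1.\<close>

lemma has_real_derivative_integral:
  fixes f f' :: "real \<Rightarrow> 'a \<Rightarrow> real"
  assumes x: "x \<in> {a<..<b}"
    and int: "\<And>y. y \<in> {a<..<b} \<Longrightarrow> integrable M (f y)"
    and deriv: "\<And>y t. y \<in> {a<..<b} \<Longrightarrow> ((\<lambda>y. f y t) has_real_derivative f' y t) (at y)"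
    and bound: "\<And>y t. y \<in> {a<..<b} \<Longrightarrow> \<bar>f' y t\<bar> \<le> w t"
    and w: "integrable M w"
    and meas: "f' x \<in> borel_measurable M"
  shows "((\<lambda>y. \<integral>t. f y t \<partial>M) has_real_derivative (\<integral>t. f' x t \<partial>M)) (at x)"
proof -
  have at: "at x = at x within {a<..<b}"
    using x by (intro at_within_open[symmetric]) auto
  have "((\<lambda>y. ((\<integral>t. f y t \<partial>M) - (\<integral>t. f x t \<partial>M)) / (y - x)) \<longlongrightarrow> (\<integral>t. f' x t \<partial>M)) (at x within {a<..<b})"
    unfolding tendsto_at_iff_sequentially comp_def
  proof (intro allI impI)
    fix X :: "nat \<Rightarrow> real"
    assume X: "\<forall>i. X i \<in> {a<..<b} - {x}" and lim: "X \<longlonglongrightarrow> x"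
    have eq: "((\<integral>t. f (X n) t \<partial>M) - (\<integral>t. f x t \<partial>M)) / (X n - x) = (\<integral>t. (f (X n) t - f x t) / (X n - x) \<partial>M)" for n
      using X x int by (simp add: Bochner_Integration.integral_diff)
    show "(\<lambda>n. ((\<integral>t. f (X n) t \<partial>M) - (\<integral>t. f x t \<partial>M)) / (X n - x)) \<longlonglongrightarrow> (\<integral>t. f' x t \<partial>M)"
      unfolding eq
    proof (rule integral_dominated_convergence[OF meas _ w])
      show "(\<lambda>t. (f (X n) t - f x t) / (X n - x)) \<in> borel_measurable M" for n
        using int[of x] int[of "X n"] X x by (auto dest!: borel_measurable_integrable)
      show "AE t in M. (\<lambda>n. (f (X n) t - f x t) / (X n - x)) \<longlonglongrightarrow> f' x t"
      proof (rule AE_I2)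
        fix t
        have "((\<lambda>y. (f y t - f x t) / (y - x)) \<longlongrightarrow> f' x t) (at x within {a<..<b})"
          using deriv[OF x, of t] at by (simp add: has_field_derivative_iff)
        then show "(\<lambda>n. (f (X n) t - f x t) / (X n - x)) \<longlonglongrightarrow> f' x t"
          using X lim unfolding tendsto_at_iff_sequentially comp_def by blast
      qed
      show "AE t in M. norm ((f (X n) t - f x t) / (X n - x)) \<le> w t" for n
      proof (rule AE_I2)
        fix t
        \<comment> \<open>The mean value inequality makes the bound \<open>w\<close> on the
          derivative a majorant of all difference quotients at once.\<close>
        have "norm (f (X n) t - f x t) \<le> w t * norm (X n - x)"
          by (rule field_differentiable_bound[of "{a<..<b}" "\<lambda>y. f y t" "\<lambda>y. f' y t"])
             (use X x deriv bound in \<open>auto intro: has_field_derivative_at_within\<close>)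
        then show "norm ((f (X n) t - f x t) / (X n - x)) \<le> w t"
          using X by (simp add: divide_le_eq abs_divide)
      qed
    qed
  qed
  then show ?thesis
    by (simp add: has_field_derivative_iff at[symmetric])
qed

lemma integral_real_line_FTC:
  fixes f F :: "real \<Rightarrow> real"
  assumes F: "\<And>x. (F has_real_derivative f x) (at x)"
    and f: "\<And>x. isCont f x" "integrable lborel f"
    and lim: "(F \<longlongrightarrow> A) at_bot" "(F \<longlongrightarrow> B) at_top"
  shows "(\<integral>x. f x \<partial>lborel) = B - A"
proof -
  have "(LBINT x=-\<infinity>..\<infinity>. f x) = B - A"
  proof (rule interval_integral_FTC_integrable)
    show "((F \<circ> real_of_ereal) \<longlongrightarrow> A) (at_right (- \<infinity>))"
      using lim(1) by (simp add: at_right_MInf filterlim_filtermap comp_def)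
    show "((F \<circ> real_of_ereal) \<longlongrightarrow> B) (at_left \<infinity>)"
      using lim(2) by (simp add: at_left_PInf filterlim_filtermap comp_def)
  qed (use F f in \<open>auto simp: has_real_derivative_iff_has_vector_derivative set_integrable_def\<close>)
  then show ?thesis
    by (simp add: interval_integral_Ioi interval_lebesgue_integral_def einterval_def set_lebesgue_integral_def)
qed

lemma integrable_exp_minus_square:
  assumes "a > (0::real)"
  shows "integrable lborel (\<lambda>t. exp (- (a * t\<^sup>2)))"
proof -
  define s where "s = sqrt (1 / (2 * a))"
  have s: "s > 0" "s\<^sup>2 = 1 / (2 * a)" using assms by (auto simp: s_def)
  have "integrable lborel (\<lambda>t. normal_density 0 s t * sqrt (2 * pi * s\<^sup>2))"
    using s by (intro integrable_mult_left) (simp add: integrable_normal_density)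
  moreover have "normal_density 0 s t * sqrt (2 * pi * s\<^sup>2) = exp (- (a * t\<^sup>2))" for t
    using s assms by (simp add: normal_density_def field_simps)
  ultimately show ?thesis by simp
qed

lemma cosh_ge_quadratic: "cosh (t::real) \<ge> t\<^sup>2 / 4"
proof -
  have *: "cosh s \<ge> s\<^sup>2 / 4" if "s \<ge> 0" for s :: real
  proof -
    have "1 + s + s\<^sup>2 / 2 \<le> exp s" using exp_lower_Taylor_quadratic[OF that] .
    then show ?thesis using that exp_gt_zero[of "-s"] unfolding cosh_field_def by (simp add: field_simps) (use exp_gt_zero[of "-s"] in linarith)
  qed
  from *[of t] *[of "-t"] show ?thesis by (cases "t \<ge> 0") auto
qed

text \<open>Half of the exponent absorbs the power of \<open>cosh t\<close>, by
  \<open>s\<^sup>2 / 2 \<le> exp s\<close> at s = a cosh t / 2; the other half becomes Gaussian by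
  \<open>cosh_ge_quadratic\<close>.\<close>

lemma cosh_power_exp_bound:
  assumes "a > (0::real)" "j \<le> 2"
  shows "cosh t ^ j * exp (- (a * cosh t)) \<le> 8 / a\<^sup>2 * exp (- (a / 8 * t\<^sup>2))"
proof -
  define y where "y = cosh t"
  have y: "y \<ge> 1" by (simp add: y_def cosh_real_ge_1)
  have "1 + a * y / 2 + (a * y / 2)\<^sup>2 / 2 \<le> exp (a * y / 2)"
    using exp_lower_Taylor_quadratic[of "a * y / 2"] y assms by simp
  moreover have "a * y / 2 \<ge> 0" using y assms by simp
  ultimately have "(a * y / 2)\<^sup>2 / 2 \<le> exp (a * y / 2)" by linarith
  then have "y\<^sup>2 \<le> 8 / a\<^sup>2 * exp (a * y / 2)"
    using assms by (simp add: field_simps power_mult_distrib)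
  then have "y\<^sup>2 * exp (- (a * y)) \<le> 8 / a\<^sup>2 * exp (a * y / 2) * exp (- (a * y))"
    by (intro mult_right_mono) auto
  also have "\<dots> = 8 / a\<^sup>2 * exp (- (a * y / 2))"
    by (simp add: mult.assoc exp_add[symmetric])
  also have "\<dots> \<le> 8 / a\<^sup>2 * exp (- (a / 8 * t\<^sup>2))"
  proof -
    have "a * (t\<^sup>2 / 4) \<le> a * y" unfolding y_def
      using cosh_ge_quadratic[of t] assms by (intro mult_left_mono) auto
    then show ?thesis using assms by (intro mult_left_mono) auto
  qed
  finally have "y\<^sup>2 * exp (- (a * y)) \<le> 8 / a\<^sup>2 * exp (- (a / 8 * t\<^sup>2))" .
  moreover have "y ^ j * exp (- (a * y)) \<le> y\<^sup>2 * exp (- (a * y))"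
    using y assms by (intro mult_right_mono power_increasing) auto
  ultimately show ?thesis unfolding y_def by linarith
qed

lemma integrable_cosh_power_exp:
  assumes "a > (0::real)" "j \<le> 2"
  shows "integrable lborel (\<lambda>t. cosh t ^ j * exp (- (a * cosh t)))"
proof (rule Bochner_Integration.integrable_bound)
  show "integrable lborel (\<lambda>t. 8 / a\<^sup>2 * exp (- (a / 8 * t\<^sup>2)))"
    using assms by (intro integrable_mult_right integrable_exp_minus_square) auto
  show "AE t in lborel. norm (cosh t ^ j * exp (- (a * cosh t))) \<le> norm (8 / a\<^sup>2 * exp (- (a / 8 * t\<^sup>2)))"
    using cosh_power_exp_bound[OF assms] by (auto simp: abs_mult)
  show "(\<lambda>t. cosh t ^ j * exp (- (a * cosh t))) \<in> borel_measurable lborel"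
    unfolding cosh_field_def by measurable
qed

text \<open>Up to the sign (-1)^j, the j-th derivative of K_0 for j at most 2; the factor 1/2 comes
  from integrating over the whole line instead of the half line.\<close>

definition K0_integral :: "nat \<Rightarrow> real \<Rightarrow> real" where
  "K0_integral j x = (\<integral>t. cosh t ^ j * exp (- (x * cosh t)) / 2 \<partial>lborel)"

lemma K0_integral_deriv:
  assumes "x > 0" "j \<le> 1"
  shows "(K0_integral j has_real_derivative - K0_integral (Suc j) x) (at x)"
proof -
  have "((\<lambda>y. \<integral>t. cosh t ^ j * exp (- (y * cosh t)) / 2 \<partial>lborel) has_real_derivative
     (\<integral>t. - (cosh t ^ Suc j * exp (- (x * cosh t)) / 2) \<partial>lborel)) (at x)"
  \<comment> \<open>The integrand decreases in the argument, so its value at the left end x/2, still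
    positive, dominates on the whole interval.\<close>
  proof (rule has_real_derivative_integral[where a = "x/2" and b = "x+1"
       and w = "\<lambda>t. cosh t ^ Suc j * exp (- (x/2 * cosh t))"])
    show "integrable lborel (\<lambda>t. cosh t ^ j * exp (- (y * cosh t)) / 2)" if "y \<in> {x/2<..<x+1}" for y
      using that assms by (intro integrable_divide integrable_cosh_power_exp) auto
    show "((\<lambda>y. cosh t ^ j * exp (- (y * cosh t)) / 2) has_real_derivative
        - (cosh t ^ Suc j * exp (- (y * cosh t)) / 2)) (at y)" for y t
      by (auto intro!: derivative_eq_intros)
    show "\<bar>- (cosh t ^ Suc j * exp (- (y * cosh t)) / 2)\<bar> \<le> cosh t ^ Suc j * exp (- (x/2 * cosh t))"
      if "y \<in> {x/2<..<x+1}" for y t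
    proof -
      have "cosh t ^ Suc j * exp (- (y * cosh t)) \<le> cosh t ^ Suc j * exp (- (x/2 * cosh t))"
        using that assms cosh_real_ge_1[of t]
        by (intro mult_left_mono) (auto intro!: mult_right_mono)
      moreover have "0 \<le> cosh t ^ Suc j * exp (- (y * cosh t))" using cosh_real_ge_1[of t] by simp
      ultimately show ?thesis by linarith
    qed
    show "integrable lborel (\<lambda>t. cosh t ^ Suc j * exp (- (x/2 * cosh t)))"
      using assms by (intro integrable_cosh_power_exp) auto
    show "(\<lambda>t. - (cosh t ^ Suc j * exp (- (x * cosh t)) / 2)) \<in> borel_measurable lborel"
      unfolding cosh_field_def by measurable
  qed (use assms in auto)
  moreover have "K0_integral j = (\<lambda>y. \<integral>t. cosh t ^ j * exp (- (y * cosh t)) / 2 \<partial>lborel)"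
    by (rule ext) (rule K0_integral_def)
  moreover have "(\<integral>t. - (cosh t ^ Suc j * exp (- (x * cosh t)) / 2) \<partial>lborel) = - K0_integral (Suc j) x"
    unfolding K0_integral_def by (rule Bochner_Integration.integral_minus)
  ultimately show ?thesis by simp
qed

text \<open>Since cosh^2 - 1 = sinh^2, the combined integrand is the t-derivative of -sinh t exp(-x
  cosh t) / 2, which vanishes at both ends. In terms of derivatives the identity reads x K'' + K' =
  x K.\<close>

lemma K0_integral_ode:
  assumes "x > 0"
  shows "x * K0_integral 2 x - K0_integral 1 x = x * K0_integral 0 x"
proof -
  let ?e = "\<lambda>t. exp (- (x * cosh t))"
  define g where "g = (\<lambda>j t. cosh t ^ j * ?e t / 2)"
  have g: "integrable lborel (g j)" if "j \<le> 2" for j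
    unfolding g_def using integrable_cosh_power_exp[OF assms that] by (rule integrable_divide)
  let ?f = "\<lambda>t. x * (cosh t ^ 2 * ?e t / 2) - cosh t ^ 1 * ?e t / 2 - x * (cosh t ^ 0 * ?e t / 2)"
  have lim: "((\<lambda>t. - (sinh t * ?e t / 2)) \<longlongrightarrow> 0) F"
    if "filterlim (\<lambda>t. t\<^sup>2) at_top F" for F :: "real filter"
  proof (rule Lim_null_comparison)
    show "\<forall>\<^sub>F t in F. norm (- (sinh t * ?e t / 2)) \<le> 8 / x\<^sup>2 * exp (- (x / 8 * t\<^sup>2))"
    proof (rule always_eventually, rule allI)
      fix t :: real
      have "\<bar>sinh t\<bar> \<le> cosh t" 
        by (simp add: abs_le_iff sinh_field_def cosh_field_def divide_right_mono)
      then have "\<bar>sinh t\<bar> * ?e t \<le> cosh t ^ 1 * ?e t" by simp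
      also have "\<dots> \<le> 8 / x\<^sup>2 * exp (- (x / 8 * t\<^sup>2))" by (rule cosh_power_exp_bound) (use assms in auto)
      finally have "\<bar>sinh t\<bar> * ?e t \<le> 8 / x\<^sup>2 * exp (- (x / 8 * t\<^sup>2))" .
      moreover have "norm (- (sinh t * ?e t / 2)) \<le> \<bar>sinh t\<bar> * ?e t" by (simp add: abs_mult)
      ultimately show "norm (- (sinh t * ?e t / 2)) \<le> 8 / x\<^sup>2 * exp (- (x / 8 * t\<^sup>2))"
        by linarith
    qed
    have "((\<lambda>u::real. 8 / x\<^sup>2 * exp (- (x / 8 * u))) \<longlongrightarrow> 0) at_top"
      using assms by real_asymp
    from filterlim_compose[OF this that]
    show "((\<lambda>t. 8 / x\<^sup>2 * exp (- (x / 8 * t\<^sup>2))) \<longlongrightarrow> 0) F" .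
  qed
  have K0: "K0_integral j x = (\<integral>t. g j t \<partial>lborel)" for j
    unfolding K0_integral_def g_def ..
  have f_eq: "?f = (\<lambda>t. x * g 2 t - g 1 t - x * g 0 t)" by (simp only: g_def)
  have "(\<integral>t. ?f t \<partial>lborel) = 0 - 0"
  proof (rule integral_real_line_FTC)
    show "((\<lambda>t. - (sinh t * ?e t / 2)) has_real_derivative ?f t) (at t)" for t
    proof -
      have *: "- ((c * e + s * (e * - (x * s))) / 2) = x * ((s\<^sup>2 + 1) * e / 2) - c ^ 1 * e / 2 - x * (c ^ 0 * e / 2)"
        for c e s :: real by (simp add: field_simps power2_eq_square)
      have "((\<lambda>t. - (sinh t * ?e t / 2)) has_real_derivative
          - ((cosh t * ?e t + sinh t * (?e t * - (x * sinh t))) / 2)) (at t)"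
        by (auto intro!: derivative_eq_intros)
      also have "- ((cosh t * ?e t + sinh t * (?e t * - (x * sinh t))) / 2) = ?f t"
        using * [of "cosh t" "?e t" "sinh t"] unfolding cosh_square_eq by simp
      finally show ?thesis .
    qed
    show "isCont ?f t" for t by (intro continuous_intros) simp_all
    show "integrable lborel ?f"
      using g[of 0] g[of 1] g[of 2] unfolding f_eq by simp
    show "((\<lambda>t. - (sinh t * ?e t / 2)) \<longlongrightarrow> 0) at_top" by (rule lim) real_asymp
    show "((\<lambda>t. - (sinh t * ?e t / 2)) \<longlongrightarrow> 0) at_bot" by (rule lim) real_asymp
  qed
  moreover have "(\<integral>t. ?f t \<partial>lborel) = x * K0_integral 2 x - K0_integral 1 x - x * K0_integral 0 x"
    unfolding f_eq K0 using g[of 0] g[of 1] g[of 2] by simp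
  ultimately have "x * K0_integral 2 x - K0_integral 1 x - x * K0_integral 0 x = 0 - 0" by (rule trans[OF sym, rotated])
  then show ?thesis by simp
qed

section \<open>The series of the modified Bessel function of order zero\<close>

text \<open>In the variable \<open>q = x\<^sup>2 / 4\<close> the modified Bessel equation of order zero reads \<open>(q f')' = f\<close>.\<close>

lemma powser_bessel_operator:
  fixes c :: "nat \<Rightarrow> real"
  assumes sm: "\<And>y. summable (\<lambda>n. c n * y ^ n)"
  shows "\<exists>f'. \<forall>q. ((\<lambda>q. \<Sum>n. c n * q ^ n) has_real_derivative f' q) (at q) \<and>
    (\<lambda>n. real (Suc n) * c (Suc n) * q ^ n) sums f' q \<and>
    ((\<lambda>q. q * f' q) has_real_derivative (\<Sum>n. (real (Suc n))\<^sup>2 * c (Suc n) * q ^ n)) (at q)"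
proof -
  define f' where "f' = (\<lambda>q. \<Sum>n. diffs c n * q ^ n)"
  have d1: "((\<lambda>q. \<Sum>n. c n * q ^ n) has_real_derivative f' q) (at q)" for q
    unfolding f'_def by (rule termdiffs_strong_converges_everywhere[OF sm])
  have sm1: "summable (\<lambda>n. diffs c n * y ^ n)" for y
    by (rule termdiff_converges_all[OF sm])
  define d where "d = (\<lambda>n. real n * c n)"
  have d_eq: "q * f' q = (\<Sum>n. d n * q ^ n)" and smd: "summable (\<lambda>n. d n * q ^ n)" for q
  proof -
    have "(\<lambda>n. q * (diffs c n * q ^ n)) sums (q * f' q)"
      unfolding f'_def by (intro sums_mult summable_sums sm1)
    then have "(\<lambda>n. d (Suc n) * q ^ Suc n) sums (q * f' q)"
      by (simp add: d_def diffs_def mult_ac)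
    then have "(\<lambda>n. d n * q ^ n) sums (q * f' q)"
      by (subst (asm) sums_Suc_iff) (simp add: d_def)
    then show "q * f' q = (\<Sum>n. d n * q ^ n)" "summable (\<lambda>n. d n * q ^ n)"
      by (auto simp: sums_iff)
  qed
  have "((\<lambda>q. q * f' q) has_real_derivative (\<Sum>n. (real (Suc n))\<^sup>2 * c (Suc n) * q ^ n)) (at q)" for q
    unfolding d_eq using termdiffs_strong_converges_everywhere[OF smd, of q]
    by (simp add: diffs_def d_def power2_eq_square mult_ac)
  moreover have "(\<lambda>n. real (Suc n) * c (Suc n) * q ^ n) sums f' q" for q
    using summable_sums[OF sm1[of q]] by (simp add: f'_def diffs_def)
  ultimately show ?thesis using d1 by blast
qed

section \<open>Power series in q = x^2/4\<close>

definition bessel_I0_q :: "real \<Rightarrow> real" where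
  "bessel_I0_q q = (\<Sum>k. 1 / (fact k)\<^sup>2 * q ^ k)"

text \<open>\<open>bessel_I0_q\<close> at q = x^2/4 is I_0(x). The harmonic numbers here arise from
  differentiating 1 / Gamma(nu + k + 1) in nu at 0; this series is the part of K_0 without the
  logarithm and Euler's constant.\<close>

definition bessel_H0_q :: "real \<Rightarrow> real" where
  "bessel_H0_q q = (\<Sum>k. harm k / (fact k)\<^sup>2 * q ^ k)"

lemma harm_le_real: "harm k \<le> real k"
proof (induction k)
  case (Suc k)
  have "inverse (real (Suc k)) \<le> 1" by (simp add: field_simps)
  with Suc show ?case by (simp add: harm_Suc)
qed (simp add: harm_def)

lemma summable_bessel_q:
  fixes y :: real
  assumes "\<And>k. \<bar>c k\<bar> \<le> 2 ^ k"
  shows "summable (\<lambda>k. c k / (fact k)\<^sup>2 * y ^ k)"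
proof (rule summable_comparison_test)
  show "\<exists>N. \<forall>n\<ge>N. norm (c n / (fact n)\<^sup>2 * y ^ n) \<le> inverse (fact n) * (2 * \<bar>y\<bar>) ^ n"
  proof (intro exI allI impI)
    fix n :: nat
    have "\<bar>c n\<bar> * \<bar>y\<bar> ^ n \<le> 2 ^ n * \<bar>y\<bar> ^ n" by (intro mult_right_mono assms) auto
    also have "\<dots> \<le> 2 ^ n * \<bar>y\<bar> ^ n * fact n"
      by (metis fact_ge_1 mult_left_mono mult.right_neutral mult_nonneg_nonneg abs_ge_zero zero_le_numeral zero_le_power)
    finally show "norm (c n / (fact n)\<^sup>2 * y ^ n) \<le> inverse (fact n) * (2 * \<bar>y\<bar>) ^ n"
      by (simp add: abs_mult power_abs field_simps power2_eq_square power_mult_distrib)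
  qed
qed (rule summable_exp)

lemma summable_bessel_I0_q: "summable (\<lambda>k. 1 / (fact k)\<^sup>2 * (y::real) ^ k)"
  by (rule summable_bessel_q) simp

lemma summable_bessel_H0_q: "summable (\<lambda>k. harm k / (fact k)\<^sup>2 * (y::real) ^ k)"
proof (rule summable_bessel_q)
  show "\<bar>harm k\<bar> \<le> (2::real) ^ k" for k
    using harm_le_real[of k] of_nat_less_two_power[of k, where 'a=real] harm_nonneg[of k, where 'a=real]
    by linarith
qed

text \<open>The coefficients 1/(k!)^2 satisfy (k+1)^2 c(k+1) = c(k), which gives the homogeneous
  equation. With harmonic numbers, the increment 1/(k+1) leaves the coefficients of I' as an
  inhomogeneous term; it later cancels what the logarithm in \<open>K0_series\<close>
  contributes.\<close>

lemma bessel_q_ode: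
  obtains I' H' where
    "\<And>q. (bessel_I0_q has_real_derivative I' q) (at q)"
    "\<And>q. (bessel_H0_q has_real_derivative H' q) (at q)"
    "\<And>q. ((\<lambda>q. q * I' q) has_real_derivative bessel_I0_q q) (at q)"
    "\<And>q. ((\<lambda>q. q * H' q) has_real_derivative bessel_H0_q q + I' q) (at q)"
proof -
  obtain I' where I: "\<forall>q. (bessel_I0_q has_real_derivative I' q) (at q) \<and>
      (\<lambda>n. real (Suc n) * (1 / (fact (Suc n))\<^sup>2) * q ^ n) sums I' q \<and>
      ((\<lambda>q. q * I' q) has_real_derivative (\<Sum>n. (real (Suc n))\<^sup>2 * (1 / (fact (Suc n))\<^sup>2) * q ^ n)) (at q)"
    using powser_bessel_operator[OF summable_bessel_I0_q] unfolding bessel_I0_q_def[abs_def] ..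
  obtain H' where H: "\<forall>q. (bessel_H0_q has_real_derivative H' q) (at q) \<and>
      (\<lambda>n. real (Suc n) * (harm (Suc n) / (fact (Suc n))\<^sup>2) * q ^ n) sums H' q \<and>
      ((\<lambda>q. q * H' q) has_real_derivative (\<Sum>n. (real (Suc n))\<^sup>2 * (harm (Suc n) / (fact (Suc n))\<^sup>2) * q ^ n)) (at q)"
    using powser_bessel_operator[OF summable_bessel_H0_q] unfolding bessel_H0_q_def[abs_def] ..
  have e1: "(real (Suc n))\<^sup>2 * (1 / (fact (Suc n))\<^sup>2) = 1 / (fact n)\<^sup>2" for n
    by (simp add: power_mult_distrib fact_Suc del: of_nat_Suc)
  have e2: "(real (Suc n))\<^sup>2 * (harm (Suc n) / (fact (Suc n))\<^sup>2) =
      harm n / (fact n)\<^sup>2 + real (Suc n) * (1 / (fact (Suc n))\<^sup>2)" for n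
  proof -
    have *: "s\<^sup>2 * ((h + inverse s) / (s * f)\<^sup>2) = h / f\<^sup>2 + s * (1 / (s * f)\<^sup>2)"
      if "s > 0" "f > 0" for s h f :: real
      using that by (simp add: power_mult_distrib field_simps power2_eq_square)
    show ?thesis
      using *[of "real (Suc n)" "fact n" "harm n"] by (simp add: harm_Suc fact_Suc del: of_nat_Suc)
  qed
  have "(\<lambda>n. harm n / (fact n)\<^sup>2 * q ^ n + real (Suc n) * (1 / (fact (Suc n))\<^sup>2) * q ^ n) sums (bessel_H0_q q + I' q)" for q
    unfolding bessel_H0_q_def using I by (intro sums_add summable_sums summable_bessel_H0_q) blast
  then have "(\<Sum>n. (real (Suc n))\<^sup>2 * (harm (Suc n) / (fact (Suc n))\<^sup>2) * q ^ n) = bessel_H0_q q + I' q" for q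
    unfolding e2 ring_distribs by (simp add: sums_iff)
  with I H have "(bessel_I0_q has_real_derivative I' q) (at q)" "(bessel_H0_q has_real_derivative H' q) (at q)"
    "((\<lambda>q. q * I' q) has_real_derivative bessel_I0_q q) (at q)"
    "((\<lambda>q. q * H' q) has_real_derivative bessel_H0_q q + I' q) (at q)" for q
    unfolding e1 by (auto simp: bessel_I0_q_def)
  with that show ?thesis by blast
qed

definition K0_series :: "real \<Rightarrow> real" where
  "K0_series x = bessel_H0_q (x\<^sup>2 / 4) - (euler_mascheroni + ln (x / 2)) * bessel_I0_q (x\<^sup>2 / 4)"

section \<open>Differentiating I_nu in the order at nu = 0\<close>

lemma sum_inverse_shift_bound:
  assumes "\<bar>\<nu>\<bar> < (1/2::real)"
  shows "\<bar>\<Sum>j<k. inverse (\<nu> + real j + 1)\<bar> \<le> 2 * real k"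
proof -
  have "\<bar>\<Sum>j<k. inverse (\<nu> + real j + 1)\<bar> \<le> (\<Sum>j<k. \<bar>inverse (\<nu> + real j + 1)\<bar>)"
    by (rule sum_abs)
  also have "\<dots> \<le> (\<Sum>j<k. 2)"
    using assms by (intro sum_mono) (auto simp: field_simps abs_less_iff)
  finally show ?thesis by simp
qed

text \<open>For orders within 1/2 of 0 each factor of the Pochhammer symbol exceeds 1/2, so each
  reciprocal factor is at most 2. This uniformity in the order is what termwise differentiation
  requires.\<close>

lemma inverse_pochhammer_bound:
  assumes "\<bar>\<nu>\<bar> < (1/2::real)"
  shows "\<bar>inverse (pochhammer (\<nu> + 1) k)\<bar> \<le> 2 ^ k"
proof (induction k)
  case (Suc k)
  have "inverse (pochhammer (\<nu> + 1) (Suc k)) = inverse (pochhammer (\<nu> + 1) k) * inverse (\<nu> + 1 + real k)"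
    by (simp add: pochhammer_Suc)
  moreover have "\<bar>inverse (\<nu> + 1 + real k)\<bar> \<le> 2" using assms by (auto simp: field_simps abs_less_iff)
  ultimately show ?case using Suc by (simp add: abs_mult) (metis abs_ge_zero mult.commute mult_mono' abs_inverse)
qed simp

lemma inverse_pochhammer_deriv:
  assumes "\<bar>\<nu>\<bar> < (1/2::real)"
  shows "((\<lambda>\<nu>. inverse (pochhammer (\<nu> + 1) k)) has_real_derivative
           - (\<Sum>j<k. inverse (\<nu> + real j + 1)) * inverse (pochhammer (\<nu> + 1) k)) (at \<nu> within A)"
proof (induction k)
  case (Suc k)
  have nz: "\<nu> + 1 + real k \<noteq> 0" using assms by (auto simp: abs_less_iff)
  have "((\<lambda>\<nu>. inverse (pochhammer (\<nu> + 1) k) * inverse (\<nu> + 1 + real k)) has_real_derivative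
      - (\<Sum>j<k. inverse (\<nu> + real j + 1)) * inverse (pochhammer (\<nu> + 1) k) * inverse (\<nu> + 1 + real k)
       + - (inverse (\<nu> + 1 + real k) * 1 * inverse (\<nu> + 1 + real k)) * inverse (pochhammer (\<nu> + 1) k)) (at \<nu> within A)"
    by (intro DERIV_mult Suc DERIV_inverse' derivative_eq_intros nz) (auto intro!: derivative_eq_intros)
  then show ?case
    by (simp add: pochhammer_Suc inverse_mult_distrib) (simp add: algebra_simps)
qed simp

text \<open>\<open>bessel_S (x\<^sup>2 / 4) \<nu>\<close> is \<open>bessel_I \<nu> x\<close> without the factor \<open>rGamma (\<nu> + 1) * (x / 2) powr \<nu>\<close>.\<close>

definition bessel_S :: "real \<Rightarrow> real \<Rightarrow> real" where
  "bessel_S q \<nu> = (\<Sum>k. q ^ k / fact k * inverse (pochhammer (\<nu> + 1) k))"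

text \<open>Logarithmic differentiation multiplies the k-th term by a sum of k reciprocals, at most
  2k and hence at most 2 * 2^k. With \<open>inverse_pochhammer_bound\<close> the differentiated
  terms are at most 2 (4|q|)^k / k!, so the Weierstrass test applies. At order 0 the sum of
  reciprocals is \<open>harm k\<close>.\<close>

lemma bessel_S_deriv: "(bessel_S q has_real_derivative - bessel_H0_q q) (at 0)"
proof -
  let ?f = "\<lambda>k \<nu>. q ^ k / fact k * inverse (pochhammer (\<nu> + 1) k)"
  let ?f' = "\<lambda>k \<nu>. q ^ k / fact k * (- (\<Sum>j<k. inverse (\<nu> + real j + 1)) * inverse (pochhammer (\<nu> + 1) k))"
  let ?S = "{-1/2<..<1/2::real}"
  have D: "((\<lambda>\<nu>. \<Sum>k. ?f k \<nu>) has_real_derivative (\<Sum>k. ?f' k 0)) (at 0)"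
  proof (rule has_field_derivative_series'(2)[where S = ?S and ?x0.0 = 0])
    show "(?f n has_real_derivative ?f' n x) (at x within ?S)" if "x \<in> ?S" for n x
      using that by (intro DERIV_cmult inverse_pochhammer_deriv) auto
    show "uniformly_convergent_on ?S (\<lambda>n x. \<Sum>i<n. ?f' i x)"
    proof (rule Weierstrass_m_test'_ev)
      show "\<forall>\<^sub>F n in sequentially. \<forall>x\<in>?S. norm (?f' n x) \<le> 2 * (inverse (fact n) * (4 * \<bar>q\<bar>) ^ n)"
      proof (intro always_eventually allI ballI)
        fix n x assume "x \<in> ?S"
        then have x: "\<bar>x\<bar> < 1/2" by auto
        have "\<bar>\<Sum>j<n. inverse (x + real j + 1)\<bar> * \<bar>inverse (pochhammer (x + 1) n)\<bar> \<le> (2 * real n) * 2 ^ n"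
          using sum_inverse_shift_bound[OF x, of n] inverse_pochhammer_bound[OF x, of n]
          by (intro mult_mono) auto
        also have "\<dots> \<le> (2 * 2 ^ n) * 2 ^ n"
          using of_nat_less_two_power[of n, where 'a=real] by (intro mult_right_mono) auto
        also have "\<dots> = 2 * 4 ^ n" by (simp add: power_mult_distrib[symmetric])
        finally have "\<bar>\<Sum>j<n. inverse (x + real j + 1)\<bar> * \<bar>inverse (pochhammer (x + 1) n)\<bar> \<le> 2 * 4 ^ n" .
        then have "\<bar>q\<bar> ^ n / fact n * (\<bar>\<Sum>j<n. inverse (x + real j + 1)\<bar> * \<bar>inverse (pochhammer (x + 1) n)\<bar>)
           \<le> \<bar>q\<bar> ^ n / fact n * (2 * 4 ^ n)"
          by (intro mult_left_mono) auto
        then show "norm (?f' n x) \<le> 2 * (inverse (fact n) * (4 * \<bar>q\<bar>) ^ n)"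
          by (simp only: real_norm_def abs_mult abs_minus_cancel abs_divide power_abs abs_of_pos[OF fact_gt_zero])
             (simp add: power_mult_distrib field_simps)
      qed
      show "summable (\<lambda>n. 2 * (inverse (fact n) * (4 * \<bar>q\<bar>) ^ n))"
        by (intro summable_mult summable_exp)
    qed
    show "summable (\<lambda>n. ?f n 0)"
      using summable_bessel_I0_q[of q] by (simp add: pochhammer_fact[symmetric] field_simps power2_eq_square)
  qed auto
  have "?f' k 0 = - (harm k / (fact k)\<^sup>2 * q ^ k)" for k
  proof -
    have "(\<Sum>j<k. inverse (0 + real j + 1)) = harm k"
      by (induction k) (simp_all add: harm_Suc harm_def add_ac)
    then show ?thesis
      by (simp add: pochhammer_fact[symmetric] power2_eq_square field_simps)
  qed
  then have "(\<Sum>k. ?f' k 0) = - bessel_H0_q q"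
    unfolding bessel_H0_q_def by (simp only: suminf_minus[OF summable_bessel_H0_q])
  with D show ?thesis
    unfolding bessel_S_def[abs_def] by (simp only:)
qed

lemma bessel_I_eq:
  assumes x: "x > 0" and nu: "\<bar>\<nu>\<bar> < 1/2"
  shows "bessel_I \<nu> x = rGamma (\<nu> + 1) * (x / 2) powr \<nu> * bessel_S (x\<^sup>2 / 4) \<nu>"
proof -
  have summand: "rGamma (\<nu> + real k + 1) / fact k * (x / 2) powr (\<nu> + 2 * real k) =
     rGamma (\<nu> + 1) * (x / 2) powr \<nu> * ((x\<^sup>2 / 4) ^ k / fact k * inverse (pochhammer (\<nu> + 1) k))" for k
  proof -
    have "pochhammer (\<nu> + 1) k > 0" using nu by (intro pochhammer_pos) (auto simp: abs_less_iff)
    moreover have "rGamma (\<nu> + 1) = pochhammer (\<nu> + 1) k * rGamma (\<nu> + real k + 1)"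
      using pochhammer_rGamma[of "\<nu> + 1" k] by (simp add: add_ac)
    ultimately have 1: "rGamma (\<nu> + real k + 1) = rGamma (\<nu> + 1) * inverse (pochhammer (\<nu> + 1) k)"
      by (simp add: field_simps)
    have "(x / 2) powr (2 * real k) = (x / 2) ^ (2 * k)"
      using x powr_realpow[of "x/2" "2*k"] by simp
    also have "\<dots> = (x\<^sup>2 / 4) ^ k" by (simp add: power_mult power_divide)
    finally show ?thesis unfolding 1 powr_add by simp
  qed
  have sm: "summable (\<lambda>k. (x\<^sup>2 / 4) ^ k / fact k * inverse (pochhammer (\<nu> + 1) k))"
  proof (rule summable_comparison_test[OF _ summable_exp[of "2 * (x\<^sup>2 / 4)"]], intro exI allI impI)
    fix n
    have *: "q ^ n / fact n * 2 ^ n = inverse (fact n) * (2 * q) ^ n" for q :: real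
      by (simp add: power_mult_distrib field_simps)
    have "\<bar>(x\<^sup>2 / 4) ^ n / fact n\<bar> * \<bar>inverse (pochhammer (\<nu> + 1) n)\<bar> \<le> (x\<^sup>2 / 4) ^ n / fact n * 2 ^ n"
      using inverse_pochhammer_bound[OF nu, of n] by (intro mult_mono) auto
    also have "\<dots> = inverse (fact n) * (2 * (x\<^sup>2 / 4)) ^ n"
      using * .
    finally show "norm ((x\<^sup>2 / 4) ^ n / fact n * inverse (pochhammer (\<nu> + 1) n)) \<le> inverse (fact n) * (2 * (x\<^sup>2 / 4)) ^ n"
      by (simp only: real_norm_def abs_mult)
  qed
  show ?thesis
    unfolding bessel_I_def bessel_S_def summand by (rule suminf_mult[OF sm])
qed

text \<open>The product rule for the three factors in \<open>bessel_I_eq\<close>: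
  \<open>rGamma\<close> has derivative \<open>euler_mascheroni\<close> at 1, the power contributes
  ln(x/2), and the series contributes \<open>- bessel_H0_q\<close>.\<close>

lemma bessel_I_deriv_order:
  assumes x: "x > 0"
  shows "((\<lambda>\<nu>. bessel_I \<nu> x) has_real_derivative - K0_series x) (at 0)"
proof -
  have "((\<lambda>\<nu>. rGamma (\<nu> + 1) :: real) has_real_derivative euler_mascheroni) (at 0)"
    using has_field_derivative_rGamma_no_nonpos_int[of "1::real" UNIV]
      DERIV_shift[of "rGamma :: real \<Rightarrow> real" euler_mascheroni 0 1] by (simp add: Digamma_1)
  moreover have "((\<lambda>\<nu>. (x / 2) powr \<nu>) has_real_derivative ln (x / 2)) (at 0)"
    using x by (auto intro!: derivative_eq_intros)
  ultimately have "((\<lambda>\<nu>. rGamma (\<nu> + 1) * (x / 2) powr \<nu> * bessel_S (x\<^sup>2 / 4) \<nu>) has_real_derivative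
      ((euler_mascheroni * (x / 2) powr 0 + ln (x / 2) * rGamma (0 + 1)) * bessel_S (x\<^sup>2 / 4) 0
        + - bessel_H0_q (x\<^sup>2 / 4) * (rGamma (0 + 1) * (x / 2) powr 0))) (at 0)"
    by (intro DERIV_mult bessel_S_deriv)
  also have "bessel_S q 0 = bessel_I0_q q" for q
    unfolding bessel_S_def bessel_I0_q_def
    by (intro suminf_cong) (simp add: pochhammer_fact[symmetric] power2_eq_square field_simps)
  finally have "((\<lambda>\<nu>. rGamma (\<nu> + 1) * (x / 2) powr \<nu> * bessel_S (x\<^sup>2 / 4) \<nu>) has_real_derivative - K0_series x) (at 0)"
    using x by (simp add: K0_series_def)
  moreover have "\<forall>\<^sub>F \<nu> in nhds 0. rGamma (\<nu> + 1) * (x / 2) powr \<nu> * bessel_S (x\<^sup>2 / 4) \<nu> = bessel_I \<nu> x"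
  proof -
    have "\<forall>\<^sub>F \<nu> in nhds 0. \<nu> \<in> {-1/2<..<1/2::real}"
      by (intro eventually_nhds_in_open) auto
    then show ?thesis by eventually_elim (use x in \<open>auto intro!: bessel_I_eq[symmetric]\<close>)
  qed
  ultimately show ?thesis
    by (subst (asm) DERIV_cong_ev[OF refl _ refl]) auto
qed

text \<open>As sin(nu pi) behaves like nu pi, \<open>bessel_K_nonint\<close> is asymptotically half
  the difference quotient at 0 of I_(-nu) - I_nu, whose derivative there is twice
  \<open>K0_series\<close>.\<close>

lemma bessel_K_0:
  assumes x: "x > 0"
  shows "bessel_K 0 x = K0_series x"
proof -
  let ?I = "\<lambda>\<nu>. bessel_I \<nu> x"
  have "((\<lambda>\<nu>. ?I (- \<nu>)) has_real_derivative K0_series x) (at 0)"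
    using DERIV_mirror[of ?I "- K0_series x" 0] bessel_I_deriv_order[OF x]
    by (simp add: DERIV_mirror)
  then have "((\<lambda>\<nu>. ?I (- \<nu>) - ?I \<nu>) has_real_derivative 2 * K0_series x) (at 0)"
    using DERIV_diff[OF _ bessel_I_deriv_order[OF x]] by fastforce
  then have "((\<lambda>\<nu>. (?I (- \<nu>) - ?I \<nu>) / \<nu>) \<longlongrightarrow> 2 * K0_series x) (at 0)"
    by (simp add: has_field_derivative_iff)
  moreover have "((\<lambda>\<nu>. pi * \<nu> / (2 * sin (\<nu> * pi))) \<longlongrightarrow> 1 / 2) (at 0)"
    by real_asymp
  ultimately have "((\<lambda>\<nu>. pi * \<nu> / (2 * sin (\<nu> * pi)) * ((?I (- \<nu>) - ?I \<nu>) / \<nu>)) \<longlongrightarrow> 1/2 * (2 * K0_series x)) (at 0)"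
    by (rule tendsto_mult[rotated])
  then have "((\<lambda>\<nu>. pi * \<nu> / (2 * sin (\<nu> * pi)) * ((?I (- \<nu>) - ?I \<nu>) / \<nu>)) \<longlongrightarrow> K0_series x) (at 0)"
    by simp
  then have "((\<lambda>\<nu>. bessel_K_nonint \<nu> x) \<longlongrightarrow> K0_series x) (at 0)"
    by (rule Lim_transform_eventually) (auto simp: bessel_K_nonint_def eventually_at_filter)
  then show ?thesis
    by (simp add: bessel_K_def tendsto_Lim)
qed

text \<open>With q = x^2/4 one has x d/dx = 2 q d/dq, so \<open>bessel_q_ode\<close> carries over.
  For \<open>K0_series\<close> the inhomogeneous term of the harmonic part becomes 2 P', and
  differentiating the logarithm times P twice produces exactly 2 P' as well. The value
  \<open>P' 0 = 0\<close> serves the asymptotics at 0.\<close>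

lemma bessel_I0_sq_ode:
    "\<exists>P'. P' 0 = 0 \<and> (\<forall>x. ((\<lambda>x. bessel_I0_q (x\<^sup>2 / 4)) has_real_derivative P' x) (at x) \<and>
       ((\<lambda>x. x * P' x) has_real_derivative x * bessel_I0_q (x\<^sup>2 / 4)) (at x))"
  and K0_series_ode:
    "\<exists>L'. \<forall>x>0. (K0_series has_real_derivative L' x) (at x) \<and>
       ((\<lambda>x. x * L' x) has_real_derivative x * K0_series x) (at x)"
proof -
  obtain I' H' where I: "\<And>q. (bessel_I0_q has_real_derivative I' q) (at q)"
    and H: "\<And>q. (bessel_H0_q has_real_derivative H' q) (at q)"
    and I2: "\<And>q. ((\<lambda>q. q * I' q) has_real_derivative bessel_I0_q q) (at q)"
    and H2: "\<And>q. ((\<lambda>q. q * H' q) has_real_derivative bessel_H0_q q + I' q) (at q)"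
    using bessel_q_ode by blast
  have sq: "((\<lambda>x::real. x\<^sup>2 / 4) has_real_derivative x / 2) (at x)" for x
    by (auto intro!: derivative_eq_intros)
  define P where "P = (\<lambda>x. bessel_I0_q (x\<^sup>2 / 4))"
  define T where "T = (\<lambda>x. bessel_H0_q (x\<^sup>2 / 4))"
  define P' where "P' = (\<lambda>x. I' (x\<^sup>2 / 4) * (x / 2))"
  define T' where "T' = (\<lambda>x. H' (x\<^sup>2 / 4) * (x / 2))"
  define L' where "L' = (\<lambda>x. T' x - (P x / x + (euler_mascheroni + ln (x / 2)) * P' x))"
  have P: "(P has_real_derivative P' x) (at x)" for x
    unfolding P_def P'_def by (rule DERIV_chain2[OF I sq])
  have T: "(T has_real_derivative T' x) (at x)" for x
    unfolding T_def T'_def by (rule DERIV_chain2[OF H sq])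
  have P2: "((\<lambda>x. x * P' x) has_real_derivative x * P x) (at x)" for x
  proof -
    have "((\<lambda>x. 2 * (x\<^sup>2 / 4 * I' (x\<^sup>2 / 4))) has_real_derivative 2 * (bessel_I0_q (x\<^sup>2 / 4) * (x / 2))) (at x)"
      by (intro DERIV_cmult DERIV_chain2[OF I2 sq])
    moreover have "(\<lambda>x. 2 * (x\<^sup>2 / 4 * I' (x\<^sup>2 / 4))) = (\<lambda>x. x * P' x)"
      by (simp add: P'_def fun_eq_iff power2_eq_square)
    ultimately show ?thesis by (simp add: P_def mult_ac)
  qed
  have T2: "((\<lambda>x. x * T' x) has_real_derivative x * (T x) + 2 * P' x) (at x)" for x
  proof -
    have "((\<lambda>x. 2 * (x\<^sup>2 / 4 * H' (x\<^sup>2 / 4))) has_real_derivative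
        2 * ((bessel_H0_q (x\<^sup>2 / 4) + I' (x\<^sup>2 / 4)) * (x / 2))) (at x)"
      by (intro DERIV_cmult DERIV_chain2[OF H2 sq])
    moreover have "(\<lambda>x. 2 * (x\<^sup>2 / 4 * H' (x\<^sup>2 / 4))) = (\<lambda>x. x * T' x)"
      by (simp add: T'_def fun_eq_iff power2_eq_square)
    ultimately show ?thesis by (simp add: T_def P'_def algebra_simps)
  qed
  have K0: "K0_series = (\<lambda>x. T x - (euler_mascheroni + ln (x / 2)) * P x)"
    by (simp add: fun_eq_iff K0_series_def T_def P_def)
  have ln: "((\<lambda>x. euler_mascheroni + ln (x / 2)) has_real_derivative 1 / x) (at x)" if "x > 0" for x :: real
    using that by (auto intro!: derivative_eq_intros simp: field_simps)
  have L: "(K0_series has_real_derivative L' x) (at x)" if "x > 0" for x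
  proof -
    have "((\<lambda>x. T x - (euler_mascheroni + ln (x / 2)) * P x) has_real_derivative
        T' x - (1 / x * P x + P' x * (euler_mascheroni + ln (x / 2)))) (at x)"
      by (intro DERIV_diff DERIV_mult T P ln that)
    then show ?thesis by (simp add: K0 L'_def mult_ac)
  qed
  have L2: "((\<lambda>x. x * L' x) has_real_derivative x * K0_series x) (at x)" if "x > 0" for x
  proof -
    have "((\<lambda>x. x * T' x - (P x + (euler_mascheroni + ln (x / 2)) * (x * P' x))) has_real_derivative
        x * (T x) + 2 * P' x - (P' x + (1 / x * (x * P' x) + x * P x * (euler_mascheroni + ln (x / 2))))) (at x)"
      by (intro DERIV_diff DERIV_add DERIV_mult T2 P P2 ln that)
    moreover have "x * (T x) + 2 * P' x - (P' x + (1 / x * (x * P' x) + x * P x * (euler_mascheroni + ln (x / 2)))) = x * K0_series x"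
      using that by (simp add: K0 algebra_simps)
    moreover have "\<forall>\<^sub>F x in nhds x. x * T' x - (P x + (euler_mascheroni + ln (x / 2)) * (x * P' x)) = x * L' x"
    proof -
      have "\<forall>\<^sub>F x in nhds x. x \<in> {0<..}" using that by (intro eventually_nhds_in_open) auto
      then show ?thesis by eventually_elim (simp add: L'_def algebra_simps)
    qed
    ultimately show ?thesis by (subst (asm) DERIV_cong_ev[OF refl _ refl]) auto
  qed
  show "\<exists>P'. P' 0 = 0 \<and> (\<forall>x. ((\<lambda>x. bessel_I0_q (x\<^sup>2 / 4)) has_real_derivative P' x) (at x) \<and>
      ((\<lambda>x. x * P' x) has_real_derivative x * bessel_I0_q (x\<^sup>2 / 4)) (at x))"
    by (intro exI[of _ P'] conjI allI P[unfolded P_def] P2[unfolded P_def]) (simp add: P'_def)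
  show "\<exists>L'. \<forall>x>0. (K0_series has_real_derivative L' x) (at x) \<and>
      ((\<lambda>x. x * L' x) has_real_derivative x * K0_series x) (at x)"
    by (intro exI[of _ L'] conjI allI impI L L2)
qed

section \<open>Identification of the two solutions\<close>

lemma substitution_exp_real_line:
  fixes f :: "real \<Rightarrow> real"
  assumes "c > 0" "d > 0"
    and cont: "\<And>u. u > 0 \<Longrightarrow> isCont f u"
    and nonneg: "\<And>u. u > 0 \<Longrightarrow> f u \<ge> 0"
    and int: "integrable lborel (\<lambda>t. f (d * exp (c * t)) * (c * d * exp (c * t)))"
  shows "integrable lborel (\<lambda>u. indicator {0<..} u * f u)"
    and "(\<integral>u. indicator {0<..} u * f u \<partial>lborel) = (\<integral>t. f (d * exp (c * t)) * (c * d * exp (c * t)) \<partial>lborel)"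
proof -
  let ?g = "\<lambda>t. d * exp (c * t)" and ?g' = "\<lambda>t. c * d * exp (c * t)"
  have A: "((ereal \<circ> ?g \<circ> real_of_ereal) \<longlongrightarrow> 0) (at_right (- \<infinity>))"
    using assms(1,2) unfolding at_right_MInf filterlim_filtermap comp_def zero_ereal_def
    by simp real_asymp
  have B: "((ereal \<circ> ?g \<circ> real_of_ereal) \<longlongrightarrow> \<infinity>) (at_left \<infinity>)"
    using assms(1,2) unfolding at_left_PInf filterlim_filtermap comp_def
    by (simp add: tendsto_PInfty_eq_at_top) real_asymp
  have D: "(?g has_real_derivative ?g' t) (at t)" for t
    by (auto intro!: derivative_eq_intros)
  have int': "set_integrable lborel (einterval (- \<infinity>) \<infinity>) (\<lambda>t. f (?g t) * ?g' t)"
    using int by (simp add: set_integrable_def einterval_def)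
  have *: "set_integrable lborel (einterval 0 \<infinity>) f"
    "(LBINT x=0..\<infinity>. f x) = (LBINT t=-\<infinity>..\<infinity>. f (?g t) * ?g' t)"
    using interval_integral_substitution_nonneg[OF _ D _ _ _ _ A B int'] assms by auto
  show "integrable lborel (\<lambda>u. indicator {0<..} u * f u)"
    using *(1) by (simp add: set_integrable_def einterval_def greaterThan_def zero_ereal_def)
  show "(\<integral>u. indicator {0<..} u * f u \<partial>lborel) = (\<integral>t. f (?g t) * ?g' t \<partial>lborel)"
    using *(2) by (simp add: interval_lebesgue_integral_def set_lebesgue_integral_def
        einterval_def greaterThan_def zero_ereal_def)
qed

lemma has_bochner_integral_exp_half_line:
  assumes "a > (0::real)"
  shows "has_bochner_integral lborel (\<lambda>t. indicator {0..} t * exp (- (a * t))) (1 / a)"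
proof -
  have "(\<integral>\<^sup>+t. ennreal (exp (- (a * t))) * indicator {0..} t \<partial>lborel) = ennreal (0 - (- exp (- (a * 0)) / a))"
  proof (rule nn_integral_FTC_atLeast)
    show "((\<lambda>t. - exp (- (a * t)) / a) \<longlongrightarrow> 0) at_top" using assms by real_asymp
    show "DERIV (\<lambda>t. - exp (- (a * t)) / a) t :> exp (- (a * t))" for t
      using assms by (auto intro!: derivative_eq_intros)
  qed auto
  then have "(\<integral>\<^sup>+t. ennreal (indicator {0..} t * exp (- (a * t))) \<partial>lborel) = ennreal (1 / a)"
    by (simp add: ennreal_mult' mult.commute ennreal_indicator)
  then show ?thesis using assms by (intro has_bochner_integral_nn_integral) auto
qed

lemma has_bochner_integral_exp_neg_half_line:
  assumes "a > (0::real)"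
  shows "has_bochner_integral lborel (\<lambda>t. indicator {..0} t * exp (a * t)) (1 / a)"
proof -
  have "has_bochner_integral lborel (\<lambda>t. indicator {0..} (0 + (-1) * t) * exp (- (a * (0 + (-1) * t)))) ((1 / a) /\<^sub>R \<bar>-1\<bar>)"
    using has_bochner_integral_exp_half_line[OF assms]
    by (subst lborel_has_bochner_integral_real_affine_iff[symmetric]) auto
  moreover have "indicator {0..} (0 + (-1) * t) = (indicator {..0} t :: real)" for t :: real
    by (auto simp: indicator_def)
  ultimately show ?thesis by simp
qed

text \<open>The integral of this kernel is the constant term of \<open>\<Gamma>(\<nu>) = 1/\<nu> - \<gamma> + o(1)\<close> at \<open>0\<close>, after the
  substitution \<open>s = exp t\<close>; it is also the constant term of \<open>K\<^sub>0\<close> at \<open>0\<close>.\<close>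

definition gumbel_kernel :: "real \<Rightarrow> real" where
  "gumbel_kernel t = exp (- exp t) - indicator {..0} t"

lemma borel_measurable_gumbel_kernel [measurable]: "gumbel_kernel \<in> borel_measurable borel"
  unfolding gumbel_kernel_def[abs_def] by measurable

text \<open>The weight dominates exp(\<nu> t) for every \<nu> in [0, 1], so one integrable majorant
  serves for the limit \<nu> to 0. Near minus infinity the decay comes from subtracting the
  indicator, near plus infinity from the double exponential.\<close>

lemma gumbel_kernel_bound: "exp (max 0 t) * \<bar>gumbel_kernel t\<bar> \<le> 2 * exp (- \<bar>t\<bar>)"
proof (cases "t \<le> 0")
  case True
  have "1 - exp t \<le> exp (- exp t)" using exp_ge_add_one_self[of "- exp t"] by simp
  moreover have "exp (- exp t) \<le> 1" by simp
  ultimately have "\<bar>gumbel_kernel t\<bar> \<le> exp t" using True by (simp add: gumbel_kernel_def)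
  moreover have "exp t > 0" by simp
  ultimately have "\<bar>gumbel_kernel t\<bar> \<le> 2 * exp t" by linarith
  with True show ?thesis by (cases "t = 0") (auto simp: max_def)
next
  case False
  have "1 + exp t + (exp t)\<^sup>2 / 2 \<le> exp (exp t)" by (rule exp_lower_Taylor_quadratic) simp
  then have "(exp t)\<^sup>2 / 2 \<le> exp (exp t)" using exp_gt_zero[of t] by linarith
  then have "exp t * exp (- exp t) \<le> 2 * exp (- t)"
    by (simp add: exp_minus field_simps power2_eq_square)
  with False show ?thesis by (simp add: gumbel_kernel_def)
qed

lemma integrable_exp_neg_abs: "integrable lborel (\<lambda>t::real. 2 * exp (- \<bar>t\<bar>))"
proof (rule Bochner_Integration.integrable_bound)
  show "integrable lborel (\<lambda>t::real. 2 * (indicator {0..} t * exp (- (1 * t)) + indicator {..0} t * exp (1 * t)))"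
    using has_bochner_integral_exp_half_line[of 1] has_bochner_integral_exp_neg_half_line[of 1]
    by (intro integrable_mult_right Bochner_Integration.integrable_add) (auto simp: has_bochner_integral_iff)
  show "AE t in lborel. norm (2 * exp (- \<bar>t\<bar>) :: real) \<le>
    norm (2 * (indicator {0..} t * exp (- (1 * t)) + indicator {..0} t * exp (1 * t)))"
  proof (rule AE_I2)
    fix t :: real
    have "exp (- \<bar>t\<bar>) \<le> indicator {0..} t * exp (- (1 * t)) + indicator {..0} t * exp (1 * t)"
      by (cases "t \<ge> 0") (auto simp: indicator_def)
    moreover have "norm (2 * a) \<le> norm (2 * b)" if "0 \<le> a" "a \<le> b" for a b :: real
      using that by simp
    ultimately show "norm (2 * exp (- \<bar>t\<bar>) :: real) \<le> norm (2 * (indicator {0..} t * exp (- (1 * t)) + indicator {..0} t * exp (1 * t)))"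
      by simp
  qed
qed measurable

lemma gumbel_kernel_bound':
  assumes "0 \<le> \<nu>" "\<nu> \<le> 1"
  shows "\<bar>exp (\<nu> * t) * gumbel_kernel t\<bar> \<le> 2 * exp (- \<bar>t\<bar>)"
proof -
  have "\<nu> * t \<le> max 0 t"
  proof (cases "t \<ge> 0")
    case True then show ?thesis using assms mult_right_mono[of \<nu> 1 t] by simp
  next
    case False then show ?thesis using assms by (simp add: mult_nonneg_nonpos)
  qed
  then have "exp (\<nu> * t) * \<bar>gumbel_kernel t\<bar> \<le> exp (max 0 t) * \<bar>gumbel_kernel t\<bar>"
    by (intro mult_right_mono) auto
  with gumbel_kernel_bound[of t] show ?thesis by (simp add: abs_mult)
qed

lemma integrable_gumbel_kernel:
  assumes "0 \<le> \<nu>" "\<nu> \<le> 1"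
  shows "integrable lborel (\<lambda>t. exp (\<nu> * t) * gumbel_kernel t)"
  by (rule Bochner_Integration.integrable_bound[OF integrable_exp_neg_abs])
     (use gumbel_kernel_bound'[OF assms] in auto)

lemma integral_gumbel_kernel:
  assumes "0 < \<nu>" "\<nu> \<le> 1"
  shows "(\<integral>t. exp (\<nu> * t) * gumbel_kernel t \<partial>lborel) = Gamma \<nu> - 1 / \<nu>"
proof -
  have half: "has_bochner_integral lborel (\<lambda>t. indicator {..0} t * exp (\<nu> * t)) (1 / \<nu>)"
    by (rule has_bochner_integral_exp_neg_half_line) fact
  let ?f = "\<lambda>s. s powr (\<nu> - 1) / exp s"
  have eq: "?f (1 * exp (1 * t)) * (1 * 1 * exp (1 * t)) = exp (\<nu> * t) * gumbel_kernel t + indicator {..0} t * exp (\<nu> * t)" for t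
    by (simp add: gumbel_kernel_def powr_def exp_minus field_simps exp_diff exp_add[symmetric])
  have int: "integrable lborel (\<lambda>t. ?f (1 * exp (1 * t)) * (1 * 1 * exp (1 * t)))"
    unfolding eq using half integrable_gumbel_kernel[of \<nu>] assms
    by (intro Bochner_Integration.integrable_add) (auto simp: has_bochner_integral_iff)
  note sub = substitution_exp_real_line[of 1 1 ?f, OF _ _ _ _ int]
  have c: "isCont ?f u" if "u > 0" for u
    using that by (auto intro!: continuous_intros)
  have i: "integrable lborel (\<lambda>u. indicator {0<..} u * ?f u)"
    and e: "(\<integral>u. indicator {0<..} u * ?f u \<partial>lborel) = (\<integral>t. ?f (1 * exp (1 * t)) * (1 * 1 * exp (1 * t)) \<partial>lborel)"
    using sub c by auto
  have "((\<lambda>u. indicator {0<..} u * ?f u) has_integral (\<integral>u. indicator {0<..} u * ?f u \<partial>lborel)) UNIV"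
    using i by (rule has_integral_integral_lborel)
  then have "((\<lambda>u. if u \<in> {0<..} then ?f u else 0) has_integral (\<integral>u. indicator {0<..} u * ?f u \<partial>lborel)) UNIV"
    by (rule has_integral_eq[rotated]) auto
  then have "(?f has_integral (\<integral>u. indicator {0<..} u * ?f u \<partial>lborel)) {0<..}"
    by (simp only: has_integral_restrict_UNIV)
  moreover have "(?f has_integral Gamma \<nu>) {0<..}"
    using Gamma_integral_real[OF assms(1)]
    by (subst (asm) has_integral_spike_set_eq[of _ "{0<..}"]) (auto intro: negligible_subset[of "{0}"])
  ultimately have "(\<integral>u. indicator {0<..} u * ?f u \<partial>lborel) = Gamma \<nu>"
    by (rule has_integral_unique)
  then have "Gamma \<nu> = (\<integral>t. exp (\<nu> * t) * gumbel_kernel t + indicator {..0} t * exp (\<nu> * t) \<partial>lborel)"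
    unfolding e eq by simp
  also have "\<dots> = (\<integral>t. exp (\<nu> * t) * gumbel_kernel t \<partial>lborel) + 1 / \<nu>"
    using half integrable_gumbel_kernel[of \<nu>] assms
    by (subst Bochner_Integration.integral_add) (auto simp: has_bochner_integral_iff)
  finally show ?thesis by simp
qed

text \<open>By the functional equation, Gamma(\<nu>) - 1/\<nu> is the difference quotient of Gamma
  at 1, which tends to Gamma'(1). Along \<nu> = 1/(n+1) the same quantity is an integral of the
  kernel and converges by domination.\<close>

lemma integral_gumbel_kernel_0: "(\<integral>t. gumbel_kernel t \<partial>lborel) = - euler_mascheroni"
proof -
  have "((\<lambda>\<nu>. Gamma (1 + \<nu>)) has_real_derivative - euler_mascheroni) (at 0)"
    using has_field_derivative_Gamma[of "1::real" UNIV]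
      DERIV_shift[of "Gamma :: real \<Rightarrow> real" "- euler_mascheroni" 0 1] by (simp add: Digamma_1 add_ac)
  then have "((\<lambda>\<nu>. (Gamma (1 + \<nu>) - 1) / \<nu>) \<longlongrightarrow> - euler_mascheroni) (at (0::real))"
    by (simp add: has_field_derivative_iff)
  then have "(\<lambda>n. (Gamma (1 + 1 / real (Suc n)) - 1) / (1 / real (Suc n))) \<longlonglongrightarrow> - euler_mascheroni"
  proof (rule filterlim_compose)
    show "filterlim (\<lambda>n. 1 / real (Suc n)) (at 0) sequentially"
      unfolding filterlim_at using LIMSEQ_Suc[OF lim_1_over_n] by auto
  qed
  moreover have "(Gamma (1 + 1 / real (Suc n)) - 1) / (1 / real (Suc n)) =
      (\<integral>t. exp (1 / real (Suc n) * t) * gumbel_kernel t \<partial>lborel)" for n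
  proof -
    have "Gamma (1 / real (Suc n) + 1) = 1 / real (Suc n) * Gamma (1 / real (Suc n))"
      by (rule Gamma_plus1) (auto dest: nonpos_Ints_nonpos)
    then have "(Gamma (1 + 1 / real (Suc n)) - 1) / (1 / real (Suc n)) = Gamma (1 / real (Suc n)) - 1 / (1 / real (Suc n))"
      by (simp add: field_simps add_ac)
    then show ?thesis by (subst integral_gumbel_kernel) auto
  qed
  moreover have "(\<lambda>n. \<integral>t. exp (1 / real (Suc n) * t) * gumbel_kernel t \<partial>lborel) \<longlonglongrightarrow> (\<integral>t. gumbel_kernel t \<partial>lborel)"
  proof (rule integral_dominated_convergence[OF _ _ integrable_exp_neg_abs])
    show "AE t in lborel. (\<lambda>n. exp (1 / real (Suc n) * t) * gumbel_kernel t) \<longlonglongrightarrow> gumbel_kernel t"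
    proof (rule AE_I2)
      fix t
      have "(\<lambda>n. exp (1 / real (Suc n) * t) * gumbel_kernel t) \<longlonglongrightarrow> exp (0 * t) * gumbel_kernel t"
        by (intro tendsto_intros LIMSEQ_Suc[OF lim_1_over_n])
      then show "(\<lambda>n. exp (1 / real (Suc n) * t) * gumbel_kernel t) \<longlonglongrightarrow> gumbel_kernel t" by simp
    qed
    show "AE t in lborel. norm (exp (1 / real (Suc n) * t) * gumbel_kernel t) \<le> 2 * exp (- \<bar>t\<bar>)" for n
      unfolding real_norm_def by (intro AE_I2 gumbel_kernel_bound') auto
  qed auto
  ultimately show ?thesis by (simp add: LIMSEQ_unique)
qed

section \<open>The logarithmic singularity of the integral at 0\<close>

lemma integrable_half_line_exp_exp:
  assumes "y > (0::real)"
  shows "integrable lborel (\<lambda>t. indicator {0..} t * exp (- (y * exp t)))"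
proof (rule Bochner_Integration.integrable_bound)
  show "integrable lborel (\<lambda>t. indicator {0..} t * exp (- (y * t)))"
    using has_bochner_integral_exp_half_line[OF assms] by (simp add: has_bochner_integral_iff)
  show "AE t in lborel. norm (indicator {0..} t * exp (- (y * exp t))) \<le> norm (indicator {0..} t * exp (- (y * t)))"
  proof (rule AE_I2)
    fix t :: real
    have "t \<le> exp t" using exp_ge_add_one_self[of t] by linarith
    then have "y * t \<le> y * exp t" using assms by simp
    then show "norm (indicator {0..} t * exp (- (y * exp t))) \<le> norm (indicator {0..} t * exp (- (y * t)))"
      by (simp add: indicator_def)
  qed
qed measurable

lemma K0_integral_half_line:
  assumes "x > 0"
  shows "integrable lborel (\<lambda>t. indicator {0..} t * exp (- (x * cosh t)))"
    and "K0_integral 0 x = (\<integral>t. indicator {0..} t * exp (- (x * cosh t)) \<partial>lborel)"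
proof -
  let ?e = "\<lambda>t. exp (- (x * cosh t))"
  have meas [measurable]: "?e \<in> borel_measurable borel" unfolding cosh_field_def by measurable
  have int: "integrable lborel ?e" using integrable_cosh_power_exp[OF assms, of 0] by simp
  show i: "integrable lborel (\<lambda>t. indicator {0..} t * ?e t)"
    by (rule Bochner_Integration.integrable_bound[OF int]) (auto simp: indicator_def)
  have i2: "integrable lborel (\<lambda>t. indicator {..<0} t * ?e t)"
    by (rule Bochner_Integration.integrable_bound[OF int]) (auto simp: indicator_def)
  have "(\<integral>t. ?e t \<partial>lborel) = (\<integral>t. indicator {0..} t * ?e t + indicator {..<0} t * ?e t \<partial>lborel)"
    by (intro Bochner_Integration.integral_cong) (auto simp: indicator_def)
  also have "\<dots> = (\<integral>t. indicator {0..} t * ?e t \<partial>lborel) + (\<integral>t. indicator {..<0} t * ?e t \<partial>lborel)"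
    using i i2 by simp
  also have "(\<integral>t. indicator {..<0} t * ?e t \<partial>lborel) = (\<integral>t. indicator {..<0} (0 + -1 * t) * ?e (0 + -1 * t) \<partial>lborel)"
    by (subst lborel_integral_real_affine[of "-1" _ 0]) auto
  also have "\<dots> = (\<integral>t. indicator {0..} t * ?e t \<partial>lborel)"
  proof (rule integral_cong_AE)
    show "AE t in lborel. indicator {..<0} (0 + -1 * t) * ?e (0 + -1 * t) = indicator {0..} t * ?e t"
      using AE_lborel_singleton[of 0] by eventually_elim (auto simp: indicator_def)
  qed measurable
  finally show "K0_integral 0 x = (\<integral>t. indicator {0..} t * ?e t \<partial>lborel)"
    by (simp add: K0_integral_def)
qed

text \<open>On the half line x cosh t splits into (x/2) exp t and (x/2) exp(-t). The exponential of
  the second part, with a minus sign, differs from 1 by at most (x/2) exp(-t), which integrates to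
  x/2.\<close>

lemma K0_integral_approx:
  assumes "x > 0"
  shows "\<bar>K0_integral 0 x - (\<integral>t. indicator {0..} t * exp (- (x / 2 * exp t)) \<partial>lborel)\<bar> \<le> x / 2"
proof -
  have y: "x / 2 > 0" using assms by simp
  note i1 = K0_integral_half_line(1)[OF assms] and i2 = integrable_half_line_exp_exp[OF y]
  have h: "has_bochner_integral lborel (\<lambda>t. x / 2 * (indicator {0..} t * exp (- (1 * t)))) (x / 2 * (1 / 1))"
    by (intro has_bochner_integral_mult_right has_bochner_integral_exp_half_line) simp
  have "\<bar>\<integral>t. indicator {0..} t * exp (- (x * cosh t)) - indicator {0..} t * exp (- (x / 2 * exp t)) \<partial>lborel\<bar>
      \<le> (\<integral>t. x / 2 * (indicator {0..} t * exp (- (1 * t))) \<partial>lborel)"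
  proof (rule integral_abs_bound_integral)
    fix t :: real
    let ?a = "x / 2 * exp t" and ?b = "x / 2 * exp (- t)"
    have e: "exp (- (x * cosh t)) = exp (- ?a) * exp (- ?b)"
      by (simp add: cosh_field_def exp_add[symmetric] field_simps)
    have b: "?b > 0" "?a > 0" using y by auto
    have "1 - ?b \<le> exp (- ?b)" using exp_ge_add_one_self[of "- ?b"] by simp
    then have "\<bar>exp (- ?b) - 1\<bar> \<le> ?b" using b by auto
    then have "exp (- ?a) * \<bar>exp (- ?b) - 1\<bar> \<le> 1 * ?b" using b by (intro mult_mono) auto
    moreover have "\<bar>exp (- ?a) * exp (- ?b) - exp (- ?a)\<bar> = exp (- ?a) * \<bar>exp (- ?b) - 1\<bar>"
    proof -
      have "exp (- ?a) * exp (- ?b) - exp (- ?a) = exp (- ?a) * (exp (- ?b) - 1)" by (simp add: algebra_simps)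
      then show ?thesis by (simp only: abs_mult abs_exp_cancel)
    qed
    ultimately have "\<bar>exp (- (x * cosh t)) - exp (- ?a)\<bar> \<le> x / 2 * exp (- (1 * t))"
      unfolding e mult_1 by linarith
    moreover have "\<bar>indicator {0..} t * A - indicator {0..} t * B\<bar> \<le> x / 2 * (indicator {0..} t * C)"
      if "\<bar>A - B\<bar> \<le> x / 2 * C" for A B C :: real
      using that by (simp add: indicator_def)
    ultimately show "\<bar>indicator {0..} t * exp (- (x * cosh t)) - indicator {0..} t * exp (- ?a)\<bar>
        \<le> x / 2 * (indicator {0..} t * exp (- (1 * t)))"
      by blast
  qed (use i1 i2 h in \<open>auto simp: has_bochner_integral_iff\<close>)
  also have "(\<integral>t. indicator {0..} t * exp (- (x * cosh t)) - indicator {0..} t * exp (- (x / 2 * exp t)) \<partial>lborel)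
     = K0_integral 0 x - (\<integral>t. indicator {0..} t * exp (- (x / 2 * exp t)) \<partial>lborel)"
    using i1 i2 by (simp add: K0_integral_half_line(2)[OF assms])
  also have "(\<integral>t. x / 2 * (indicator {0..} t * exp (- (1 * t))) \<partial>lborel) = x / 2"
    using h by (simp add: has_bochner_integral_iff)
  finally show ?thesis .
qed

text \<open>Shifting t by ln y turns y exp t into exp t and moves the left end to ln y. Subtracting
  the indicator of [ln y, 0] to form the kernel accounts for the logarithm.\<close>

lemma integral_exp_exp_eq:
  assumes "0 < y" "y < 1"
  shows "(\<integral>t. indicator {0..} t * exp (- (y * exp t)) \<partial>lborel) + ln y
           = (\<integral>t. indicator {ln y..} t * gumbel_kernel t \<partial>lborel)"
proof -
  have ly: "ln y < 0" using assms by simp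
  have i: "integrable lborel (\<lambda>t. indicator {ln y..} t * gumbel_kernel t)"
    by (rule Bochner_Integration.integrable_bound[OF integrable_gumbel_kernel[of 0]])
       (auto simp: indicator_def)
  have "(\<integral>t. indicator {0..} t * exp (- (y * exp t)) \<partial>lborel) =
      (\<integral>t. indicator {0..} (- ln y + 1 * t) * exp (- (y * exp (- ln y + 1 * t))) \<partial>lborel)"
    by (subst lborel_integral_real_affine[of 1 _ "- ln y"]) auto
  also have "\<dots> = (\<integral>t. indicator {ln y..} t * gumbel_kernel t + indicator {ln y..0} t \<partial>lborel)"
    using ly assms by (intro Bochner_Integration.integral_cong refl)
      (auto simp: indicator_def gumbel_kernel_def exp_diff)
  also have "\<dots> = (\<integral>t. indicator {ln y..} t * gumbel_kernel t \<partial>lborel) + (\<integral>t. indicator {ln y..0} t \<partial>lborel)"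
    using i ly by (intro Bochner_Integration.integral_add) (auto simp: integrable_indicator_iff)
  also have "(\<integral>t. indicator {ln y..0} t \<partial>lborel) = - ln y"
    using ly by simp
  finally show ?thesis by simp
qed

lemma K0_integral_asymp:
  "((\<lambda>x. K0_integral 0 x + ln (x / 2)) \<longlongrightarrow> - euler_mascheroni) (at_right 0)"
proof -
  have "((\<lambda>x. \<integral>t. indicator {ln (x / 2)..} t * gumbel_kernel t \<partial>lborel) \<longlongrightarrow> - euler_mascheroni) (at_right 0)"
    unfolding tendsto_at_iff_sequentially comp_def
  proof (intro allI impI)
    fix X :: "nat \<Rightarrow> real" assume X: "\<forall>i. X i \<in> {0<..} - {0}" "X \<longlonglongrightarrow> 0"
    have "filterlim (\<lambda>x::real. ln (x / 2)) at_bot (at_right 0)" by real_asymp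
    moreover have "filterlim X (at_right 0) sequentially" using X by (simp add: filterlim_at less_imp_neq[symmetric] del: less_imp_neq)
    ultimately have lim: "filterlim (\<lambda>n. ln (X n / 2)) at_bot sequentially" by (rule filterlim_compose)
    show "(\<lambda>n. \<integral>t. indicator {ln (X n / 2)..} t * gumbel_kernel t \<partial>lborel) \<longlonglongrightarrow> - euler_mascheroni"
      unfolding integral_gumbel_kernel_0[symmetric]
    proof (rule integral_dominated_convergence[where w = "\<lambda>t. \<bar>gumbel_kernel t\<bar>"])
      show "integrable lborel (\<lambda>t. \<bar>gumbel_kernel t\<bar>)"
        using integrable_gumbel_kernel[of 0] by simp
      show "AE t in lborel. (\<lambda>n. indicator {ln (X n / 2)..} t * gumbel_kernel t) \<longlonglongrightarrow> gumbel_kernel t"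
      proof (rule AE_I2)
        fix t
        have "\<forall>\<^sub>F n in sequentially. ln (X n / 2) \<le> t"
          using lim by (simp add: filterlim_at_bot)
        then have "\<forall>\<^sub>F n in sequentially. gumbel_kernel t = indicator {ln (X n / 2)..} t * gumbel_kernel t"
          by eventually_elim simp
        then show "(\<lambda>n. indicator {ln (X n / 2)..} t * gumbel_kernel t) \<longlonglongrightarrow> gumbel_kernel t"
          by (rule Lim_transform_eventually[OF tendsto_const])
      qed
    qed (auto simp: indicator_def)
  qed
  moreover have "((\<lambda>x. K0_integral 0 x + ln (x / 2) - (\<integral>t. indicator {ln (x / 2)..} t * gumbel_kernel t \<partial>lborel)) \<longlongrightarrow> 0) (at_right 0)"
  proof (rule Lim_null_comparison)
    have "\<forall>\<^sub>F x in at_right (0::real). x \<in> {0<..<2}"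
      by (rule eventually_at_right_real) simp
    then show "\<forall>\<^sub>F x in at_right 0. norm (K0_integral 0 x + ln (x / 2) - (\<integral>t. indicator {ln (x / 2)..} t * gumbel_kernel t \<partial>lborel)) \<le> x / 2"
    proof eventually_elim
      case (elim x)
      then show ?case using K0_integral_approx[of x] integral_exp_exp_eq[of "x / 2"]
        unfolding real_norm_def abs_le_iff by simp
    qed
    show "((\<lambda>x::real. x / 2) \<longlongrightarrow> 0) (at_right 0)" by real_asymp
  qed
  ultimately show ?thesis
    using tendsto_add by fastforce
qed

section \<open>The logarithmic singularity of the series at 0\<close>

lemma isCont_bessel_H0_q: "isCont bessel_H0_q q"
proof (rule bessel_q_ode)
  fix I' H' assume "\<And>q. (bessel_H0_q has_real_derivative H' q) (at q)"
  then show ?thesis by (rule DERIV_isCont)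
qed

lemma bessel_I0_q_0 [simp]: "bessel_I0_q 0 = 1" and bessel_H0_q_0 [simp]: "bessel_H0_q 0 = 0"
  using powser_zero[of "\<lambda>k. 1 / (fact k)\<^sup>2 :: real"] powser_zero[of "\<lambda>k. harm k / (fact k)\<^sup>2 :: real"]
  by (simp_all add: bessel_I0_q_def bessel_H0_q_def harm_def)

lemma bessel_I0_q_ge_1:
  assumes "q \<ge> 0"
  shows "bessel_I0_q q \<ge> 1"
  using sum_le_suminf[OF summable_bessel_I0_q[of q], of "{0}"] assms
  by (simp add: bessel_I0_q_def)

text \<open>The delicate term is (I_0(x) - 1) ln(x/2). It is written as ((I_0(x) - 1)/x) * (x
  ln(x/2)), where both factors tend to 0, the first because I_0 has derivative 0 at 0.\<close>

lemma K0_series_asymp: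
  "((\<lambda>x. K0_series x + ln (x / 2)) \<longlongrightarrow> - euler_mascheroni) (at_right 0)"
proof -
  obtain P' where "P' 0 = 0 \<and> (\<forall>x. ((\<lambda>x. bessel_I0_q (x\<^sup>2 / 4)) has_real_derivative P' x) (at x) \<and>
     ((\<lambda>x. x * P' x) has_real_derivative x * bessel_I0_q (x\<^sup>2 / 4)) (at x))"
    using bessel_I0_sq_ode ..
  then have P: "\<And>x. ((\<lambda>x. bessel_I0_q (x\<^sup>2 / 4)) has_real_derivative P' x) (at x)" and "P' 0 = 0"
    by auto
  then have "((\<lambda>x. (bessel_I0_q (x\<^sup>2 / 4) - 1) / x) \<longlongrightarrow> 0) (at 0)"
    using P[of 0] by (simp add: has_field_derivative_iff)
  then have 1: "((\<lambda>x. (bessel_I0_q (x\<^sup>2 / 4) - 1) / x) \<longlongrightarrow> 0) (at_right 0)"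
    by (rule tendsto_mono[rotated]) (simp add: at_le)
  have 2: "((\<lambda>x::real. x * ln (x / 2)) \<longlongrightarrow> 0) (at_right 0)" by real_asymp
  have I: "((\<lambda>x. bessel_I0_q (x\<^sup>2 / 4)) \<longlongrightarrow> 1) (at_right 0)"
    using DERIV_isCont[OF P, of 0] by (auto simp: isCont_def intro: tendsto_mono[rotated] at_le)
  have "isCont (\<lambda>x::real. bessel_H0_q (x\<^sup>2 / 4)) 0"
    by (rule isCont_o2[OF _ isCont_bessel_H0_q]) (intro continuous_intros, simp)
  then have T: "((\<lambda>x. bessel_H0_q (x\<^sup>2 / 4)) \<longlongrightarrow> 0) (at_right 0)"
    by (auto simp: isCont_def intro: tendsto_mono[rotated] at_le)
  have "((\<lambda>x. bessel_H0_q (x\<^sup>2 / 4) - euler_mascheroni * bessel_I0_q (x\<^sup>2 / 4)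
      - (bessel_I0_q (x\<^sup>2 / 4) - 1) / x * (x * ln (x / 2))) \<longlongrightarrow> 0 - euler_mascheroni * 1 - 0 * 0) (at_right 0)"
    by (intro tendsto_intros T I 1 2)
  moreover have "\<forall>\<^sub>F x in at_right (0::real). x \<in> {0<..<1}"
    by (rule eventually_at_right_real) simp
  then have "\<forall>\<^sub>F x in at_right 0. bessel_H0_q (x\<^sup>2 / 4) - euler_mascheroni * bessel_I0_q (x\<^sup>2 / 4)
      - (bessel_I0_q (x\<^sup>2 / 4) - 1) / x * (x * ln (x / 2)) = K0_series x + ln (x / 2)"
    by eventually_elim (simp add: K0_series_def field_simps)
  ultimately show ?thesis
    using Lim_transform_eventually by fastforce
qed

section \<open>Uniqueness through the Wronskian with I_0\<close>

text \<open>The derivative of \<open>D / P\<close> is \<open>w / (x P\<^sup>2)\<close>, so a positive Wronskian would make \<open>D\<close> tend to \<open>-\<infinity>\<close>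
  logarithmically at \<open>0\<close>.\<close>

lemma bessel_ode_wronskian_nonpos:
  assumes D: "\<And>x. x > 0 \<Longrightarrow> (D has_real_derivative D' x) (at x)"
    and P: "\<And>x. (P has_real_derivative P' x) (at x)"
    and lim: "(D \<longlongrightarrow> 0) (at_right 0)"
    and P1: "\<And>x. P x \<ge> (1::real)"
    and w: "\<And>x. x > 0 \<Longrightarrow> x * D' x * P x - D x * (x * P' x) = w"
  shows "w \<le> 0"
proof (rule ccontr)
  assume "\<not> w \<le> 0"
  then have w0: "w > 0" by simp
  have "continuous_on {0..1} P" using P DERIV_isCont continuous_at_imp_continuous_on by blast
  then have "\<exists>x\<in>{0..1::real}. \<forall>y\<in>{0..1}. P y \<le> P x"
    by (intro continuous_attains_sup) auto
  then obtain C where C: "\<And>x. x \<in> {0..1} \<Longrightarrow> P x \<le> C" by blast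
  have C1: "C \<ge> 1" using C[of 0] P1[of 0] by simp
  have Ppos: "P x > 0" for x using P1[of x] by linarith
  have mono: "D x / P x - w / C\<^sup>2 * ln x \<le> D 1 / P 1 - w / C\<^sup>2 * ln 1" if "0 < x" "x < 1" for x
  proof (rule DERIV_nonneg_imp_nondecreasing[where f = "\<lambda>x. D x / P x - w / C\<^sup>2 * ln x"])
    fix y assume y: "x \<le> y" "y \<le> 1"
    then have y0: "y > 0" using that by simp
    have "((\<lambda>x. D x / P x - w / C\<^sup>2 * ln x) has_real_derivative
        (D' y * P y - D y * P' y) / (P y * P y) - w / C\<^sup>2 * (1 / y)) (at y)"
      using y0 Ppos[of y] by (intro DERIV_diff DERIV_divide D P DERIV_cmult DERIV_ln_divide) auto
    moreover have "0 \<le> (D' y * P y - D y * P' y) / (P y * P y) - w / C\<^sup>2 * (1 / y)"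
    proof -
      have e: "D' y * P y - D y * P' y = w / y" using w[OF y0] y0 by (simp add: field_simps)
      have "P y * P y \<le> C\<^sup>2" using C[of y] y y0 Ppos[of y] by (simp add: power2_eq_square mult_mono)
      then have "w / y / C\<^sup>2 \<le> w / y / (P y * P y)"
        using w0 y0 Ppos[of y] C1 by (intro divide_left_mono) auto
      then show ?thesis unfolding e by (simp add: mult.commute)
    qed
    ultimately show "\<exists>d. ((\<lambda>x. D x / P x - w / C\<^sup>2 * ln x) has_real_derivative d) (at y) \<and> 0 \<le> d" by blast
  qed (use that in simp)
  have PC: "isCont P 0" using P by (rule DERIV_isCont)
  have "((\<lambda>x. D x / P x) \<longlongrightarrow> 0 / P 0) (at_right 0)"
    using PC Ppos[of 0] by (intro tendsto_divide lim) (auto simp: isCont_def intro: tendsto_mono[rotated] at_le)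
  moreover have "filterlim (\<lambda>x::real. ln x) at_bot (at_right 0)" by real_asymp
  ultimately have "\<forall>\<^sub>F x in at_right 0. D x / P x > -1" "\<forall>\<^sub>F x in at_right 0. ln x \<le> (- 2 - \<bar>D 1 / P 1\<bar>) / (w / C\<^sup>2)"
    by (auto simp: order_tendsto_iff filterlim_at_bot)
  moreover have "\<forall>\<^sub>F x in at_right (0::real). x \<in> {0<..<1}"
    by (rule eventually_at_right_real) simp
  ultimately have "\<forall>\<^sub>F x in at_right (0::real). False"
  proof eventually_elim
    case (elim x)
    have "w / C\<^sup>2 * ln x \<le> - 2 - \<bar>D 1 / P 1\<bar>"
      using elim(2) w0 C1 by (simp add: field_simps)
    moreover have "D x / P x - w / C\<^sup>2 * ln x \<le> D 1 / P 1"
      using mono[of x] elim(3) by simp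
    ultimately show ?case using elim(1) abs_ge_self[of "D 1 / P 1"] by linarith
  qed
  then show False by simp
qed

text \<open>The Wronskian with I_0 is constant; applying \<open>bessel_ode_wronskian_nonpos\<close>
  to D and to -D forces it to be 0. Then D is a multiple of I_0, and since D tends to 0 while I_0(0)
  = 1, the multiple is 0.\<close>

lemma bessel_ode_vanish:
  assumes D: "\<And>x. x > 0 \<Longrightarrow> (D has_real_derivative D' x) (at x)"
    and D2: "\<And>x. x > 0 \<Longrightarrow> ((\<lambda>x. x * D' x) has_real_derivative x * D x) (at x)"
    and lim: "(D \<longlongrightarrow> 0) (at_right 0)"
    and x: "x > 0"
  shows "D x = 0"
proof -
  define P where "P = (\<lambda>x. bessel_I0_q (x\<^sup>2 / 4))"
  obtain P' where "P' 0 = 0 \<and> (\<forall>x. (P has_real_derivative P' x) (at x) \<and>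
     ((\<lambda>x. x * P' x) has_real_derivative x * P x) (at x))"
    using bessel_I0_sq_ode unfolding P_def ..
  then have P: "\<And>x. (P has_real_derivative P' x) (at x)"
    and P2: "\<And>x. ((\<lambda>x. x * P' x) has_real_derivative x * P x) (at x)"
    by auto
  have P1: "P x \<ge> 1" for x unfolding P_def by (rule bessel_I0_q_ge_1) simp
  have Ppos: "P x > 0" for x using P1[of x] by linarith
  have "((\<lambda>x. x * D' x * P x - D x * (x * P' x)) has_real_derivative 0) (at x)" if "x > 0" for x
  proof -
    have "((\<lambda>x. x * D' x * P x - D x * (x * P' x)) has_real_derivative
      (x * D x * P x + P' x * (x * D' x)) - (D' x * (x * P' x) + x * P x * D x)) (at x)"
      by (intro DERIV_diff DERIV_mult D D2 P P2 that)
    then show ?thesis by (simp add: mult_ac)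
  qed
  then have "\<exists>w. \<forall>x\<in>{0<..}. x * D' x * P x - D x * (x * P' x) = w"
    by (intro has_field_derivative_zero_constant) (auto intro: has_field_derivative_at_within)
  then obtain w where w: "\<And>x. x > 0 \<Longrightarrow> x * D' x * P x - D x * (x * P' x) = w" by auto
  have "w \<le> 0" by (rule bessel_ode_wronskian_nonpos[OF D P lim P1 w])
  moreover have "- w \<le> 0"
  proof (rule bessel_ode_wronskian_nonpos[OF _ P _ P1])
    show "((\<lambda>x. - D x) has_real_derivative - D' x) (at x)" if "x > 0" for x
      using D[OF that] by (rule DERIV_minus)
    show "((\<lambda>x. - D x) \<longlongrightarrow> 0) (at_right 0)" using tendsto_minus[OF lim] by simp
    show "x * (- D' x) * P x - (- D x) * (x * P' x) = - w" if "x > 0" for x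
      using w[OF that] by simp
  qed
  ultimately have w0: "w = 0" by simp
  have "((\<lambda>x. D x / P x) has_real_derivative 0) (at x)" if "x > 0" for x
  proof -
    have "((\<lambda>x. D x / P x) has_real_derivative (D' x * P x - D x * P' x) / (P x * P x)) (at x)"
      using Ppos[of x] that by (intro DERIV_divide D P) auto
    moreover have "D' x * P x - D x * P' x = 0"
    proof -
      have "x * (D' x * P x - D x * P' x) = 0" using w[OF that] w0 by (simp add: algebra_simps)
      then show ?thesis using that by simp
    qed
    ultimately show ?thesis by simp
  qed
  then have "\<exists>c. \<forall>x\<in>{0<..}. D x / P x = c"
    by (intro has_field_derivative_zero_constant) (auto intro: has_field_derivative_at_within)
  then obtain c where c: "\<And>x. x > 0 \<Longrightarrow> D x / P x = c" by auto
  have "((\<lambda>x. D x / P x) \<longlongrightarrow> 0 / P 0) (at_right 0)"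
    using DERIV_isCont[OF P, of 0] Ppos[of 0]
    by (intro tendsto_divide lim) (auto simp: isCont_def intro: tendsto_mono[rotated] at_le)
  moreover have "((\<lambda>x. D x / P x) \<longlongrightarrow> c) (at_right 0)"
  proof (rule Lim_transform_eventually[OF tendsto_const])
    have "\<forall>\<^sub>F x in at_right (0::real). x \<in> {0<..<1}"
      by (rule eventually_at_right_real) simp
    then show "\<forall>\<^sub>F x in at_right 0. c = D x / P x" by eventually_elim (simp add: c)
  qed
  ultimately have "c = 0" using tendsto_unique[of "at_right (0::real)"] by fastforce
  then show "D x = 0" using c[OF x] Ppos[of x] by simp
qed

lemma bessel_K_0_integral:
  assumes x: "x > 0"
  shows "bessel_K 0 x = K0_integral 0 x"
proof -
  obtain L' where "\<forall>x>0. (K0_series has_real_derivative L' x) (at x) \<and>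
      ((\<lambda>x. x * L' x) has_real_derivative x * K0_series x) (at x)"
    using K0_series_ode ..
  then have L: "\<And>x. x > 0 \<Longrightarrow> (K0_series has_real_derivative L' x) (at x)"
    and L2: "\<And>x. x > 0 \<Longrightarrow> ((\<lambda>x. x * L' x) has_real_derivative x * K0_series x) (at x)"
    by auto
  have "K0_integral 0 x - K0_series x = 0"
  proof (rule bessel_ode_vanish[OF _ _ _ x])
    show "((\<lambda>x. K0_integral 0 x - K0_series x) has_real_derivative - K0_integral 1 x - L' x) (at x)" if "x > 0" for x
      using K0_integral_deriv[OF that, of 0] L[OF that] by (auto intro: DERIV_diff)
    show "((\<lambda>x. x * (- K0_integral 1 x - L' x)) has_real_derivative x * (K0_integral 0 x - K0_series x)) (at x)"
      if "x > 0" for x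
    proof -
      have "((\<lambda>x. - (x * K0_integral 1 x) - x * L' x) has_real_derivative
          - (1 * K0_integral 1 x + - K0_integral (Suc 1) x * x) - x * K0_series x) (at x)"
        by (intro DERIV_diff DERIV_minus DERIV_mult DERIV_ident K0_integral_deriv L2 that) auto
      moreover have "- (1 * K0_integral 1 x + - K0_integral (Suc 1) x * x) - x * K0_series x = x * (K0_integral 0 x - K0_series x)"
        using K0_integral_ode[OF that] by (simp add: algebra_simps numeral_2_eq_2)
      moreover have "(\<lambda>x. - (x * K0_integral 1 x) - x * L' x) = (\<lambda>x. x * (- K0_integral 1 x - L' x))"
        by (simp add: fun_eq_iff algebra_simps)
      ultimately show ?thesis by simp
    qed
    show "((\<lambda>x. K0_integral 0 x - K0_series x) \<longlongrightarrow> 0) (at_right 0)"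
      using tendsto_diff[OF K0_integral_asymp K0_series_asymp] by simp
  qed
  with bessel_K_0[OF x] show ?thesis by simp
qed

section \<open>The product of two normal variables\<close>

text \<open>The substitution u = sqrt x * exp(t/2) balances the two squares: u^2 + x^2/u^2 = 2 x
  cosh t, and du/u = dt/2 supplies the factor 1/2 of \<open>K0_integral\<close>.\<close>

lemma K0_substitution:
  assumes x: "x > 0"
  shows "(\<integral>\<^sup>+u. indicator {0<..} u * ennreal (exp (- (u\<^sup>2 + x\<^sup>2 / u\<^sup>2) / 2) / u) \<partial>lborel) = ennreal (K0_integral 0 x)"
proof -
  let ?f = "\<lambda>u. exp (- (u\<^sup>2 + x\<^sup>2 / u\<^sup>2) / 2) / u"
  let ?g = "\<lambda>t. sqrt x * exp (1/2 * t)"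
  have eq: "?f (?g t) * (1/2 * sqrt x * exp (1/2 * t)) = exp (- (x * cosh t)) / 2" for t
  proof -
    have 1: "(?g t)\<^sup>2 = x * exp t"
      using x by (simp add: power_mult_distrib exp_double[symmetric])
    have 2: "x\<^sup>2 / (x * exp t) = x * exp (- t)"
      using x by (simp add: exp_minus field_simps power2_eq_square)
    have "?f (?g t) = exp (- (x * cosh t)) / ?g t"
      unfolding 1 2 by (simp add: cosh_field_def field_simps)
    then show ?thesis using x by simp
  qed
  have int: "integrable lborel (\<lambda>t. ?f (?g t) * (1/2 * sqrt x * exp (1/2 * t)))"
    unfolding eq using integrable_cosh_power_exp[OF x, of 0] by simp
  have cont: "isCont ?f u" if "u > 0" for u
    using that by (intro continuous_intros) auto
  have "integrable lborel (\<lambda>u. indicator {0<..} u * ?f u)"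
    "(\<integral>u. indicator {0<..} u * ?f u \<partial>lborel) = (\<integral>t. ?f (?g t) * (1/2 * sqrt x * exp (1/2 * t)) \<partial>lborel)"
    using substitution_exp_real_line[of "1/2" "sqrt x" ?f, OF _ _ cont _ int] x by auto
  moreover have "(\<integral>t. ?f (?g t) * (1/2 * sqrt x * exp (1/2 * t)) \<partial>lborel) = K0_integral 0 x"
    unfolding eq by (simp add: K0_integral_def)
  ultimately have "(\<integral>\<^sup>+u. ennreal (indicator {0<..} u * ?f u) \<partial>lborel) = ennreal (K0_integral 0 x)"
    by (subst nn_integral_eq_integral) (auto simp: indicator_def)
  moreover have "ennreal (indicator {0<..} u * ?f u) = indicator {0<..} u * ennreal (?f u)" for u
    by (simp add: indicator_def)
  ultimately show ?thesis by (simp only:)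
qed

lemma nn_integral_even:
  fixes f :: "real \<Rightarrow> ennreal"
  assumes [measurable]: "f \<in> borel_measurable borel" and even: "\<And>u. f (- u) = f u"
  shows "(\<integral>\<^sup>+u. f u \<partial>lborel) = 2 * (\<integral>\<^sup>+u. indicator {0<..} u * f u \<partial>lborel)"
proof -
  have "(\<integral>\<^sup>+u. f u \<partial>lborel) = (\<integral>\<^sup>+u. indicator {0<..} u * f u + indicator {..<0} u * f u \<partial>lborel)"
  proof (rule nn_integral_cong_AE)
    show "AE u in lborel. f u = indicator {0<..} u * f u + indicator {..<0} u * f u"
      using AE_lborel_singleton[of 0] by eventually_elim (auto simp: indicator_def)
  qed
  also have "\<dots> = (\<integral>\<^sup>+u. indicator {0<..} u * f u \<partial>lborel) + (\<integral>\<^sup>+u. indicator {..<0} u * f u \<partial>lborel)"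
    by (intro nn_integral_add) auto
  also have "(\<integral>\<^sup>+u. indicator {..<0} u * f u \<partial>lborel) = (\<integral>\<^sup>+u. indicator {..<0} (0 + -1 * u) * f (0 + -1 * u) \<partial>lborel)"
    by (subst nn_integral_real_affine[of _ "-1" 0]) auto
  also have "\<dots> = (\<integral>\<^sup>+u. indicator {0<..} u * f u \<partial>lborel)"
    by (intro nn_integral_cong) (auto simp: even indicator_def)
  finally show ?thesis by (simp add: mult_2)
qed

text \<open>The integrand is the density of N N' at x conditionally on N = u, weighted by the
  density of N. At x = 0 the integral diverges, hence the restriction.\<close>

lemma normal_product_density:
  assumes x: "x \<noteq> 0"
  shows "(\<integral>\<^sup>+u. ennreal (std_normal_density u * std_normal_density (x / u) / \<bar>u\<bar>) \<partial>lborel)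
           = ennreal (1 / pi * bessel_K 0 \<bar>x\<bar>)"
proof -
  have "(\<integral>\<^sup>+u. ennreal (std_normal_density u * std_normal_density (x / u) / \<bar>u\<bar>) \<partial>lborel)
     = 2 * (\<integral>\<^sup>+u. indicator {0<..} u * ennreal (std_normal_density u * std_normal_density (x / u) / \<bar>u\<bar>) \<partial>lborel)"
    by (intro nn_integral_even) (auto simp: std_normal_density_def power_divide)
  also have "\<dots> = 2 * (\<integral>\<^sup>+u. ennreal (1 / (2 * pi)) * (indicator {0<..} u * ennreal (exp (- (u\<^sup>2 + \<bar>x\<bar>\<^sup>2 / u\<^sup>2) / 2) / u)) \<partial>lborel)"
  proof (intro arg_cong[where f = "\<lambda>z. 2 * z"] nn_integral_cong)
    fix u :: real
    have "std_normal_density u * std_normal_density (x / u) / \<bar>u\<bar> = 1 / (2 * pi) * (exp (- (u\<^sup>2 + \<bar>x\<bar>\<^sup>2 / u\<^sup>2) / 2) / u)"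
      if "u > 0"
    proof -
      have "exp (- u\<^sup>2 / 2) * exp (- (x / u)\<^sup>2 / 2) = exp (- (u\<^sup>2 + \<bar>x\<bar>\<^sup>2 / u\<^sup>2) / 2)"
        by (simp add: exp_add[symmetric] power_divide field_simps)
      then show ?thesis using that
        by (simp add: std_normal_density_def real_sqrt_mult[symmetric] field_simps)
    qed
    then show "indicator {0<..} u * ennreal (std_normal_density u * std_normal_density (x / u) / \<bar>u\<bar>)
      = ennreal (1 / (2 * pi)) * (indicator {0<..} u * ennreal (exp (- (u\<^sup>2 + \<bar>x\<bar>\<^sup>2 / u\<^sup>2) / 2) / u))"
      by (auto simp: indicator_def ennreal_mult'[symmetric])
  qed
  also have "\<dots> = 2 * (ennreal (1 / (2 * pi)) * ennreal (K0_integral 0 \<bar>x\<bar>))"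
    using K0_substitution[of "\<bar>x\<bar>"] x by (subst nn_integral_cmult) auto
  also have "\<dots> = ennreal (2 * (1 / (2 * pi) * K0_integral 0 \<bar>x\<bar>))"
    by (subst ennreal_mult'[symmetric], simp, subst ennreal_numeral[symmetric], subst ennreal_mult'[symmetric]) auto
  also have "2 * (1 / (2 * pi) * K0_integral 0 \<bar>x\<bar>) = 1 / pi * bessel_K 0 \<bar>x\<bar>"
    using x by (simp add: bessel_K_0_integral)
  finally show ?thesis .
qed

abbreviation std_normal :: "real measure" where
  "std_normal \<equiv> density lborel (\<lambda>x. ennreal (std_normal_density x))"

lemma VG_law_eq:
  "VG_law = distr (std_normal \<Otimes>\<^sub>M std_normal) borel (\<lambda>(u, v). u * v)"
proof (rule measure_eqI)
  show "sets VG_law = sets (distr (std_normal \<Otimes>\<^sub>M std_normal) borel (\<lambda>(u, v). u * v))"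
    by (simp add: VG_law_def)
next
  fix A assume "A \<in> sets VG_law"
  then have A [measurable]: "A \<in> sets borel" by (simp add: VG_law_def)
  let ?\<phi> = std_normal_density
  interpret N: prob_space std_normal by (rule prob_space_normal_density) simp
  have meas: "(\<lambda>(u, v). u * v :: real) \<in> measurable (std_normal \<Otimes>\<^sub>M std_normal) borel"
    by measurable
  have dens: "(\<lambda>x. ennreal (1 / pi * bessel_K 0 \<bar>x\<bar>)) \<in> borel_measurable lborel"
  proof -
    \<comment> \<open>The definition of \<open>bessel_K\<close> by a limit gives no direct access to
      measurability; away from 0 it is read off from the parameter integral.\<close>
    have "(\<lambda>x. if x = 0 then ennreal (1 / pi * bessel_K 0 \<bar>0\<bar>) else
        (\<integral>\<^sup>+u. ennreal (?\<phi> u * ?\<phi> (x / u) / \<bar>u\<bar>) \<partial>lborel)) \<in> borel_measurable lborel"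
      by measurable
    also have "(\<lambda>x. if x = 0 then ennreal (1 / pi * bessel_K 0 \<bar>0\<bar>) else
        (\<integral>\<^sup>+u. ennreal (?\<phi> u * ?\<phi> (x / u) / \<bar>u\<bar>) \<partial>lborel)) = (\<lambda>x. ennreal (1 / pi * bessel_K 0 \<bar>x\<bar>))"
      by (auto simp: fun_eq_iff normal_product_density)
    finally show ?thesis .
  qed
  have "emeasure (distr (std_normal \<Otimes>\<^sub>M std_normal) borel (\<lambda>(u, v). u * v)) A
     = (\<integral>\<^sup>+z. indicator A (case z of (u, v) \<Rightarrow> u * v) \<partial>(std_normal \<Otimes>\<^sub>M std_normal))"
    using nn_integral_distr[OF meas, of "indicator A"] by simp
  also have "\<dots> = (\<integral>\<^sup>+u. \<integral>\<^sup>+v. indicator A (u * v) \<partial>std_normal \<partial>std_normal)"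
    by (subst N.nn_integral_fst[symmetric]) auto
  also have "\<dots> = (\<integral>\<^sup>+u. ennreal (?\<phi> u) * (\<integral>\<^sup>+v. ennreal (?\<phi> v) * indicator A (u * v) \<partial>lborel) \<partial>lborel)"
    by (simp add: nn_integral_density)
  also have "\<dots> = (\<integral>\<^sup>+u. \<integral>\<^sup>+x. ennreal (?\<phi> u * ?\<phi> (x / u) / \<bar>u\<bar>) * indicator A x \<partial>lborel \<partial>lborel)"
  proof (rule nn_integral_cong_AE)
    show "AE u in lborel. ennreal (?\<phi> u) * (\<integral>\<^sup>+v. ennreal (?\<phi> v) * indicator A (u * v) \<partial>lborel)
       = (\<integral>\<^sup>+x. ennreal (?\<phi> u * ?\<phi> (x / u) / \<bar>u\<bar>) * indicator A x \<partial>lborel)"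
      using AE_lborel_singleton[of 0]
    proof eventually_elim
      case (elim u)
      have "(\<integral>\<^sup>+v. ennreal (?\<phi> v) * indicator A (u * v) \<partial>lborel)
        = ennreal \<bar>1 / u\<bar> * (\<integral>\<^sup>+x. ennreal (?\<phi> (0 + 1 / u * x)) * indicator A (u * (0 + 1 / u * x)) \<partial>lborel)"
        using elim by (intro nn_integral_real_affine) auto
      also have "\<dots> = ennreal \<bar>1 / u\<bar> * (\<integral>\<^sup>+x. ennreal (?\<phi> (x / u)) * indicator A x \<partial>lborel)"
        using elim by simp
      finally have "ennreal (?\<phi> u) * (\<integral>\<^sup>+v. ennreal (?\<phi> v) * indicator A (u * v) \<partial>lborel)
        = (\<integral>\<^sup>+x. ennreal (?\<phi> u) * (ennreal \<bar>1 / u\<bar> * (ennreal (?\<phi> (x / u)) * indicator A x)) \<partial>lborel)"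
        by (simp add: nn_integral_cmult)
      also have "\<dots> = (\<integral>\<^sup>+x. ennreal (?\<phi> u * ?\<phi> (x / u) / \<bar>u\<bar>) * indicator A x \<partial>lborel)"
        by (intro nn_integral_cong) (auto simp: indicator_def ennreal_mult'[symmetric] field_simps)
      finally show ?case .
    qed
  qed
  also have "\<dots> = (\<integral>\<^sup>+x. \<integral>\<^sup>+u. ennreal (?\<phi> u * ?\<phi> (x / u) / \<bar>u\<bar>) * indicator A x \<partial>lborel \<partial>lborel)"
    by (rule lborel_pair.Fubini') measurable
  also have "\<dots> = (\<integral>\<^sup>+x. (\<integral>\<^sup>+u. ennreal (?\<phi> u * ?\<phi> (x / u) / \<bar>u\<bar>) \<partial>lborel) * indicator A x \<partial>lborel)"
    by (intro nn_integral_cong nn_integral_multc) auto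
  also have "\<dots> = (\<integral>\<^sup>+x. ennreal (1 / pi * bessel_K 0 \<bar>x\<bar>) * indicator A x \<partial>lborel)"
  proof (rule nn_integral_cong_AE)
    show "AE x in lborel. (\<integral>\<^sup>+u. ennreal (?\<phi> u * ?\<phi> (x / u) / \<bar>u\<bar>) \<partial>lborel) * indicator A x
        = ennreal (1 / pi * bessel_K 0 \<bar>x\<bar>) * indicator A x"
      using AE_lborel_singleton[of 0] by eventually_elim (rule arg_cong[OF normal_product_density])
  qed
  also have "\<dots> = emeasure VG_law A"
    unfolding VG_law_def using dens by (subst emeasure_density) auto
  finally show "emeasure VG_law A = emeasure (distr (std_normal \<Otimes>\<^sub>M std_normal) borel (\<lambda>(u, v). u * v)) A" ..
qed

section \<open>Stein's equation for the normal law\<close>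

text \<open>\<open>(g x - R / x0) exp (- x\<^sup>2 / 2)\<close> is increasing to the right of \<open>x0\<close> and tends to \<open>0\<close>.\<close>

lemma stein_growth_bound:
  fixes g r :: "real \<Rightarrow> real"
  assumes g: "\<And>x. (g has_real_derivative x * g x + r x) (at x)"
    and r: "\<And>x. \<bar>r x\<bar> \<le> R" and K: "\<And>x. \<bar>g x\<bar> \<le> K" and x0: "x0 > 0"
  shows "g x0 \<le> R / x0"
proof -
  let ?G = "\<lambda>x. (g x - R / x0) * exp (- (x\<^sup>2 / 2))"
  have R0: "R \<ge> 0" using r[of 0] abs_ge_zero[of "r 0"] by linarith
  have mono: "?G x0 \<le> ?G y" if "x0 \<le> y" for y
  proof (rule DERIV_nonneg_imp_nondecreasing[where f = ?G, OF that])
    fix x assume x: "x0 \<le> x" "x \<le> y"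
    have alg: "(x * a + b - 0) * e + e * - x * (a - d) = (b + x * d) * e" for a b d e :: real
      by (simp add: algebra_simps)
    have D: "(?G has_real_derivative (x * g x + r x - 0) * exp (- (x\<^sup>2 / 2)) +
        exp (- (x\<^sup>2 / 2)) * - x * (g x - R / x0)) (at x)"
      by (intro DERIV_mult DERIV_diff g DERIV_const) (auto intro!: derivative_eq_intros)
    have E: "(x * g x + r x - 0) * exp (- (x\<^sup>2 / 2)) + exp (- (x\<^sup>2 / 2)) * - x * (g x - R / x0)
        = (r x + R * (x / x0)) * exp (- (x\<^sup>2 / 2))"
      unfolding alg by simp
    have "r x + R * (x / x0) \<ge> 0"
    proof -
      have "R * 1 \<le> R * (x / x0)" using x x0 R0 by (intro mult_left_mono) auto
      then show ?thesis using r[of x] by (simp add: abs_le_iff)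
    qed
    then have "0 \<le> (r x + R * (x / x0)) * exp (- (x\<^sup>2 / 2))" by simp
    with D[unfolded E] show "\<exists>d. (?G has_real_derivative d) (at x) \<and> 0 \<le> d" by blast
  qed
  have "(?G \<longlongrightarrow> 0) at_top"
  proof (rule Lim_null_comparison)
    show "((\<lambda>x. (K + R / x0) * exp (- (x\<^sup>2 / 2))) \<longlongrightarrow> 0) at_top" by real_asymp
    have "R / x0 \<ge> 0" using R0 x0 by simp
    then have "\<bar>g x - R / x0\<bar> \<le> K + R / x0" for x using K[of x] unfolding abs_le_iff by linarith
    then show "\<forall>\<^sub>F x in at_top. norm (?G x) \<le> (K + R / x0) * exp (- (x\<^sup>2 / 2))"
      by (intro always_eventually allI) (simp add: abs_mult mult_right_mono)
  qed
  then have "?G x0 \<le> 0"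
    by (rule tendsto_lowerbound) (auto simp: eventually_at_top_linorder intro!: exI[of _ x0] mono)
  then show ?thesis by (simp add: mult_le_0_iff)
qed

text \<open>\<open>stein_growth_bound\<close> for g and -g bounds x g on the right half line; the
  left half follows because x -> -g(-x) solves the equation with r(-x). The equation then bounds the
  derivative by 2 R. For |x| at least 1 this gives |g| at most R; otherwise one of the points 1 and
  -1 is within distance 1, which adds 2 R. The a priori bound K singles out the bounded solution,
  and its size does not enter the result.\<close>

lemma stein_bounds:
  fixes g r :: "real \<Rightarrow> real"
  assumes g: "\<And>x. (g has_real_derivative x * g x + r x) (at x)"
    and r: "\<And>x. \<bar>r x\<bar> \<le> R" and K: "\<And>x. \<bar>g x\<bar> \<le> K"
  shows "\<bar>x * g x\<bar> \<le> R" and "\<bar>x * g x + r x\<bar> \<le> 2 * R" and "\<bar>g x\<bar> \<le> 3 * R"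
proof -
  have R0: "R \<ge> 0" using r[of 0] abs_ge_zero[of "r 0"] by linarith
  have pos: "\<bar>x * g x\<bar> \<le> R"
    if "x > 0" and g: "\<And>x. (g has_real_derivative x * g x + r x) (at x)"
    and r: "\<And>x. \<bar>r x\<bar> \<le> R" and K: "\<And>x. \<bar>g x\<bar> \<le> K" for x and g r :: "real \<Rightarrow> real"
  proof -
    have "g x \<le> R / x" by (rule stein_growth_bound[OF g r K that(1)])
    moreover have "- g x \<le> R / x"
    proof (rule stein_growth_bound[OF _ _ _ that(1)])
      show "((\<lambda>x. - g x) has_real_derivative x * (- g x) + (- r x)) (at x)" for x
        using DERIV_minus[OF g[of x]] by simp
    qed (use r K in auto)
    ultimately show ?thesis using that(1) by (simp add: abs_le_iff field_simps)
  qed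
  have mirror: "((\<lambda>x. - g (- x)) has_real_derivative x * (- g (- x)) + r (- x)) (at x)" for x
    using DERIV_minus[OF DERIV_mirror[THEN iffD1, of g "- x * g (- x) + r (- x)" x]] g[of "- x"] by simp
  have xg: "\<bar>x * g x\<bar> \<le> R" for x
  proof -
    consider "x > 0" | "x = 0" | "x < 0" by linarith
    then show ?thesis
    proof cases
      case 1 then show ?thesis by (rule pos[OF _ g r K])
    next
      case 2 then show ?thesis using R0 by simp
    next
      case 3
      have "\<bar>- x * (- g (- (- x)))\<bar> \<le> R"
        by (rule pos[OF _ mirror]) (use 3 r K in auto)
      then show ?thesis by simp
    qed
  qed
  have d: "\<bar>x * g x + r x\<bar> \<le> 2 * R" for x
    using xg[of x] r[of x] by (simp add: abs_le_iff)
  have diff: "\<bar>g x - g y\<bar> \<le> 2 * R * \<bar>x - y\<bar>" for x y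
    using field_differentiable_bound[of UNIV g "\<lambda>x. x * g x + r x" "2 * R" x y] g d by auto
  show "\<bar>x * g x\<bar> \<le> R" "\<bar>x * g x + r x\<bar> \<le> 2 * R" by (rule xg, rule d)
  show "\<bar>g x\<bar> \<le> 3 * R"
  proof (cases "\<bar>x\<bar> \<ge> 1")
    case True
    then have "1 * \<bar>g x\<bar> \<le> \<bar>x\<bar> * \<bar>g x\<bar>" by (intro mult_right_mono) auto
    then show ?thesis using xg[of x] R0 by (simp add: abs_mult)
  next
    case False
    define s :: real where "s = (if x \<ge> 0 then 1 else - 1)"
    have "\<bar>x - s\<bar> \<le> 1" using False by (auto simp: s_def)
    then have "2 * R * \<bar>x - s\<bar> \<le> 2 * R * 1" using R0 by (intro mult_left_mono) auto
    moreover have "\<bar>g s\<bar> \<le> R" using xg[of s] by (auto simp: s_def split: if_splits)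
    ultimately show ?thesis using diff[of x s] by (simp add: abs_le_iff)
  qed
qed

section \<open>Existence of a bounded solution\<close>

definition normal_expect :: "(real \<Rightarrow> real) \<Rightarrow> real" where
  "normal_expect k = (\<integral>x. std_normal_density x * k x \<partial>lborel)"

lemma integrable_std_normal_times:
  assumes [measurable]: "q \<in> borel_measurable borel" and q: "\<And>x. \<bar>q x\<bar> \<le> C * (1 + x ^ 6)"
  shows "integrable lborel (\<lambda>x. std_normal_density x * q x)"
proof (rule Bochner_Integration.integrable_bound)
  show "integrable lborel (\<lambda>x. C * (std_normal_density x * x ^ 0 + std_normal_density x * x ^ 6))"
    by (intro integrable_mult_right Bochner_Integration.integrable_add integrable_std_normal_moment)
  show "AE x in lborel. norm (std_normal_density x * q x) \<le> norm (C * (std_normal_density x * x ^ 0 + std_normal_density x * x ^ 6))"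
  proof (rule AE_I2)
    fix x :: real
    have "norm (std_normal_density x * q x) \<le> std_normal_density x * (C * (1 + x ^ 6))"
      using q[of x] by (simp add: abs_mult mult_left_mono)
    also have "\<dots> \<le> norm (C * (std_normal_density x * x ^ 0 + std_normal_density x * x ^ 6))"
      by (simp add: algebra_simps)
    finally show "norm (std_normal_density x * q x) \<le> norm (C * (std_normal_density x * x ^ 0 + std_normal_density x * x ^ 6))" .
  qed
qed measurable

lemma abs_power_le_sixth:
  assumes "j \<le> 6"
  shows "\<bar>x::real\<bar> ^ j \<le> 1 + x ^ 6"
proof (cases "\<bar>x\<bar> \<le> 1")
  case True
  then have "\<bar>x\<bar> ^ j \<le> 1" by (simp add: power_le_one)
  then show ?thesis by (simp add: add_increasing2)
next
  case False
  then have "\<bar>x\<bar> ^ j \<le> \<bar>x\<bar> ^ 6" using assms by (intro power_increasing) auto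
  then show ?thesis by simp
qed

lemma integrable_std_normal_bounded:
  assumes "q \<in> borel_measurable borel" and q: "\<And>x. \<bar>q x\<bar> \<le> C"
  shows "integrable lborel (\<lambda>x. std_normal_density x * q x)"
proof (rule integrable_std_normal_times[OF assms(1)])
  fix x :: real
  have "0 \<le> C" using q[of 0] abs_ge_zero[of "q 0"] by linarith
  then have "0 \<le> C * x ^ 6" by simp
  with q[of x] have "\<bar>q x\<bar> \<le> C + C * x ^ 6" by linarith
  then show "\<bar>q x\<bar> \<le> C * (1 + x ^ 6)" by (simp only: distrib_left mult_1_right)
qed

text \<open>To the right of 1 the slope of exp(-x^2/2) is at least its own value in size, so F - R
  exp(-x^2/2) increases to its limit A; applied to -F as well, this gives both sides.\<close>

lemma gaussian_tail_bound:
  fixes F q :: "real \<Rightarrow> real"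
  assumes F: "\<And>x. (F has_real_derivative q x) (at x)"
    and q: "\<And>x. \<bar>q x\<bar> \<le> R * exp (- (x\<^sup>2 / 2))"
    and lim: "(F \<longlongrightarrow> A) at_top" and x: "x \<ge> 1"
  shows "\<bar>F x - A\<bar> \<le> R * exp (- (x\<^sup>2 / 2))"
proof -
  have aux: "F x - A \<le> R * exp (- (x\<^sup>2 / 2))"
    if F: "\<And>x. (F has_real_derivative q x) (at x)"
      and q: "\<And>x. \<bar>q x\<bar> \<le> R * exp (- (x\<^sup>2 / 2))" and lim: "(F \<longlongrightarrow> A) at_top" for F q A
  proof -
    let ?G = "\<lambda>x. F x - R * exp (- (x\<^sup>2 / 2))"
    have R0: "R \<ge> 0" using q[of 0] abs_ge_zero[of "q 0"] by simp
    have mono: "?G x \<le> ?G y" if "x \<le> y" for y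
    proof (rule DERIV_nonneg_imp_nondecreasing[where f = ?G, OF that])
      fix z assume z: "x \<le> z" "z \<le> y"
      have "(?G has_real_derivative q z - R * (exp (- (z\<^sup>2 / 2)) * - z)) (at z)"
        by (intro DERIV_diff F DERIV_cmult) (auto intro!: derivative_eq_intros)
      moreover have "R * exp (- (z\<^sup>2 / 2)) * 1 \<le> R * exp (- (z\<^sup>2 / 2)) * z"
        using R0 x z by (intro mult_left_mono) auto
      then have "0 \<le> q z - R * (exp (- (z\<^sup>2 / 2)) * - z)"
        using q[of z] by (simp add: abs_le_iff)
      ultimately show "\<exists>d. (?G has_real_derivative d) (at z) \<and> 0 \<le> d" by blast
    qed
    have "((\<lambda>x. R * exp (- (x\<^sup>2 / 2))) \<longlongrightarrow> 0) at_top" by real_asymp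
    with lim have "(?G \<longlongrightarrow> A - 0) at_top" by (rule tendsto_diff)
    then have "?G x \<le> A - 0"
      by (rule tendsto_lowerbound) (auto simp: eventually_at_top_linorder intro!: exI[of _ x] mono)
    then show ?thesis by simp
  qed
  have "- F x - (- A) \<le> R * exp (- (x\<^sup>2 / 2))"
    by (rule aux[of "\<lambda>x. - F x" "\<lambda>x. - q x"]) (use F q lim in \<open>auto intro: DERIV_minus tendsto_minus\<close>)
  with aux[OF F q lim] show ?thesis by (simp add: abs_le_iff)
qed

lemma antiderivative_limit_at_top:
  fixes F q :: "real \<Rightarrow> real"
  assumes F: "\<And>x. (F has_real_derivative q x) (at x)"
    and q: "\<And>x. isCont q x" "integrable lborel q"
  shows "\<exists>A. (F \<longlongrightarrow> A) at_top"
proof -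
  let ?q = "\<lambda>x. indicator {0..} x * q x"
  have i: "integrable lborel ?q"
    using integrable_mult_indicator[OF _ q(2), of "{0..}"] by simp
  have "((\<lambda>y. \<integral>x. indicator {..y} x *\<^sub>R ?q x \<partial>lborel) \<longlongrightarrow> (\<integral>x. ?q x \<partial>lborel)) at_top"
    by (rule tendsto_integral_at_top) (use i in auto)
  then have "((\<lambda>y. F 0 + (\<integral>x. indicator {..y} x *\<^sub>R ?q x \<partial>lborel)) \<longlongrightarrow> F 0 + (\<integral>x. ?q x \<partial>lborel)) at_top"
    by (intro tendsto_intros)
  moreover have "\<forall>\<^sub>F y in at_top. F 0 + (\<integral>x. indicator {..y} x *\<^sub>R ?q x \<partial>lborel) = F y"
    using eventually_ge_at_top[of 0]
  proof eventually_elim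
    case (elim y)
    have "(\<integral>x. indicator {..y} x *\<^sub>R ?q x \<partial>lborel) = (\<integral>x. q x * indicator {0..y} x \<partial>lborel)"
      by (intro Bochner_Integration.integral_cong) (auto simp: indicator_def)
    also have "\<dots> = F y - F 0"
      by (rule integral_FTC_Icc_real) (use F q elim in auto)
    finally show ?case by simp
  qed
  ultimately show ?thesis using Lim_transform_eventually by blast
qed

text \<open>Variation of constants: F is an antiderivative of (k - c) exp(-x^2/2). Centring makes
  the total integral 0, so F has the same limit A at both ends, and exp(x^2/2) (F - A) is bounded on
  both sides by \<open>gaussian_tail_bound\<close>.\<close>

lemma stein_solution_exists:
  fixes k :: "real \<Rightarrow> real"
  assumes k: "\<And>x. isCont k x" and B: "\<And>x. \<bar>k x\<bar> \<le> B"
  shows "\<exists>f K. (\<forall>x. (f has_real_derivative x * f x + (k x - normal_expect k)) (at x)) \<and> (\<forall>x. \<bar>f x\<bar> \<le> K)"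
proof -
  define c where "c = normal_expect k"
  define q where "q = (\<lambda>x. (k x - c) * exp (- (x\<^sup>2 / 2)))"
  define R where "R = B + \<bar>c\<bar>"
  have meas: "k \<in> borel_measurable borel"
    using k by (intro borel_measurable_continuous_onI) (simp add: continuous_at_imp_continuous_on)
  have q_cont: "isCont q x" for x unfolding q_def by (intro continuous_intros k) auto
  have q_bd: "\<bar>q x\<bar> \<le> R * exp (- (x\<^sup>2 / 2))" for x
    using B[of x] by (auto simp: q_def R_def abs_mult intro!: mult_right_mono)
  have q_eq: "q x = sqrt (2 * pi) * (std_normal_density x * k x - c * (std_normal_density x * x ^ (2 * 0)))" for x
    by (simp add: q_def std_normal_density_def field_simps)
  have ik: "integrable lborel (\<lambda>x. std_normal_density x * k x)"
    by (rule integrable_std_normal_bounded[OF meas B])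
  have iq: "integrable lborel q" unfolding q_eq[abs_def]
    by (intro integrable_mult_right Bochner_Integration.integrable_diff ik integrable_std_normal_moment)
  have q0: "(\<integral>x. q x \<partial>lborel) = 0"
  proof -
    have "(\<integral>x. std_normal_density x * x ^ (2 * 0) \<partial>lborel) = 1"
      by (subst integral_std_normal_moment_even) simp
    then have "(\<integral>x. std_normal_density x * k x - c * (std_normal_density x * x ^ (2 * 0)) \<partial>lborel) = 0"
      using ik integrable_std_normal_moment[of "2 * 0"]
      by (subst Bochner_Integration.integral_diff) (auto simp: c_def normal_expect_def)
    then show ?thesis unfolding q_eq by simp
  qed
  obtain F where F: "\<And>x. (F has_real_derivative q x) (at x)"
    using einterval_antiderivative[of "-\<infinity>" "\<infinity>" q] q_cont
    by (auto simp: has_real_derivative_iff_has_vector_derivative)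
  obtain A where A: "(F \<longlongrightarrow> A) at_top"
    using antiderivative_limit_at_top[OF F q_cont iq] by blast
  have Fm: "((\<lambda>x. F (- x)) has_real_derivative - q (- x)) (at x)" for x
    using F[of "- x"] DERIV_mirror by blast
  have iqm: "integrable lborel (\<lambda>x. - q (- x))"
    using lborel_integrable_real_affine[OF iq, of "-1" 0] by simp
  have qmc: "isCont (\<lambda>x. - q (- x)) x" for x
    by (intro continuous_intros isCont_o2[OF _ q_cont])
  obtain A' where A': "((\<lambda>x. F (- x)) \<longlongrightarrow> A') at_top"
    using antiderivative_limit_at_top[OF Fm qmc iqm] by blast
  have "(F \<longlongrightarrow> A') at_bot" using A' by (simp add: filterlim_at_bot_mirror)
  from integral_real_line_FTC[OF F q_cont iq this A] q0 have AA: "A' = A" by simp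
  define f where "f = (\<lambda>x. exp (x\<^sup>2 / 2) * (F x - A))"
  have "(f has_real_derivative x * f x + (k x - c)) (at x)" for x
  proof -
    have "(f has_real_derivative exp (x\<^sup>2 / 2) * x * (F x - A) + (q x - 0) * exp (x\<^sup>2 / 2)) (at x)"
      unfolding f_def by (intro DERIV_mult DERIV_diff F DERIV_const) (auto intro!: derivative_eq_intros)
    moreover have "exp (- (x\<^sup>2 / 2)) * exp (x\<^sup>2 / 2) = 1" by (simp add: exp_add[symmetric])
    then have "q x * exp (x\<^sup>2 / 2) = k x - c" by (simp add: q_def mult.assoc)
    ultimately show ?thesis by (simp add: f_def mult_ac)
  qed
  moreover have "\<exists>K. \<forall>x. \<bar>f x\<bar> \<le> K"
  proof -
    have big: "\<bar>f x\<bar> \<le> R" if "\<bar>x\<bar> \<ge> 1" for x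
    proof -
      have "\<bar>F x - A\<bar> \<le> R * exp (- (x\<^sup>2 / 2))"
      proof (cases "x \<ge> 1")
        case True then show ?thesis using gaussian_tail_bound[OF F q_bd A] by blast
      next
        case False
        with that have x: "- x \<ge> 1" by auto
        have "\<bar>F (- (- x)) - A\<bar> \<le> R * exp (- ((- x)\<^sup>2 / 2))"
          by (rule gaussian_tail_bound[OF Fm _ A'[unfolded AA] x]) (use q_bd[of "- y" for y] in auto)
        then show ?thesis by simp
      qed
      then have "exp (x\<^sup>2 / 2) * \<bar>F x - A\<bar> \<le> exp (x\<^sup>2 / 2) * (R * exp (- (x\<^sup>2 / 2)))"
        by (intro mult_left_mono) auto
      also have "\<dots> = R" by (simp add: exp_minus)
      finally show ?thesis by (simp add: f_def abs_mult)
    qed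
    have "continuous_on {-1..1} F"
      by (intro continuous_at_imp_continuous_on ballI DERIV_isCont[OF F])
    then have "continuous_on {-1..1} f" unfolding f_def by (intro continuous_intros) auto
    then have "bounded (f ` {-1..1})" by (intro compact_imp_bounded compact_continuous_image) auto
    then obtain K where "\<forall>x\<in>{-1..1}. \<bar>f x\<bar> \<le> K" by (auto simp: bounded_iff)
    then have K: "\<And>x. x \<in> {-1..1} \<Longrightarrow> \<bar>f x\<bar> \<le> K" by blast
    have "\<bar>f x\<bar> \<le> max R K" for x
    proof (cases "\<bar>x\<bar> \<ge> 1")
      case False
      then have "x \<in> {-1..1}" by auto
      from K[OF this] show ?thesis by linarith
    qed (use big[of x] in linarith)
    then show ?thesis by blast
  qed
  ultimately show ?thesis unfolding c_def by blast
qed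

text \<open>Differentiating Stein's equation shows that f1 solves it with right-hand side f + k', of
  size at most R1 + 3 R0; \<open>stein_bounds\<close> is applied once to f and once to f1.\<close>

lemma stein_solution_lipschitz:
  fixes k k' :: "real \<Rightarrow> real"
  assumes k: "\<And>x. (k has_real_derivative k' x) (at x)"
    and R0: "\<And>x. \<bar>k x - normal_expect k\<bar> \<le> R0" and R1: "\<And>x. \<bar>k' x\<bar> \<le> R1"
  obtains f f1 f2 where
    "\<And>x. (f has_real_derivative f1 x) (at x)" "\<And>x. (f1 has_real_derivative f2 x) (at x)"
    "\<And>x. f1 x = x * f x + (k x - normal_expect k)"
    "\<And>x. f2 x = x * f1 x + (f x + k' x)"
    "\<And>x. \<bar>f x\<bar> \<le> 3 * R0" "\<And>x. \<bar>f1 x\<bar> \<le> 2 * R0" "\<And>x. \<bar>f2 x\<bar> \<le> 2 * (R1 + 3 * R0)"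
proof -
  have B: "\<bar>k x\<bar> \<le> R0 + \<bar>normal_expect k\<bar>" for x using R0[of x] by (auto simp: abs_le_iff)
  obtain f K where f: "\<And>x. (f has_real_derivative x * f x + (k x - normal_expect k)) (at x)"
    and K: "\<And>x. \<bar>f x\<bar> \<le> K"
    using stein_solution_exists[OF DERIV_isCont[OF k] B] by auto
  note b = stein_bounds[OF f R0 K]
  define f1 where "f1 = (\<lambda>x. x * f x + (k x - normal_expect k))"
  have d1: "(f has_real_derivative f1 x) (at x)" for x using f by (simp add: f1_def)
  have d2: "(f1 has_real_derivative x * f1 x + (f x + k' x)) (at x)" for x
  proof -
    have "(f1 has_real_derivative (1 * f x + f1 x * x) + (k' x - 0)) (at x)"
      unfolding f1_def by (intro DERIV_add DERIV_mult DERIV_ident DERIV_diff k DERIV_const d1[unfolded f1_def])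
    then show ?thesis by (simp add: algebra_simps)
  qed
  have "\<bar>f x + k' x\<bar> \<le> R1 + 3 * R0" for x using b(3)[of x] R1[of x] by (auto simp: abs_le_iff)
  have b1: "\<bar>f1 x\<bar> \<le> 2 * R0" for x using b(2)[of x] by (simp add: f1_def)
  from stein_bounds(2)[OF d2 \<open>\<And>x. \<bar>f x + k' x\<bar> \<le> R1 + 3 * R0\<close> b1]
  have b2: "\<bar>x * f1 x + (f x + k' x)\<bar> \<le> 2 * (R1 + 3 * R0)" for x .
  show ?thesis
    by (rule that[of f f1 "\<lambda>x. x * f1 x + (f x + k' x)"])
       (use d1 d2 b(2,3) b2 in \<open>auto simp: f1_def\<close>)
qed

text \<open>The derivative of a solution of Stein's equation solves it again, with right-hand side \<open>k' + f\<close>;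
  the same bounds therefore apply to the higher derivatives.\<close>

lemma stein_solution_smooth:
  fixes k k' k'' :: "real \<Rightarrow> real"
  assumes k: "\<And>x. (k has_real_derivative k' x) (at x)"
    and k': "\<And>x. (k' has_real_derivative k'' x) (at x)"
    and R0: "\<And>x. \<bar>k x - normal_expect k\<bar> \<le> R0" and R1: "\<And>x. \<bar>k' x\<bar> \<le> R1"
    and R2: "\<And>x. \<bar>k'' x\<bar> \<le> R2"
  obtains f f1 f2 f3 where
    "\<And>x. (f has_real_derivative f1 x) (at x)" "\<And>x. (f1 has_real_derivative f2 x) (at x)"
    "\<And>x. (f2 has_real_derivative f3 x) (at x)"
    "\<And>x. f1 x = x * f x + (k x - normal_expect k)"
    "\<And>x. \<bar>f x\<bar> \<le> 3 * R0" "\<And>x. \<bar>f1 x\<bar> \<le> 2 * R0"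
    "\<And>x. \<bar>f2 x\<bar> \<le> 3 * (R2 + 4 * R0)" "\<And>x. \<bar>f3 x\<bar> \<le> 2 * (R2 + 4 * R0)"
proof (rule stein_solution_lipschitz[OF k R0 R1])
  fix f f1 f2
  assume f: "\<And>x. (f has_real_derivative f1 x) (at x)" "\<And>x. (f1 has_real_derivative f2 x) (at x)"
    "\<And>x. f1 x = x * f x + (k x - normal_expect k)"
    "\<And>x. f2 x = x * f1 x + (f x + k' x)"
    and b: "\<And>x. \<bar>f x\<bar> \<le> 3 * R0" "\<And>x. \<bar>f1 x\<bar> \<le> 2 * R0" "\<And>x. \<bar>f2 x\<bar> \<le> 2 * (R1 + 3 * R0)"
  have d3: "(f2 has_real_derivative x * f2 x + (2 * f1 x + k'' x)) (at x)" for x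
  proof -
    have "((\<lambda>x. x * f1 x + (f x + k' x)) has_real_derivative (1 * f1 x + f2 x * x) + (f1 x + k'' x)) (at x)"
      by (intro DERIV_add DERIV_mult DERIV_ident f k')
    moreover have "f2 = (\<lambda>x. x * f1 x + (f x + k' x))" using f(4) by (rule ext)
    ultimately show ?thesis by (simp add: algebra_simps)
  qed
  \<comment> \<open>R1 disappears at this point: the bound on f2 that contains it only serves as the
    a priori bound in \<open>stein_bounds\<close>, whereas the new right-hand side is controlled by
    R2 and R0.\<close>
  have r: "\<bar>2 * f1 x + k'' x\<bar> \<le> R2 + 4 * R0" for x using b(2)[of x] R2[of x] by (auto simp: abs_le_iff)
  show thesis
    by (rule that[OF f(1,2) d3 f(3) b(1,2)]) (rule stein_bounds[OF d3 r b(3)])+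
qed

section \<open>The skewness correction and the third Hermite polynomial\<close>

definition He3 :: "real \<Rightarrow> real" where "He3 x = x ^ 3 - 3 * x"

lemma abs_He3_le: "\<bar>He3 x\<bar> \<le> 4 * (1 + x ^ 6)"
proof -
  have "\<bar>He3 x\<bar> \<le> \<bar>x\<bar> ^ 3 + 3 * \<bar>x\<bar> ^ 1"
    unfolding He3_def using abs_triangle_ineq4[of "x ^ 3" "3 * x"] by (simp add: abs_mult power_abs)
  then show ?thesis using abs_power_le_sixth[of 3 x] abs_power_le_sixth[of 1 x] by simp
qed

lemma borel_measurable_He3 [measurable]: "He3 \<in> borel_measurable borel"
  unfolding He3_def[abs_def] by measurable

lemma integral_He3: "(\<integral>x. std_normal_density x * He3 x \<partial>lborel) = 0"
proof -
  have "(\<integral>x. std_normal_density x * x ^ (2 * 1 + 1) - 3 * (std_normal_density x * x ^ (2 * 0 + 1)) \<partial>lborel) = 0"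
    using integrable_std_normal_moment[of "2 * 1 + 1"] integrable_std_normal_moment[of "2 * 0 + 1"]
      integral_std_normal_moment_odd[of 1] integral_std_normal_moment_odd[of 0]
    by (simp only: Bochner_Integration.integral_diff integrable_mult_right) simp
  then show ?thesis by (simp add: He3_def algebra_simps power3_eq_cube power2_eq_square)
qed

text \<open>Integration by parts eliminates the Stein solution from the skewness term, leaving an
  expression in the test function alone. The centring constant drops out because He3 has normal mean
  0.\<close>

lemma normal_expect_stein_second_deriv:
  fixes k :: "real \<Rightarrow> real"
  assumes k: "\<And>x. isCont k x" and kb: "\<And>x. \<bar>k x - normal_expect k\<bar> \<le> B"
    and f: "\<And>x. (f has_real_derivative f1 x) (at x)" "\<And>x. (f1 has_real_derivative f2 x) (at x)"
      "\<And>x. isCont f2 x" "\<And>x. f1 x = x * f x + (k x - normal_expect k)"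
    and b: "\<And>x. \<bar>f x\<bar> \<le> K" "\<And>x. \<bar>f1 x\<bar> \<le> K" "\<And>x. \<bar>f2 x\<bar> \<le> K"
  shows "normal_expect f2 = - (1 / 3) * normal_expect (\<lambda>x. He3 x * k x)"
proof -
  define c where "c = normal_expect k"
  let ?\<phi> = std_normal_density
  \<comment> \<open>chosen so that \<open>?F' = \<phi> (f2 + He3 (f1 - x f) / 3)\<close>, by \<open>\<phi>' = - x \<phi>\<close>\<close>
  let ?F = "\<lambda>x. ?\<phi> x * (f1 x + x * f x + He3 x * f x / 3)"
  let ?F' = "\<lambda>x. ?\<phi> x * f2 x + 1 / 3 * (?\<phi> x * (He3 x * (k x - c)))"
  have K0: "K \<ge> 0" using b(1)[of 0] abs_ge_zero[of "f 0"] by linarith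
  have kc: "continuous_on UNIV k" "continuous_on UNIV f2"
    using k f(3) by (auto simp: continuous_at_imp_continuous_on)
  note [measurable] = borel_measurable_continuous_onI[OF kc(1)] borel_measurable_continuous_onI[OF kc(2)]
  have i1: "integrable lborel (\<lambda>x. ?\<phi> x * f2 x)"
    by (rule integrable_std_normal_bounded[OF _ b(3)]) measurable
  have iH: "integrable lborel (\<lambda>x. ?\<phi> x * (He3 x * u x))"
    if [measurable]: "u \<in> borel_measurable borel" and u: "\<And>x. \<bar>u x\<bar> \<le> C" for u C
  proof (rule integrable_std_normal_times)
    show "\<bar>He3 x * u x\<bar> \<le> (4 * C) * (1 + x ^ 6)" for x
    proof -
      have "\<bar>He3 x\<bar> * \<bar>u x\<bar> \<le> (4 * (1 + x ^ 6)) * C"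
        using abs_He3_le[of x] u[of x] by (intro mult_mono) auto
      then show ?thesis by (simp add: abs_mult algebra_simps)
    qed
  qed measurable
  have i2: "integrable lborel (\<lambda>x. ?\<phi> x * (He3 x * (k x - c)))"
    using iH[of "\<lambda>x. k x - c" B] kb by (auto simp: c_def)
  have i3: "integrable lborel (\<lambda>x. ?\<phi> x * He3 x)" using iH[of "\<lambda>_. 1" 1] by simp
  have lim: "(?F \<longlongrightarrow> 0) G"
    if G: "((\<lambda>x::real. 5 * K * ((1 / sqrt (2 * pi)) * exp (- x\<^sup>2 / 2) * (1 + x ^ 6))) \<longlongrightarrow> 0) G" for G
  proof (rule Lim_null_comparison[OF always_eventually G[folded std_normal_density_def]], rule allI)
    fix x :: real
    define P where "P = (1 + x ^ 6) * K"
    have "\<bar>x * f x\<bar> \<le> P"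
      using abs_power_le_sixth[of 1 x] b(1)[of x] unfolding abs_mult P_def by (intro mult_mono) auto
    moreover have "\<bar>He3 x * f x\<bar> \<le> 4 * P"
      using abs_He3_le[of x] b(1)[of x] unfolding abs_mult P_def mult.assoc[symmetric]
      by (intro mult_mono) auto
    moreover have "1 * K \<le> P" unfolding P_def using K0 by (intro mult_right_mono) auto
    moreover have "\<bar>f1 x\<bar> \<le> K" by (rule b)
    moreover have "\<bar>f1 x + x * f x + He3 x * f x / 3\<bar> \<le> \<bar>f1 x\<bar> + \<bar>x * f x\<bar> + \<bar>He3 x * f x\<bar> / 3"
      by (simp add: abs_triangle_ineq order_trans[OF abs_triangle_ineq])
    ultimately have "\<bar>f1 x + x * f x + He3 x * f x / 3\<bar> \<le> 5 * P"
      using K0 by linarith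
    then have "\<bar>f1 x + x * f x + He3 x * f x / 3\<bar> \<le> 5 * K * (1 + x ^ 6)"
      by (simp add: P_def mult_ac)
    then have "?\<phi> x * \<bar>f1 x + x * f x + He3 x * f x / 3\<bar> \<le> ?\<phi> x * (5 * K * (1 + x ^ 6))"
      by (intro mult_left_mono) auto
    then show "norm (?F x) \<le> 5 * K * (?\<phi> x * (1 + x ^ 6))"
      by (simp only: real_norm_def abs_mult abs_of_nonneg[OF normal_density_nonneg] mult_ac)
  qed
  have "(\<integral>x. ?F' x \<partial>lborel) = 0 - 0"
  proof (rule integral_real_line_FTC)
    show "(?F has_real_derivative ?F' x) (at x)" for x
    proof -
      have d\<phi>: "(?\<phi> has_real_derivative - x * ?\<phi> x) (at x)"
      proof -
        have "((\<lambda>x::real. exp (- x\<^sup>2 / 2)) has_real_derivative exp (- x\<^sup>2 / 2) * - x) (at x)"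
          by (auto intro!: derivative_eq_intros)
        from DERIV_cmult[OF this, of "1 / sqrt (2 * pi)"] show ?thesis
          unfolding std_normal_density_def by (simp add: mult_ac)
      qed
      have "(He3 has_real_derivative 3 * x\<^sup>2 - 3) (at x)"
        unfolding He3_def[abs_def] by (auto intro!: derivative_eq_intros)
      then have "(?F has_real_derivative - x * ?\<phi> x * (f1 x + x * f x + He3 x * f x / 3) +
          (f2 x + (1 * f x + f1 x * x) + ((3 * x\<^sup>2 - 3) * f x + f1 x * He3 x) / 3) * ?\<phi> x) (at x)"
        by (intro DERIV_mult DERIV_add DERIV_ident DERIV_cdivide d\<phi> f)
      moreover have "- x * ?\<phi> x * (f1 x + x * f x + He3 x * f x / 3) +
          (f2 x + (1 * f x + f1 x * x) + ((3 * x\<^sup>2 - 3) * f x + f1 x * He3 x) / 3) * ?\<phi> x = ?F' x"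
        unfolding f(4)[of x] c_def by (simp add: field_simps power2_eq_square)
      ultimately show ?thesis by simp
    qed
    show "isCont ?F' x" for x
      unfolding std_normal_density_def He3_def by (intro continuous_intros k f(3)) auto
    show "integrable lborel ?F'" by (intro Bochner_Integration.integrable_add integrable_mult_right i1 i2)
    show "(?F \<longlongrightarrow> 0) at_bot" by (rule lim) real_asymp
    show "(?F \<longlongrightarrow> 0) at_top" by (rule lim) real_asymp
  qed
  moreover have "(\<integral>x. ?F' x \<partial>lborel) = normal_expect f2 + 1 / 3 * (\<integral>x. ?\<phi> x * (He3 x * (k x - c)) \<partial>lborel)"
    using i1 i2 by (simp add: normal_expect_def)
  moreover have "(\<integral>x. ?\<phi> x * (He3 x * (k x - c)) \<partial>lborel) = normal_expect (\<lambda>x. He3 x * k x)"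
  proof -
    have "?\<phi> x * (He3 x * k x) = ?\<phi> x * (He3 x * (k x - c)) + c * (?\<phi> x * He3 x)" for x
      by (simp add: algebra_simps)
    then show ?thesis unfolding normal_expect_def using i2 i3 by (simp add: integral_He3)
  qed
  ultimately show ?thesis by simp
qed

section \<open>Normal approximation of normalised sums\<close>

lemma abs_integral_le:
  fixes f g :: "'a \<Rightarrow> real"
  assumes "integrable M f" "integrable M g" "\<And>x. \<bar>f x\<bar> \<le> g x"
  shows "\<bar>\<integral>x. f x \<partial>M\<bar> \<le> (\<integral>x. g x \<partial>M)"
proof -
  have "\<bar>\<integral>x. f x \<partial>M\<bar> \<le> (\<integral>x. \<bar>f x\<bar> \<partial>M)" by (rule integral_abs_bound)
  also have "\<dots> \<le> (\<integral>x. g x \<partial>M)" using assms by (intro integral_mono) auto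
  finally show ?thesis .
qed

lemma taylor_bound1:
  fixes p :: "real \<Rightarrow> real"
  assumes "\<And>x. (p has_real_derivative p1 x) (at x)" "\<And>x. \<bar>p1 x\<bar> \<le> L"
  shows "\<bar>p (b + a) - p b\<bar> \<le> L * \<bar>a\<bar>"
  using field_differentiable_bound[of UNIV p p1 L b "b + a"] assms by auto

text \<open>\<open>field_Taylor\<close> divides the remainder by the factorial of the last index of
  the sum, so the constant here is L instead of L/2; likewise L/2 instead of L/6 in
  \<open>taylor_bound3\<close>.\<close>

lemma taylor_bound2:
  fixes p :: "real \<Rightarrow> real"
  assumes p: "\<And>x. (p has_real_derivative p1 x) (at x)" "\<And>x. (p1 has_real_derivative p2 x) (at x)"
    and L: "\<And>x. \<bar>p2 x\<bar> \<le> L"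
  shows "\<bar>p (b + a) - p b - a * p1 b\<bar> \<le> L * a\<^sup>2"
proof -
  let ?f = "\<lambda>i::nat. if i = 0 then p else if i = 1 then p1 else p2"
  have "norm (?f 0 (b + a) - (\<Sum>i\<le>1. ?f i b * ((b + a) - b) ^ i / fact i)) \<le> L * norm ((b + a) - b) ^ Suc 1 / fact 1"
    by (rule field_Taylor[where S = UNIV]) (use p L in \<open>auto simp: le_Suc_eq\<close>)
  then show ?thesis by (simp add: atMost_Suc power2_eq_square algebra_simps)
qed

lemma taylor_bound3:
  fixes p :: "real \<Rightarrow> real"
  assumes p: "\<And>x. (p has_real_derivative p1 x) (at x)" "\<And>x. (p1 has_real_derivative p2 x) (at x)"
      "\<And>x. (p2 has_real_derivative p3 x) (at x)"
    and L: "\<And>x. \<bar>p3 x\<bar> \<le> L"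
  shows "\<bar>p (b + a) - p b - a * p1 b - a\<^sup>2 / 2 * p2 b\<bar> \<le> L * \<bar>a\<bar> ^ 3 / 2"
proof -
  let ?f = "\<lambda>i::nat. if i = 0 then p else if i = 1 then p1 else if i = 2 then p2 else p3"
  have "norm (?f 0 (b + a) - (\<Sum>i\<le>2. ?f i b * ((b + a) - b) ^ i / fact i)) \<le> L * norm ((b + a) - b) ^ Suc 2 / fact 2"
    by (rule field_Taylor[where S = UNIV]) (use p L in \<open>auto simp: le_Suc_eq numeral_2_eq_2\<close>)
  then show ?thesis by (simp add: numeral_2_eq_2 atMost_Suc power2_eq_square algebra_simps numeral_3_eq_3)
qed

lemma power_le_one_plus_power4:
  assumes "j \<le> 4"
  shows "\<bar>x::real\<bar> ^ j \<le> 1 + x ^ 4"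
proof (cases "\<bar>x\<bar> \<le> 1")
  case True
  then have "\<bar>x\<bar> ^ j \<le> 1" by (simp add: power_le_one)
  then show ?thesis by (simp add: add_increasing2)
next
  case False
  then have "\<bar>x\<bar> ^ j \<le> \<bar>x\<bar> ^ 4" using assms by (intro power_increasing) auto
  then show ?thesis by simp
qed

section \<open>Expansions around the sum with one summand removed\<close>

context prob_space
begin

lemma integrable_power_le4:
  fixes a :: "'a \<Rightarrow> real"
  assumes [measurable]: "a \<in> borel_measurable M" and i4: "integrable M (\<lambda>\<omega>. a \<omega> ^ 4)" and j: "j \<le> 4"
  shows "integrable M (\<lambda>\<omega>. a \<omega> ^ j)" and "integrable M (\<lambda>\<omega>. \<bar>a \<omega>\<bar> ^ j)"
proof -
  have i: "integrable M (\<lambda>\<omega>. 1 + a \<omega> ^ 4)" using i4 by simp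
  show "integrable M (\<lambda>\<omega>. a \<omega> ^ j)" "integrable M (\<lambda>\<omega>. \<bar>a \<omega>\<bar> ^ j)"
    by (rule Bochner_Integration.integrable_bound[OF i];
        use power_le_one_plus_power4[OF j] in \<open>auto simp: power_abs intro!: AE_I2 order_trans[OF _ abs_ge_self]\<close>)+
qed

lemma integrable_bounded_comp:
  fixes p :: "real \<Rightarrow> real"
  assumes "S \<in> borel_measurable M" "p \<in> borel_measurable borel" "\<And>x. \<bar>p x\<bar> \<le> K"
  shows "integrable M (\<lambda>\<omega>. p (S \<omega>))"
  by (rule integrable_const_bound[of _ K]) (use assms in auto)

lemma integrable_mult_bounded_comp:
  fixes p :: "real \<Rightarrow> real"
  assumes "integrable M u" "S \<in> borel_measurable M" "p \<in> borel_measurable borel" "\<And>x. \<bar>p x\<bar> \<le> K"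
  shows "integrable M (\<lambda>\<omega>. u \<omega> * p (S \<omega>))"
proof (rule Bochner_Integration.integrable_bound)
  show "integrable M (\<lambda>\<omega>. K * u \<omega>)" using assms(1) by simp
  show "AE \<omega> in M. norm (u \<omega> * p (S \<omega>)) \<le> norm (K * u \<omega>)"
  proof (rule AE_I2)
    fix \<omega>
    have "K \<ge> 0" using assms(4)[of 0] abs_ge_zero[of "p 0"] by linarith
    have "\<bar>u \<omega>\<bar> * \<bar>p (S \<omega>)\<bar> \<le> \<bar>u \<omega>\<bar> * K" by (intro mult_left_mono assms) auto
    then show "norm (u \<omega> * p (S \<omega>)) \<le> norm (K * u \<omega>)" using \<open>K \<ge> 0\<close> by (simp add: abs_mult mult.commute)
  qed
qed (use assms in measurable)

lemma expectation_indep_mult: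
  fixes a B :: "'a \<Rightarrow> real" and u v :: "real \<Rightarrow> real"
  assumes ind: "indep_var borel a borel B" and i: "integrable M (\<lambda>\<omega>. u (a \<omega>))"
    and [measurable]: "u \<in> borel_measurable borel" "v \<in> borel_measurable borel"
    and v: "\<And>x. \<bar>v x\<bar> \<le> K"
  shows "expectation (\<lambda>\<omega>. u (a \<omega>) * v (B \<omega>)) = expectation (\<lambda>\<omega>. u (a \<omega>)) * expectation (\<lambda>\<omega>. v (B \<omega>))"
proof -
  have "indep_var borel (u \<circ> a) borel (v \<circ> B)" by (rule indep_var_compose[OF ind]) measurable
  moreover have "B \<in> borel_measurable M" using indep_var_rv2[OF ind] .
  ultimately show ?thesis
    using indep_var_lebesgue_integral[of "u \<circ> a" "v \<circ> B"] i integrable_bounded_comp[of B v K] v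
    by (simp add: comp_def)
qed

lemma exchange_lipschitz:
  fixes a B :: "'a \<Rightarrow> real"
  assumes [measurable]: "a \<in> borel_measurable M" "B \<in> borel_measurable M" and i: "integrable M (\<lambda>\<omega>. \<bar>a \<omega>\<bar>)"
    and p: "\<And>x. (p has_real_derivative p1 x) (at x)" and b: "\<And>x. \<bar>p x\<bar> \<le> K" "\<And>x. \<bar>p1 x\<bar> \<le> L"
  shows "\<bar>expectation (\<lambda>\<omega>. p (B \<omega> + a \<omega>)) - expectation (\<lambda>\<omega>. p (B \<omega>))\<bar> \<le> L * expectation (\<lambda>\<omega>. \<bar>a \<omega>\<bar>)"
proof -
  have [measurable]: "p \<in> borel_measurable borel"
    using DERIV_isCont[OF p] by (intro borel_measurable_continuous_onI) (simp add: continuous_at_imp_continuous_on)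
  have ib: "integrable M (\<lambda>\<omega>. p (B \<omega>))" "integrable M (\<lambda>\<omega>. p (B \<omega> + a \<omega>))"
    by (auto intro!: integrable_bounded_comp[OF _ _ b(1)])
  have "\<bar>expectation (\<lambda>\<omega>. p (B \<omega> + a \<omega>) - p (B \<omega>))\<bar> \<le> expectation (\<lambda>\<omega>. L * \<bar>a \<omega>\<bar>)"
    by (rule abs_integral_le) (use i ib taylor_bound1[OF p b(2)] in auto)
  then show ?thesis using ib by simp
qed

text \<open>Here a stands for one summand and B for the sum of the others. Independence and E a = 0
  remove the terms a p(B) and a p1(B), so the first surviving terms are one order higher. The first
  bound restores the full sum in E f'(B), the second linearises E[a f(B + a)].\<close>

lemma exchange_second_order:
  fixes a B :: "'a \<Rightarrow> real"
  assumes ind: "indep_var borel a borel B" and i4: "integrable M (\<lambda>\<omega>. a \<omega> ^ 4)" and m0: "expectation a = 0"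
    and p: "\<And>x. (p has_real_derivative p1 x) (at x)" "\<And>x. (p1 has_real_derivative p2 x) (at x)"
    and b: "\<And>x. \<bar>p x\<bar> \<le> K" "\<And>x. \<bar>p1 x\<bar> \<le> K" "\<And>x. \<bar>p2 x\<bar> \<le> L"
  shows "\<bar>expectation (\<lambda>\<omega>. p (B \<omega> + a \<omega>)) - expectation (\<lambda>\<omega>. p (B \<omega>))\<bar> \<le> L * expectation (\<lambda>\<omega>. (a \<omega>)\<^sup>2)"
    and "\<bar>expectation (\<lambda>\<omega>. a \<omega> * p (B \<omega> + a \<omega>)) - expectation (\<lambda>\<omega>. (a \<omega>)\<^sup>2) * expectation (\<lambda>\<omega>. p1 (B \<omega>))\<bar>
      \<le> L * expectation (\<lambda>\<omega>. \<bar>a \<omega>\<bar> ^ 3)"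
proof -
  have [measurable]: "a \<in> borel_measurable M" "B \<in> borel_measurable M"
    using indep_var_rv1[OF ind] indep_var_rv2[OF ind] by auto
  have [measurable]: "p \<in> borel_measurable borel" "p1 \<in> borel_measurable borel"
    using DERIV_isCont[OF p(1)] DERIV_isCont[OF p(2)]
    by (auto intro!: borel_measurable_continuous_onI simp: continuous_at_imp_continuous_on)
  note ip = integrable_power_le4[OF _ i4]
  have i1: "integrable M a" using ip(1)[of 1] by simp
  have i2: "integrable M (\<lambda>\<omega>. (a \<omega>)\<^sup>2)" using ip(1)[of 2] by simp
  have i3: "integrable M (\<lambda>\<omega>. \<bar>a \<omega>\<bar> ^ 3)" using ip(2)[of 3] by simp
  have e1: "expectation (\<lambda>\<omega>. a \<omega> * p1 (B \<omega>)) = 0"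
    using expectation_indep_mult[OF ind, of "\<lambda>x. x" p1 K] i1 b m0 by simp
  have e0: "expectation (\<lambda>\<omega>. a \<omega> * p (B \<omega>)) = 0"
    using expectation_indep_mult[OF ind, of "\<lambda>x. x" p K] i1 b m0 by simp
  have e2: "expectation (\<lambda>\<omega>. (a \<omega>)\<^sup>2 * p1 (B \<omega>)) = expectation (\<lambda>\<omega>. (a \<omega>)\<^sup>2) * expectation (\<lambda>\<omega>. p1 (B \<omega>))"
    using expectation_indep_mult[OF ind, of "\<lambda>x. x\<^sup>2" p1 K] i2 b by simp
  have ib: "integrable M (\<lambda>\<omega>. p (B \<omega>))" "integrable M (\<lambda>\<omega>. p (B \<omega> + a \<omega>))"
    by (auto intro!: integrable_bounded_comp[OF _ _ b(1)])
  have ia: "integrable M (\<lambda>\<omega>. a \<omega> * p1 (B \<omega>))" "integrable M (\<lambda>\<omega>. a \<omega> * p (B \<omega>))"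
    "integrable M (\<lambda>\<omega>. a \<omega> * p (B \<omega> + a \<omega>))" "integrable M (\<lambda>\<omega>. (a \<omega>)\<^sup>2 * p1 (B \<omega>))"
    by (auto intro!: integrable_mult_bounded_comp[OF _ _ _ b(1)] integrable_mult_bounded_comp[OF _ _ _ b(2)] i1 i2)
  note T = taylor_bound2[OF p b(3)]
  have "\<bar>expectation (\<lambda>\<omega>. p (B \<omega> + a \<omega>) - p (B \<omega>) - a \<omega> * p1 (B \<omega>))\<bar> \<le> expectation (\<lambda>\<omega>. L * (a \<omega>)\<^sup>2)"
    by (rule abs_integral_le) (use ib ia i2 T in auto)
  then show "\<bar>expectation (\<lambda>\<omega>. p (B \<omega> + a \<omega>)) - expectation (\<lambda>\<omega>. p (B \<omega>))\<bar> \<le> L * expectation (\<lambda>\<omega>. (a \<omega>)\<^sup>2)"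
    using ib ia e1 by simp
  have "\<bar>expectation (\<lambda>\<omega>. a \<omega> * p (B \<omega> + a \<omega>) - a \<omega> * p (B \<omega>) - (a \<omega>)\<^sup>2 * p1 (B \<omega>))\<bar>
      \<le> expectation (\<lambda>\<omega>. L * \<bar>a \<omega>\<bar> ^ 3)"
  proof (rule abs_integral_le)
    fix \<omega>
    have "\<bar>a \<omega>\<bar> * \<bar>p (B \<omega> + a \<omega>) - p (B \<omega>) - a \<omega> * p1 (B \<omega>)\<bar> \<le> \<bar>a \<omega>\<bar> * (L * (a \<omega>)\<^sup>2)"
      by (intro mult_left_mono T) auto
    moreover have "\<bar>a \<omega>\<bar> * (L * (a \<omega>)\<^sup>2) = L * \<bar>a \<omega>\<bar> ^ 3"
      unfolding power2_abs[of "a \<omega>", symmetric] power3_eq_cube power2_eq_square by (simp only: mult_ac)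
    moreover have "a \<omega> * p (B \<omega> + a \<omega>) - a \<omega> * p (B \<omega>) - (a \<omega>)\<^sup>2 * p1 (B \<omega>)
        = a \<omega> * (p (B \<omega> + a \<omega>) - p (B \<omega>) - a \<omega> * p1 (B \<omega>))"
      by (simp add: algebra_simps power2_eq_square)
    ultimately show "\<bar>a \<omega> * p (B \<omega> + a \<omega>) - a \<omega> * p (B \<omega>) - (a \<omega>)\<^sup>2 * p1 (B \<omega>)\<bar> \<le> L * \<bar>a \<omega>\<bar> ^ 3"
      by (simp add: abs_mult)
  qed (use ia i3 in auto)
  then show "\<bar>expectation (\<lambda>\<omega>. a \<omega> * p (B \<omega> + a \<omega>)) - expectation (\<lambda>\<omega>. (a \<omega>)\<^sup>2) * expectation (\<lambda>\<omega>. p1 (B \<omega>))\<bar>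
      \<le> L * expectation (\<lambda>\<omega>. \<bar>a \<omega>\<bar> ^ 3)"
    using ia e0 e2 by simp
qed

text \<open>One more Taylor term than in \<open>exchange_second_order\<close> makes E a^3 explicit;
  this is the source of the skewness correction, and the remainder drops from order three to order
  four in a.\<close>

lemma exchange_third_order:
  fixes a B :: "'a \<Rightarrow> real"
  assumes ind: "indep_var borel a borel B" and i4: "integrable M (\<lambda>\<omega>. a \<omega> ^ 4)" and m0: "expectation a = 0"
    and p: "\<And>x. (p has_real_derivative p1 x) (at x)" "\<And>x. (p1 has_real_derivative p2 x) (at x)"
      "\<And>x. (p2 has_real_derivative p3 x) (at x)"
    and b: "\<And>x. \<bar>p x\<bar> \<le> K" "\<And>x. \<bar>p1 x\<bar> \<le> K" "\<And>x. \<bar>p2 x\<bar> \<le> K" "\<And>x. \<bar>p3 x\<bar> \<le> L"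
  shows "\<bar>expectation (\<lambda>\<omega>. a \<omega> * p (B \<omega> + a \<omega>)) - expectation (\<lambda>\<omega>. (a \<omega>)\<^sup>2) * expectation (\<lambda>\<omega>. p1 (B \<omega>))
      - expectation (\<lambda>\<omega>. a \<omega> ^ 3) / 2 * expectation (\<lambda>\<omega>. p2 (B \<omega>))\<bar> \<le> L / 2 * expectation (\<lambda>\<omega>. a \<omega> ^ 4)"
proof -
  have [measurable]: "a \<in> borel_measurable M" "B \<in> borel_measurable M"
    using indep_var_rv1[OF ind] indep_var_rv2[OF ind] by auto
  have [measurable]: "p \<in> borel_measurable borel" "p1 \<in> borel_measurable borel" "p2 \<in> borel_measurable borel"
    using DERIV_isCont[OF p(1)] DERIV_isCont[OF p(2)] DERIV_isCont[OF p(3)]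
    by (auto intro!: borel_measurable_continuous_onI simp: continuous_at_imp_continuous_on)
  note ip = integrable_power_le4[OF _ i4]
  have i1: "integrable M a" using ip(1)[of 1] by simp
  have i2: "integrable M (\<lambda>\<omega>. (a \<omega>)\<^sup>2)" using ip(1)[of 2] by simp
  have i3: "integrable M (\<lambda>\<omega>. a \<omega> ^ 3)" using ip(1)[of 3] by simp
  have e0: "expectation (\<lambda>\<omega>. a \<omega> * p (B \<omega>)) = 0"
    using expectation_indep_mult[OF ind, of "\<lambda>x. x" p K] i1 b m0 by simp
  have e2: "expectation (\<lambda>\<omega>. (a \<omega>)\<^sup>2 * p1 (B \<omega>)) = expectation (\<lambda>\<omega>. (a \<omega>)\<^sup>2) * expectation (\<lambda>\<omega>. p1 (B \<omega>))"
    using expectation_indep_mult[OF ind, of "\<lambda>x. x\<^sup>2" p1 K] i2 b by simp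
  have e3: "expectation (\<lambda>\<omega>. a \<omega> ^ 3 * p2 (B \<omega>)) = expectation (\<lambda>\<omega>. a \<omega> ^ 3) * expectation (\<lambda>\<omega>. p2 (B \<omega>))"
    using expectation_indep_mult[OF ind, of "\<lambda>x. x ^ 3" p2 K] i3 b by simp
  have ia: "integrable M (\<lambda>\<omega>. a \<omega> * p (B \<omega>))" "integrable M (\<lambda>\<omega>. a \<omega> * p (B \<omega> + a \<omega>))"
    "integrable M (\<lambda>\<omega>. (a \<omega>)\<^sup>2 * p1 (B \<omega>))" "integrable M (\<lambda>\<omega>. a \<omega> ^ 3 * p2 (B \<omega>))"
    by (auto intro!: integrable_mult_bounded_comp[OF _ _ _ b(1)] integrable_mult_bounded_comp[OF _ _ _ b(2)]
        integrable_mult_bounded_comp[OF _ _ _ b(3)] i1 i2 i3)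
  have "\<bar>expectation (\<lambda>\<omega>. a \<omega> * p (B \<omega> + a \<omega>) - a \<omega> * p (B \<omega>) - (a \<omega>)\<^sup>2 * p1 (B \<omega>) - (a \<omega> ^ 3 * p2 (B \<omega>)) / 2)\<bar>
      \<le> expectation (\<lambda>\<omega>. L / 2 * a \<omega> ^ 4)"
  proof (rule abs_integral_le)
    fix \<omega>
    let ?r = "p (B \<omega> + a \<omega>) - p (B \<omega>) - a \<omega> * p1 (B \<omega>) - (a \<omega>)\<^sup>2 / 2 * p2 (B \<omega>)"
    have "\<bar>a \<omega>\<bar> * \<bar>?r\<bar> \<le> \<bar>a \<omega>\<bar> * (L * \<bar>a \<omega>\<bar> ^ 3 / 2)"
      by (intro mult_left_mono taylor_bound3[OF p b(4)]) auto
    moreover have "\<bar>a \<omega>\<bar> * (L * \<bar>a \<omega>\<bar> ^ 3 / 2) = L / 2 * \<bar>a \<omega>\<bar> ^ 4"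
      by (simp add: eval_nat_numeral)
    moreover have "\<bar>a \<omega>\<bar> ^ 4 = a \<omega> ^ 4" by simp
    moreover have "a \<omega> * p (B \<omega> + a \<omega>) - a \<omega> * p (B \<omega>) - (a \<omega>)\<^sup>2 * p1 (B \<omega>) - (a \<omega> ^ 3 * p2 (B \<omega>)) / 2 = a \<omega> * ?r"
      by (simp add: algebra_simps eval_nat_numeral)
    ultimately show "\<bar>a \<omega> * p (B \<omega> + a \<omega>) - a \<omega> * p (B \<omega>) - (a \<omega>)\<^sup>2 * p1 (B \<omega>) - (a \<omega> ^ 3 * p2 (B \<omega>)) / 2\<bar>
        \<le> L / 2 * a \<omega> ^ 4"
      by (simp only: abs_mult)
  qed (use ia i4 in auto)
  then show ?thesis
    using ia e0 e2 e3 by simp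
qed

end

lemma abs_scaled_diff: "c \<ge> 0 \<Longrightarrow> \<bar>c * x - c * y\<bar> = c * \<bar>x - y :: real\<bar>"
  by (simp add: abs_mult flip: right_diff_distrib)

lemma abs_normal_expect_le:
  assumes [measurable]: "q \<in> borel_measurable borel" and q: "\<And>x. \<bar>q x\<bar> \<le> C"
  shows "\<bar>normal_expect q\<bar> \<le> C"
proof -
  have "\<bar>normal_expect q\<bar> \<le> (\<integral>x. C * (std_normal_density x * x ^ (2 * 0)) \<partial>lborel)"
    unfolding normal_expect_def
  proof (rule abs_integral_le)
    show "integrable lborel (\<lambda>x. std_normal_density x * q x)"
      by (rule integrable_std_normal_bounded[OF _ q]) measurable
    show "integrable lborel (\<lambda>x. C * (std_normal_density x * x ^ (2 * 0)))"
      by (intro integrable_mult_right integrable_std_normal_moment)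
    show "\<bar>std_normal_density x * q x\<bar> \<le> C * (std_normal_density x * x ^ (2 * 0))" for x
      using mult_left_mono[OF q[of x] normal_density_nonneg[of 0 1 x]] by (simp add: abs_mult mult.commute)
  qed
  also have "\<dots> = C" by (simp only: integral_mult_right_zero integral_std_normal_moment_even) simp
  finally show ?thesis .
qed

text \<open>The summands share the values of their moments rather than their law, since the exchange
  argument sees only these; the three parameters are the third, absolute third and fourth
  moments.\<close>

locale normalised_sum = prob_space M for M :: "'a measure" +
  fixes I :: "'i set" and X :: "'i \<Rightarrow> 'a \<Rightarrow> real" and \<mu>3 \<beta>3 \<mu>4 :: real
  assumes fin: "finite I" and ne: "I \<noteq> {}"
    and indep: "indep_vars (\<lambda>_. borel) X I"
    and int4: "\<And>i. i \<in> I \<Longrightarrow> integrable M (\<lambda>\<omega>. X i \<omega> ^ 4)"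
    and mean: "\<And>i. i \<in> I \<Longrightarrow> expectation (X i) = 0"
    and var: "\<And>i. i \<in> I \<Longrightarrow> expectation (\<lambda>\<omega>. (X i \<omega>)\<^sup>2) = 1"
    and mom3: "\<And>i. i \<in> I \<Longrightarrow> expectation (\<lambda>\<omega>. X i \<omega> ^ 3) = \<mu>3"
    and abs3: "\<And>i. i \<in> I \<Longrightarrow> expectation (\<lambda>\<omega>. \<bar>X i \<omega>\<bar> ^ 3) = \<beta>3"
    and mom4: "\<And>i. i \<in> I \<Longrightarrow> expectation (\<lambda>\<omega>. X i \<omega> ^ 4) = \<mu>4"
begin

definition "n = real (card I)"
definition "a i \<omega> = X i \<omega> / sqrt n"
definition "B i \<omega> = (\<Sum>j\<in>I - {i}. a j \<omega>)"
definition "S \<omega> = (\<Sum>i\<in>I. X i \<omega>) / sqrt n"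

lemma n_ge_1: "n \<ge> 1"
  using fin ne unfolding n_def by (simp add: Suc_le_eq card_gt_0_iff)

lemma X_measurable [measurable]: "i \<in> I \<Longrightarrow> X i \<in> borel_measurable M"
  using indep by (auto simp: indep_vars_def)

lemma S_measurable [measurable]: "S \<in> borel_measurable M"
  unfolding S_def[abs_def] by measurable

lemma S_eq: "S \<omega> = (\<Sum>i\<in>I. a i \<omega>)"
  by (simp add: S_def a_def sum_divide_distrib)

lemma S_split: "i \<in> I \<Longrightarrow> S \<omega> = B i \<omega> + a i \<omega>"
  unfolding S_eq B_def using fin by (simp add: sum.remove)

lemma indep_a_B:
  assumes i: "i \<in> I"
  shows "indep_var borel (a i) borel (B i)"
proof -
  have "indep_vars (\<lambda>_. borel) a I"
    using indep_vars_compose2[OF indep, of "\<lambda>_ x. x / sqrt n" "\<lambda>_. borel"] by (simp add: a_def[abs_def])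
  then have "indep_vars (\<lambda>_. borel) a (insert i (I - {i}))" using i by (simp add: insert_absorb)
  then show ?thesis
    unfolding B_def[abs_def] using fin by (intro indep_vars_sum) auto
qed

lemma a_moments:
  assumes i: "i \<in> I"
  shows "integrable M (\<lambda>\<omega>. a i \<omega> ^ 4)" "expectation (a i) = 0" "expectation (\<lambda>\<omega>. (a i \<omega>)\<^sup>2) = 1 / n"
    "expectation (\<lambda>\<omega>. a i \<omega> ^ 3) = \<mu>3 / (n * sqrt n)" "expectation (\<lambda>\<omega>. \<bar>a i \<omega>\<bar> ^ 3) = \<beta>3 / (n * sqrt n)"
    "expectation (\<lambda>\<omega>. a i \<omega> ^ 4) = \<mu>4 / n\<^sup>2"
    "integrable M (\<lambda>\<omega>. \<bar>a i \<omega>\<bar>)" "expectation (\<lambda>\<omega>. \<bar>a i \<omega>\<bar>) \<le> 1 / sqrt n"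
proof -
  have n: "n > 0" "sqrt n > 0" using n_ge_1 by auto
  have sq: "sqrt n ^ 2 = n" "sqrt n ^ 3 = n * sqrt n" "sqrt n ^ 4 = n\<^sup>2"
    using n by (simp_all add: eval_nat_numeral)
  note ip = integrable_power_le4[OF X_measurable[OF i] int4[OF i]]
  show "integrable M (\<lambda>\<omega>. a i \<omega> ^ 4)" "expectation (a i) = 0" "expectation (\<lambda>\<omega>. (a i \<omega>)\<^sup>2) = 1 / n"
    "expectation (\<lambda>\<omega>. a i \<omega> ^ 3) = \<mu>3 / (n * sqrt n)" "expectation (\<lambda>\<omega>. \<bar>a i \<omega>\<bar> ^ 3) = \<beta>3 / (n * sqrt n)"
    "expectation (\<lambda>\<omega>. a i \<omega> ^ 4) = \<mu>4 / n\<^sup>2"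
    using mean[OF i] var[OF i] mom3[OF i] abs3[OF i] mom4[OF i] int4[OF i] n
    by (simp_all add: a_def[abs_def] power_divide sq abs_divide)
  show "integrable M (\<lambda>\<omega>. \<bar>a i \<omega>\<bar>)" using ip(2)[of 1] n by (simp add: a_def abs_divide)
  have i1: "integrable M (\<lambda>\<omega>. \<bar>X i \<omega>\<bar>)" and i2: "integrable M (\<lambda>\<omega>. (X i \<omega>)\<^sup>2)"
    using ip(2)[of 1] ip(1)[of 2] by auto
  have "expectation (\<lambda>\<omega>. \<bar>X i \<omega>\<bar>) \<le> expectation (\<lambda>\<omega>. (1 + (X i \<omega>)\<^sup>2) / 2)"
  proof (rule integral_mono)
    show "\<bar>X i \<omega>\<bar> \<le> (1 + (X i \<omega>)\<^sup>2) / 2" for \<omega>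
      using zero_le_power2[of "\<bar>X i \<omega>\<bar> - 1"] by (simp add: power2_diff)
  qed (use i1 i2 in auto)
  also have "\<dots> = 1" using i2 var[OF i] by (simp add: prob_space)
  finally show "expectation (\<lambda>\<omega>. \<bar>a i \<omega>\<bar>) \<le> 1 / sqrt n"
    using n by (simp add: a_def abs_divide divide_right_mono)
qed

text \<open>Expectations of pointwise inequalities, with E X^2 = 1 inserted: (t-1)^2 (2t+1),
  (t^2-1)^2 and t^2 (t-1)^2 are nonnegative for t = |X|. They serve to absorb error terms of lower
  moment order into those with \<beta>3 and \<mu>4.\<close>

lemma moment_bounds: "\<beta>3 \<ge> 1" "\<mu>4 \<ge> 1" "\<beta>3 \<le> \<mu>4" "\<bar>\<mu>3\<bar> \<le> \<beta>3"
proof -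
  obtain i where i: "i \<in> I" using ne by auto
  note ip = integrable_power_le4[OF X_measurable[OF i] int4[OF i]]
  have i2: "integrable M (\<lambda>\<omega>. (X i \<omega>)\<^sup>2)" and i3: "integrable M (\<lambda>\<omega>. \<bar>X i \<omega>\<bar> ^ 3)" using ip(1)[of 2] ip(2)[of 3] by auto
  have "expectation (\<lambda>\<omega>. (3 * (X i \<omega>)\<^sup>2 - 1) / 2) \<le> expectation (\<lambda>\<omega>. \<bar>X i \<omega>\<bar> ^ 3)"
  proof (rule integral_mono)
    show "(3 * (X i \<omega>)\<^sup>2 - 1) / 2 \<le> \<bar>X i \<omega>\<bar> ^ 3" for \<omega>
    proof -
      have "(t - 1)\<^sup>2 * (2 * t + 1) = 2 * t ^ 3 - 3 * t\<^sup>2 + 1" for t :: real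
        by (simp add: algebra_simps eval_nat_numeral)
      moreover have "0 \<le> (\<bar>X i \<omega>\<bar> - 1)\<^sup>2 * (2 * \<bar>X i \<omega>\<bar> + 1)" by simp
      ultimately have "0 \<le> 2 * \<bar>X i \<omega>\<bar> ^ 3 - 3 * \<bar>X i \<omega>\<bar>\<^sup>2 + 1" by simp
      then show ?thesis by simp
    qed
  qed (use i2 i3 in auto)
  then show "\<beta>3 \<ge> 1" using i2 var[OF i] abs3[OF i] by (simp add: prob_space)
  have "expectation (\<lambda>\<omega>. 2 * (X i \<omega>)\<^sup>2 - 1) \<le> expectation (\<lambda>\<omega>. X i \<omega> ^ 4)"
  proof (rule integral_mono)
    show "2 * (X i \<omega>)\<^sup>2 - 1 \<le> X i \<omega> ^ 4" for \<omega>
      using zero_le_power2[of "(X i \<omega>)\<^sup>2 - 1"] by (simp add: power2_diff)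
  qed (use i2 int4[OF i] in auto)
  then show m4: "\<mu>4 \<ge> 1" using i2 var[OF i] mom4[OF i] by (simp add: prob_space)
  have "expectation (\<lambda>\<omega>. \<bar>X i \<omega>\<bar> ^ 3) \<le> expectation (\<lambda>\<omega>. ((X i \<omega>)\<^sup>2 + X i \<omega> ^ 4) / 2)"
  proof (rule integral_mono)
    show "\<bar>X i \<omega>\<bar> ^ 3 \<le> ((X i \<omega>)\<^sup>2 + X i \<omega> ^ 4) / 2" for \<omega>
    proof -
      have "t\<^sup>2 * (t - 1)\<^sup>2 = t\<^sup>2 + t ^ 4 - 2 * t ^ 3" for t :: real
        by (simp add: algebra_simps eval_nat_numeral)
      moreover have "0 \<le> \<bar>X i \<omega>\<bar>\<^sup>2 * (\<bar>X i \<omega>\<bar> - 1)\<^sup>2" by simp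
      ultimately have "0 \<le> \<bar>X i \<omega>\<bar>\<^sup>2 + \<bar>X i \<omega>\<bar> ^ 4 - 2 * \<bar>X i \<omega>\<bar> ^ 3" by metis
      then show ?thesis by simp
    qed
  qed (use i2 i3 int4[OF i] in auto)
  then have "\<beta>3 \<le> (1 + \<mu>4) / 2" using i2 int4[OF i] var[OF i] mom4[OF i] abs3[OF i] by simp
  with m4 show "\<beta>3 \<le> \<mu>4" by simp
  show "\<bar>\<mu>3\<bar> \<le> \<beta>3"
    using integral_abs_bound[of M "\<lambda>\<omega>. X i \<omega> ^ 3"] mom3[OF i] abs3[OF i] by (simp add: power_abs)
qed

lemma expectation_stein:
  assumes f: "\<And>x. (f has_real_derivative f1 x) (at x)" "\<And>x. (f1 has_real_derivative f2 x) (at x)"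
    and eq: "\<And>x. f1 x = x * f x + (k x - c)"
    and b: "\<And>x. \<bar>f x\<bar> \<le> K" "\<And>x. \<bar>f1 x\<bar> \<le> K"
  shows "expectation (\<lambda>\<omega>. k (S \<omega>)) - c = (\<Sum>i\<in>I. 1 / n * expectation (\<lambda>\<omega>. f1 (S \<omega>)) - expectation (\<lambda>\<omega>. a i \<omega> * f (S \<omega>)))"
proof -
  have [measurable]: "f \<in> borel_measurable borel" "f1 \<in> borel_measurable borel"
    using DERIV_isCont[OF f(1)] DERIV_isCont[OF f(2)]
    by (auto intro!: borel_measurable_continuous_onI simp: continuous_at_imp_continuous_on)
  have k_eq: "k (S \<omega>) = f1 (S \<omega>) - (\<Sum>i\<in>I. a i \<omega> * f (S \<omega>)) + c" for \<omega>
    using eq[of "S \<omega>"] by (simp add: sum_distrib_right[symmetric] S_eq[symmetric])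
  have ia: "integrable M (\<lambda>\<omega>. a i \<omega> * f (S \<omega>))" if "i \<in> I" for i
    using integrable_power_le4(1)[OF _ a_moments(1)[OF that], of 1] indep_var_rv1[OF indep_a_B[OF that]]
    by (intro integrable_mult_bounded_comp[OF _ _ _ b(1)]) auto
  have i1: "integrable M (\<lambda>\<omega>. f1 (S \<omega>))" by (intro integrable_bounded_comp[OF _ _ b(2)]) auto
  have "expectation (\<lambda>\<omega>. k (S \<omega>)) = expectation (\<lambda>\<omega>. f1 (S \<omega>)) - (\<Sum>i\<in>I. expectation (\<lambda>\<omega>. a i \<omega> * f (S \<omega>))) + c"
    unfolding k_eq using ia i1 by (simp add: Bochner_Integration.integral_sum prob_space)
  moreover have "(\<Sum>i\<in>I. 1 / n * expectation (\<lambda>\<omega>. f1 (S \<omega>))) = expectation (\<lambda>\<omega>. f1 (S \<omega>))"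
    using n_ge_1 by (simp add: n_def)
  ultimately show ?thesis by (simp add: sum_subtractf)
qed

text \<open>Per summand there are two errors: linearising E[a f(S)], and restoring S in E f1(B).
  With L = 2 (R1 + 3 R0) each is at most L \<beta>3 / (n sqrt n), and summing over n summands gives
  2 L \<beta>3 / sqrt n.\<close>

lemma normal_approx_first_order:
  fixes k k' :: "real \<Rightarrow> real"
  assumes k: "\<And>x. (k has_real_derivative k' x) (at x)"
    and R0: "\<And>x. \<bar>k x - normal_expect k\<bar> \<le> R0" and R1: "\<And>x. \<bar>k' x\<bar> \<le> R1"
  shows "\<bar>expectation (\<lambda>\<omega>. k (S \<omega>)) - normal_expect k\<bar> \<le> 4 * (R1 + 3 * R0) * \<beta>3 / sqrt n"
proof (rule stein_solution_lipschitz[OF k R0 R1])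
  fix f f1 f2
  assume f: "\<And>x. (f has_real_derivative f1 x) (at x)" "\<And>x. (f1 has_real_derivative f2 x) (at x)"
    and eq: "\<And>x. f1 x = x * f x + (k x - normal_expect k)"
    and b: "\<And>x. \<bar>f x\<bar> \<le> 3 * R0" "\<And>x. \<bar>f1 x\<bar> \<le> 2 * R0" "\<And>x. \<bar>f2 x\<bar> \<le> 2 * (R1 + 3 * R0)"
  define L where "L = 2 * (R1 + 3 * R0)"
  have L0: "L \<ge> 0" using b(3)[of 0] abs_ge_zero[of "f2 0"] unfolding L_def by linarith
  have R00: "R0 \<ge> 0" using R0[of 0] abs_ge_zero[of "k 0 - normal_expect k"] by linarith
  have b': "\<bar>f1 x\<bar> \<le> 3 * R0" for x using b(2)[of x] R00 by linarith
  have n: "n > 0" "sqrt n > 0" using n_ge_1 by auto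
  have term_bound: "\<bar>1 / n * expectation (\<lambda>\<omega>. f1 (S \<omega>)) - expectation (\<lambda>\<omega>. a i \<omega> * f (S \<omega>))\<bar> \<le> 2 * L * \<beta>3 / (n * sqrt n)"
    if i: "i \<in> I" for i
  proof -
    note m = a_moments[OF i] and ind = indep_a_B[OF i]
    have e1: "\<bar>expectation (\<lambda>\<omega>. a i \<omega> * f (S \<omega>)) - 1 / n * expectation (\<lambda>\<omega>. f1 (B i \<omega>))\<bar> \<le> L * (\<beta>3 / (n * sqrt n))"
      using exchange_second_order(2)[OF ind m(1) m(2) f b(1) b' b(3)] unfolding S_split[OF i] m L_def .
    have "\<bar>expectation (\<lambda>\<omega>. f1 (S \<omega>)) - expectation (\<lambda>\<omega>. f1 (B i \<omega>))\<bar> \<le> L * expectation (\<lambda>\<omega>. \<bar>a i \<omega>\<bar>)"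
      using exchange_lipschitz[OF indep_var_rv1[OF ind] indep_var_rv2[OF ind] m(7) f(2) b(2) b(3)]
      unfolding S_split[OF i] L_def .
    also have "\<dots> \<le> L * (1 / sqrt n)" using m(8) L0 by (intro mult_left_mono)
    finally have "1 / n * \<bar>expectation (\<lambda>\<omega>. f1 (S \<omega>)) - expectation (\<lambda>\<omega>. f1 (B i \<omega>))\<bar> \<le> 1 / n * (L * (1 / sqrt n))"
      using n by (intro mult_left_mono) auto
    then have e2: "\<bar>1 / n * expectation (\<lambda>\<omega>. f1 (S \<omega>)) - 1 / n * expectation (\<lambda>\<omega>. f1 (B i \<omega>))\<bar> \<le> L * (1 / (n * sqrt n))"
      using n by (subst abs_scaled_diff) auto
    have "L * (1 / (n * sqrt n)) \<le> L * (\<beta>3 / (n * sqrt n))"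
      using L0 n moment_bounds(1) by (intro mult_left_mono divide_right_mono) auto
    with e1 e2 have "\<bar>1 / n * expectation (\<lambda>\<omega>. f1 (S \<omega>)) - expectation (\<lambda>\<omega>. a i \<omega> * f (S \<omega>))\<bar> \<le> 2 * (L * (\<beta>3 / (n * sqrt n)))"
      by linarith
    then show ?thesis by (simp add: mult.assoc)
  qed
  have "\<bar>expectation (\<lambda>\<omega>. k (S \<omega>)) - normal_expect k\<bar> \<le> (\<Sum>i\<in>I. 2 * L * \<beta>3 / (n * sqrt n))"
    unfolding expectation_stein[OF f eq b(1) b'] by (rule order_trans[OF sum_abs sum_mono]) (rule term_bound)
  also have "\<dots> = n * (2 * L * \<beta>3 / (n * sqrt n))" by (simp add: n_def)
  also have "\<dots> = 4 * (R1 + 3 * R0) * \<beta>3 / sqrt n" using n by (simp add: L_def)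
  finally show ?thesis .
qed

text \<open>The third-order exchange leaves -\<mu>3 / (2 sqrt n) times E f2(S). Applying the
  first-order result to f2 itself replaces S by a normal variable at the price of another 1/sqrt n,
  and \<open>normal_expect_stein_second_deriv\<close> supplies the factor -1/3, hence the
  coefficient \<mu>3 / (6 sqrt n).\<close>

lemma normal_approx_second_order:
  fixes k k' k'' :: "real \<Rightarrow> real"
  assumes k: "\<And>x. (k has_real_derivative k' x) (at x)"
    and k': "\<And>x. (k' has_real_derivative k'' x) (at x)" and k'': "\<And>x. isCont k'' x"
    and R0: "\<And>x. \<bar>k x - normal_expect k\<bar> \<le> R0" and R1: "\<And>x. \<bar>k' x\<bar> \<le> R1"
    and R2: "\<And>x. \<bar>k'' x\<bar> \<le> R2"
  shows "\<bar>expectation (\<lambda>\<omega>. k (S \<omega>)) - normal_expect k - \<mu>3 / (6 * sqrt n) * normal_expect (\<lambda>x. He3 x * k x)\<bar>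
    \<le> (R2 + 4 * R0) * (4 * \<mu>4 + 40 * \<bar>\<mu>3\<bar> * \<beta>3) / n"
proof (rule stein_solution_smooth[OF k k' R0 R1 R2])
  fix f f1 f2 f3
  assume f: "\<And>x. (f has_real_derivative f1 x) (at x)" "\<And>x. (f1 has_real_derivative f2 x) (at x)"
      "\<And>x. (f2 has_real_derivative f3 x) (at x)"
    and eq: "\<And>x. f1 x = x * f x + (k x - normal_expect k)"
    and b: "\<And>x. \<bar>f x\<bar> \<le> 3 * R0" "\<And>x. \<bar>f1 x\<bar> \<le> 2 * R0"
      "\<And>x. \<bar>f2 x\<bar> \<le> 3 * (R2 + 4 * R0)" "\<And>x. \<bar>f3 x\<bar> \<le> 2 * (R2 + 4 * R0)"
  define Q where "Q = R2 + 4 * R0"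
  define L where "L = 2 * Q"
  define K where "K = 3 * Q"
  have R00: "R0 \<ge> 0" using R0[of 0] abs_ge_zero[of "k 0 - normal_expect k"] by linarith
  have R20: "R2 \<ge> 0" using R2[of 0] abs_ge_zero[of "k'' 0"] by linarith
  have Q0: "Q \<ge> 0" "L \<ge> 0" using R00 R20 by (auto simp: Q_def L_def)
  have "3 * R0 \<le> K" "2 * R0 \<le> K" "3 * (R2 + 4 * R0) \<le> K" using R00 R20 by (auto simp: K_def Q_def)
  then have bK: "\<bar>f x\<bar> \<le> K" "\<bar>f1 x\<bar> \<le> K" "\<bar>f2 x\<bar> \<le> K" for x
    using order_trans[OF b(1)[of x]] order_trans[OF b(2)[of x]] order_trans[OF b(3)[of x]] by auto
  have bL: "\<bar>f3 x\<bar> \<le> L" for x using b(4) by (simp add: L_def Q_def)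
  have n: "n > 0" "sqrt n > 0" using n_ge_1 by auto
  \<comment> \<open>In the bound below the factor 2 L is L/2 from the Taylor remainder, L from
    restoring S in E f1(B) and L/2 from restoring it in the skewness term.\<close>
  let ?E1 = "expectation (\<lambda>\<omega>. f1 (S \<omega>))" and ?E2 = "expectation (\<lambda>\<omega>. f2 (S \<omega>))"
  have term_bound: "\<bar>(1 / n * ?E1 - expectation (\<lambda>\<omega>. a i \<omega> * f (S \<omega>))) + \<mu>3 / (n * sqrt n) / 2 * ?E2\<bar> \<le> 2 * L * \<mu>4 / n\<^sup>2"
    if i: "i \<in> I" for i
  proof -
    note m = a_moments[OF i] and ind = indep_a_B[OF i]
    have e1: "\<bar>expectation (\<lambda>\<omega>. a i \<omega> * f (S \<omega>)) - 1 / n * expectation (\<lambda>\<omega>. f1 (B i \<omega>))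
        - \<mu>3 / (n * sqrt n) / 2 * expectation (\<lambda>\<omega>. f2 (B i \<omega>))\<bar> \<le> L / 2 * (\<mu>4 / n\<^sup>2)"
      using exchange_third_order[OF ind m(1) m(2) f bK bL] unfolding S_split[OF i] m .
    have "\<bar>?E1 - expectation (\<lambda>\<omega>. f1 (B i \<omega>))\<bar> \<le> L * (1 / n)"
      using exchange_second_order(1)[OF ind m(1) m(2) f(2,3) bK(2,3) bL] unfolding S_split[OF i] m .
    then have "1 / n * \<bar>?E1 - expectation (\<lambda>\<omega>. f1 (B i \<omega>))\<bar> \<le> 1 / n * (L * (1 / n))"
      using n by (intro mult_left_mono) auto
    then have e2: "\<bar>1 / n * ?E1 - 1 / n * expectation (\<lambda>\<omega>. f1 (B i \<omega>))\<bar> \<le> L * (1 / n\<^sup>2)"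
      using n by (subst abs_scaled_diff) (auto simp: power2_eq_square)
    have "\<bar>?E2 - expectation (\<lambda>\<omega>. f2 (B i \<omega>))\<bar> \<le> L * expectation (\<lambda>\<omega>. \<bar>a i \<omega>\<bar>)"
      using exchange_lipschitz[OF indep_var_rv1[OF ind] indep_var_rv2[OF ind] m(7) f(3) bK(3) bL]
      unfolding S_split[OF i] .
    also have "\<dots> \<le> L * (1 / sqrt n)" using m(8) Q0 by (intro mult_left_mono)
    finally have "\<bar>\<mu>3 / (n * sqrt n) / 2\<bar> * \<bar>?E2 - expectation (\<lambda>\<omega>. f2 (B i \<omega>))\<bar> \<le> \<bar>\<mu>3 / (n * sqrt n) / 2\<bar> * (L * (1 / sqrt n))"
      by (intro mult_left_mono) auto
    also have "\<dots> = \<bar>\<mu>3\<bar> * (L / 2 * (1 / n\<^sup>2))"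
      using n by (simp add: abs_mult power2_eq_square)
    also have "\<dots> \<le> \<mu>4 * (L / 2 * (1 / n\<^sup>2))"
      using moment_bounds Q0 by (intro mult_right_mono) auto
    also have "\<dots> = L / 2 * (\<mu>4 / n\<^sup>2)" by simp
    finally have e3: "\<bar>\<mu>3 / (n * sqrt n) / 2 * ?E2 - \<mu>3 / (n * sqrt n) / 2 * expectation (\<lambda>\<omega>. f2 (B i \<omega>))\<bar> \<le> L / 2 * (\<mu>4 / n\<^sup>2)"
      by (simp only: abs_mult[symmetric] right_diff_distrib)
    have "L * (1 / n\<^sup>2) \<le> L * (\<mu>4 / n\<^sup>2)"
      using Q0 n moment_bounds(2) by (intro mult_left_mono divide_right_mono) auto
    moreover have "\<bar>(A1 - A) + D\<bar> \<le> 2 * (L * r)"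
      if "\<bar>A - B1 - C1\<bar> \<le> L / 2 * r" "\<bar>A1 - B1\<bar> \<le> L * s" "\<bar>D - C1\<bar> \<le> L / 2 * r" "L * s \<le> L * r"
      for A A1 B1 C1 D r s :: real
    proof -
      have "L / 2 * r = L * r / 2" by simp
      with that show ?thesis unfolding abs_le_iff by (intro conjI; linarith)
    qed
    ultimately have "\<bar>(1 / n * ?E1 - expectation (\<lambda>\<omega>. a i \<omega> * f (S \<omega>))) + \<mu>3 / (n * sqrt n) / 2 * ?E2\<bar> \<le> 2 * (L * (\<mu>4 / n\<^sup>2))"
      using e1 e2 e3 by blast
    then show ?thesis by (simp add: mult.assoc)
  qed
  have "expectation (\<lambda>\<omega>. k (S \<omega>)) - normal_expect k + \<mu>3 / (2 * sqrt n) * ?E2 =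
      (\<Sum>i\<in>I. (1 / n * ?E1 - expectation (\<lambda>\<omega>. a i \<omega> * f (S \<omega>))) + \<mu>3 / (n * sqrt n) / 2 * ?E2)"
  proof -
    have "(\<Sum>i\<in>I. \<mu>3 / (n * sqrt n) / 2 * ?E2) = n * (\<mu>3 / (n * sqrt n) / 2 * ?E2)" by (simp add: n_def)
    also have "\<dots> = \<mu>3 / (2 * sqrt n) * ?E2" using n by simp
    finally show ?thesis unfolding expectation_stein[OF f(1,2) eq bK(1,2)] sum.distrib by simp
  qed
  then have "\<bar>expectation (\<lambda>\<omega>. k (S \<omega>)) - normal_expect k + \<mu>3 / (2 * sqrt n) * ?E2\<bar> \<le> (\<Sum>i\<in>I. 2 * L * \<mu>4 / n\<^sup>2)"
    by (simp only:) (rule order_trans[OF sum_abs sum_mono], rule term_bound)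
  also have "\<dots> = n * (2 * L * \<mu>4 / n\<^sup>2)" by (simp add: n_def)
  also have "\<dots> = Q * (4 * \<mu>4) / n" using n by (simp add: L_def power2_eq_square)
  finally have main: "\<bar>expectation (\<lambda>\<omega>. k (S \<omega>)) - normal_expect k + \<mu>3 / (2 * sqrt n) * ?E2\<bar> \<le> Q * (4 * \<mu>4) / n" .

  have f2_cont: "isCont f2 x" for x using f(3) by (rule DERIV_isCont)
  have [measurable]: "f2 \<in> borel_measurable borel"
    using f2_cont by (auto intro!: borel_measurable_continuous_onI simp: continuous_at_imp_continuous_on)
  have N2: "normal_expect f2 = - (1 / 3) * normal_expect (\<lambda>x. He3 x * k x)"
    by (rule normal_expect_stein_second_deriv[OF DERIV_isCont[OF k] R0 f(1,2) f2_cont eq bK])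
  have "\<bar>normal_expect f2\<bar> \<le> K" by (rule abs_normal_expect_le[OF _ bK(3)]) measurable
  then have "\<bar>f2 x - normal_expect f2\<bar> \<le> 2 * K" for x using bK(3)[of x] by linarith
  \<comment> \<open>The test function is now f2, with centred bound 2 K and derivative bound L. With
    L = 2 Q and K = 3 Q this makes 4 (L + 6 K) = 80 Q, and the factor \<mu>3 / (2 sqrt n) halves it
    to 40.\<close>
  from normal_approx_first_order[OF f(3) this bL]
  have "\<bar>?E2 - normal_expect f2\<bar> \<le> 4 * (L + 3 * (2 * K)) * \<beta>3 / sqrt n" .
  then have "\<bar>\<mu>3 / (2 * sqrt n)\<bar> * \<bar>?E2 - normal_expect f2\<bar> \<le> \<bar>\<mu>3 / (2 * sqrt n)\<bar> * (4 * (L + 3 * (2 * K)) * \<beta>3 / sqrt n)"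
    by (intro mult_left_mono) auto
  also have "\<dots> = Q * (40 * \<bar>\<mu>3\<bar> * \<beta>3) / n"
  proof -
    have "\<bar>\<mu>3 / (2 * sqrt n)\<bar> = \<bar>\<mu>3\<bar> / (2 * sqrt n)" using n by (simp add: abs_mult)
    moreover have "4 * (L + 3 * (2 * K)) = 80 * Q" by (simp add: L_def K_def)
    ultimately show ?thesis using n by (simp add: field_simps)
  qed
  finally have "\<bar>\<mu>3 / (2 * sqrt n) * ?E2 - \<mu>3 / (2 * sqrt n) * normal_expect f2\<bar> \<le> Q * (40 * \<bar>\<mu>3\<bar> * \<beta>3) / n"
    by (simp only: abs_mult[symmetric] right_diff_distrib)
  moreover have "\<mu>3 / (2 * sqrt n) * normal_expect f2 = - (\<mu>3 / (6 * sqrt n) * normal_expect (\<lambda>x. He3 x * k x))"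
    unfolding N2 by simp
  moreover have "Q * (4 * \<mu>4) / n + Q * (40 * \<bar>\<mu>3\<bar> * \<beta>3) / n = (R2 + 4 * R0) * (4 * \<mu>4 + 40 * \<bar>\<mu>3\<bar> * \<beta>3) / n"
    by (simp add: Q_def add_divide_distrib distrib_left)
  ultimately show ?thesis using main by linarith
qed

end

section \<open>Products of two normalised sums\<close>

lemma normal_expect_poly_bound:
  assumes [measurable]: "q \<in> borel_measurable borel"
    and q: "\<And>x. \<bar>q x\<bar> \<le> d0 + d1 * x\<^sup>2 + d2 * x ^ 4"
  shows "\<bar>normal_expect q\<bar> \<le> d0 + d1 + 3 * d2"
proof -
  let ?\<phi> = std_normal_density
  note i = integrable_std_normal_moment
  let ?p = "\<lambda>x. d0 * (?\<phi> x * x ^ (2 * 0)) + d1 * (?\<phi> x * x ^ (2 * 1)) + d2 * (?\<phi> x * x ^ (2 * 2))"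
  have ip: "integrable lborel ?p"
    by (intro Bochner_Integration.integrable_add integrable_mult_right i)
  have le: "\<bar>?\<phi> x * q x\<bar> \<le> ?p x" for x
    using mult_left_mono[OF q[of x] normal_density_nonneg[of 0 1 x]] by (simp add: abs_mult algebra_simps power2_eq_square)
  have "\<bar>normal_expect q\<bar> \<le> (\<integral>x. ?p x \<partial>lborel)"
    unfolding normal_expect_def
  proof (rule abs_integral_le[OF _ ip le])
    show "integrable lborel (\<lambda>x. ?\<phi> x * q x)"
      by (rule Bochner_Integration.integrable_bound[OF ip]) (use le in \<open>auto intro: order_trans[OF _ abs_ge_self]\<close>)
  qed
  also have "(\<integral>x. ?p x \<partial>lborel) = d0 * (\<integral>x. ?\<phi> x * x ^ (2 * 0) \<partial>lborel) + d1 * (\<integral>x. ?\<phi> x * x ^ (2 * 1) \<partial>lborel)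
      + d2 * (\<integral>x. ?\<phi> x * x ^ (2 * 2) \<partial>lborel)"
    by (simp only: Bochner_Integration.integral_add Bochner_Integration.integrable_add integrable_mult_right i
        integral_mult_right_zero)
  also have "\<dots> = d0 + d1 + 3 * d2"
    unfolding integral_std_normal_moment_even by (simp add: eval_nat_numeral)
  finally show ?thesis .
qed

text \<open>Odd powers are traded for even ones, whose normal moments are explicit, by 2t \<le> 1 +
  t^2 and 2t^3 \<le> t^2 + t^4. The resulting normal means, 5 and 6, are the constants for the odd
  function G and its derivative below.\<close>

lemma abs_He3_bounds:
  "\<bar>He3 x\<bar> \<le> 3 / 2 + 2 * x\<^sup>2 + 1 / 2 * x ^ 4" "\<bar>He3 x * x\<bar> \<le> 0 + 3 * x\<^sup>2 + 1 * x ^ 4"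
proof -
  define t where "t = \<bar>x\<bar>"
  have t: "t \<ge> 0" "x\<^sup>2 = t\<^sup>2" "x ^ 4 = t ^ 4" by (auto simp: t_def)
  have "\<bar>He3 x\<bar> \<le> \<bar>x ^ 3\<bar> + \<bar>3 * x\<bar>" unfolding He3_def by (rule abs_triangle_ineq4)
  then have H: "\<bar>He3 x\<bar> \<le> t ^ 3 + 3 * t" by (simp add: t_def power_abs abs_mult)
  have "0 \<le> t\<^sup>2 * (t - 1)\<^sup>2" "0 \<le> (t - 1)\<^sup>2" by auto
  moreover have "t\<^sup>2 * (t - 1)\<^sup>2 = t\<^sup>2 + t ^ 4 - 2 * t ^ 3" "(t - 1)\<^sup>2 = t\<^sup>2 - 2 * t + 1"
    by (simp_all add: algebra_simps eval_nat_numeral)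
  ultimately show "\<bar>He3 x\<bar> \<le> 3 / 2 + 2 * x\<^sup>2 + 1 / 2 * x ^ 4" unfolding t(2,3) using H by linarith
  have "\<bar>He3 x * x\<bar> \<le> (t ^ 3 + 3 * t) * t"
    unfolding abs_mult using H t by (intro mult_mono) (auto simp: t_def)
  also have "\<dots> = 3 * t\<^sup>2 + t ^ 4" by (simp add: algebra_simps eval_nat_numeral)
  finally show "\<bar>He3 x * x\<bar> \<le> 0 + 3 * x\<^sup>2 + 1 * x ^ 4" unfolding t(2,3) by simp
qed

text \<open>The weight p is 1 for the first and x for the second derivative of E h(N v), and
  \<open>He3\<close> for the derivative of the skewness term.\<close>

lemma normal_expect_scaled_deriv:
  fixes p h h1 :: "real \<Rightarrow> real"
  assumes [measurable]: "p \<in> borel_measurable borel"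
    and p: "\<And>x. \<bar>p x\<bar> \<le> C * (1 + x ^ 6)" "\<And>x. \<bar>p x * x\<bar> \<le> C * (1 + x ^ 6)"
    and h: "\<And>x. (h has_real_derivative h1 x) (at x)" and [measurable]: "h1 \<in> borel_measurable borel"
    and b: "\<And>x. \<bar>h x\<bar> \<le> H0" "\<And>x. \<bar>h1 x\<bar> \<le> H1"
  shows "((\<lambda>v. normal_expect (\<lambda>x. p x * h (x * v))) has_real_derivative
            normal_expect (\<lambda>x. p x * x * h1 (x * v))) (at v)"
  unfolding normal_expect_def
proof (rule has_real_derivative_integral[where a = "v - 1" and b = "v + 1"
      and w = "\<lambda>x. std_normal_density x * (\<bar>p x * x\<bar> * H1)"])
  have H: "H0 \<ge> 0" "H1 \<ge> 0" using b(1)[of 0] b(2)[of 0] by linarith+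
  have [measurable]: "h \<in> borel_measurable borel"
    using DERIV_isCont[OF h] by (intro borel_measurable_continuous_onI) (simp add: continuous_at_imp_continuous_on)
  show "integrable lborel (\<lambda>x. std_normal_density x * (p x * h (x * y)))" for y
  proof (rule integrable_std_normal_times)
    show "\<bar>p x * h (x * y)\<bar> \<le> (C * H0) * (1 + x ^ 6)" for x
      using mult_mono[OF p(1)[of x] b(1)[of "x * y"]] order_trans[OF abs_ge_zero p(1)[of x]]
      by (simp add: abs_mult mult_ac)
  qed measurable
  show "((\<lambda>y. std_normal_density x * (p x * h (x * y))) has_real_derivative
      std_normal_density x * (p x * x * h1 (x * y))) (at y)" for x y
  proof -
    have "((\<lambda>y. h (x * y)) has_real_derivative h1 (x * y) * x) (at y)"
      by (rule DERIV_chain2[OF h]) (auto intro!: derivative_eq_intros)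
    from DERIV_cmult[OF DERIV_cmult[OF this, of "p x"], of "std_normal_density x"] show ?thesis
      by (simp only: mult_ac)
  qed
  show "\<bar>std_normal_density x * (p x * x * h1 (x * y))\<bar>
      \<le> std_normal_density x * (\<bar>p x * x\<bar> * H1)" for x y
  proof -
    have "\<bar>p x * x * h1 (x * y)\<bar> \<le> \<bar>p x * x\<bar> * H1"
      unfolding abs_mult[of "p x * x"] using b(2) by (intro mult_left_mono) auto
    then show ?thesis
      unfolding abs_mult[of "std_normal_density x"] by (simp add: mult_left_mono)
  qed
  show "integrable lborel (\<lambda>x. std_normal_density x * (\<bar>p x * x\<bar> * H1))"
  proof (rule integrable_std_normal_times)
    show "\<bar>\<bar>p x * x\<bar> * H1\<bar> \<le> (C * H1) * (1 + x ^ 6)" for x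
      using mult_right_mono[OF p(2)[of x] H(2)] H by (simp add: abs_mult mult_ac)
  qed measurable
  show "(\<lambda>x. std_normal_density x * (p x * x * h1 (x * v))) \<in> borel_measurable lborel" by measurable
qed simp

lemma normal_expect_odd:
  assumes "\<And>x. q (- x) = - q x"
  shows "normal_expect q = 0"
proof -
  have "normal_expect q = (\<integral>x. std_normal_density (0 + -1 * x) * q (0 + -1 * x) \<partial>lborel)"
    unfolding normal_expect_def by (subst lborel_integral_real_affine[of "-1" _ 0]) auto
  also have "\<dots> = - normal_expect q"
    unfolding normal_expect_def by (simp add: assms std_normal_density_def)
  finally show ?thesis by simp
qed

lemma normal_expect_reflect: "normal_expect (\<lambda>x. q (- x)) = normal_expect q"
  unfolding normal_expect_def
  by (subst (2) lborel_integral_real_affine[of "-1" _ 0]) (auto simp: std_normal_density_def)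

lemma VG_expect_normal:
  assumes [measurable]: "h \<in> borel_measurable borel" and b: "\<And>x. \<bar>h x\<bar> \<le> H0"
  shows "VG_expect h = normal_expect (\<lambda>v. normal_expect (\<lambda>x. h (x * v)))"
proof -
  interpret N: prob_space std_normal by (rule prob_space_normal_density) simp
  interpret P: pair_prob_space std_normal std_normal ..
  have "VG_expect h = (\<integral>z. h (fst z * snd z) \<partial>(std_normal \<Otimes>\<^sub>M std_normal))"
    unfolding VG_expect_def VG_law_eq by (subst integral_distr) (auto simp: split_beta')
  also have "\<dots> = (\<integral>v. \<integral>x. h (x * v) \<partial>std_normal \<partial>std_normal)"
  proof -
    have "integrable (std_normal \<Otimes>\<^sub>M std_normal) (\<lambda>(x, v). h (x * v))"
      by (rule P.P.integrable_const_bound[of _ H0]) (auto simp: split_beta' intro: b)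
    from P.integral_snd[OF this] show ?thesis by (simp add: split_beta')
  qed
  also have "\<dots> = normal_expect (\<lambda>v. normal_expect (\<lambda>x. h (x * v)))"
    unfolding normal_expect_def by (subst (1 2) integral_density) auto
  finally show ?thesis .
qed

lemma (in prob_space) expectation_indep_product:
  fixes U V :: "'a \<Rightarrow> real" and h :: "real \<Rightarrow> real"
  assumes ind: "indep_var borel U borel V"
    and [measurable]: "h \<in> borel_measurable borel" and b: "\<And>x. \<bar>h x\<bar> \<le> H0"
  shows "expectation (\<lambda>\<omega>. h (U \<omega> * V \<omega>)) = expectation (\<lambda>\<omega>'. expectation (\<lambda>\<omega>. h (U \<omega> * V \<omega>')))"
    and "(\<lambda>v. expectation (\<lambda>\<omega>. h (U \<omega> * v))) \<in> borel_measurable borel"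
proof -
  have [measurable]: "U \<in> borel_measurable M" "V \<in> borel_measurable M"
    using indep_var_rv1[OF ind] indep_var_rv2[OF ind] by auto
  let ?U = "distr M borel U" and ?V = "distr M borel V"
  interpret U: prob_space ?U by (rule prob_space_distr) measurable
  interpret V: prob_space ?V by (rule prob_space_distr) measurable
  interpret P: pair_prob_space ?U ?V ..
  have pair: "?U \<Otimes>\<^sub>M ?V = distr M (borel \<Otimes>\<^sub>M borel) (\<lambda>\<omega>. (U \<omega>, V \<omega>))"
    using ind by (simp add: indep_var_distribution_eq)
  have inner: "(\<integral>u. h (u * v) \<partial>?U) = expectation (\<lambda>\<omega>. h (U \<omega> * v))" for v
    using Bochner_Integration.integral_distr[of U M borel "\<lambda>u. h (u * v)"] by simp
  have "expectation (\<lambda>\<omega>. h (U \<omega> * V \<omega>)) = (\<integral>z. h (fst z * snd z) \<partial>(?U \<Otimes>\<^sub>M ?V))"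
    unfolding pair by (subst Bochner_Integration.integral_distr) auto
  also have "\<dots> = (\<integral>v. \<integral>u. h (u * v) \<partial>?U \<partial>?V)"
  proof -
    have "integrable (?U \<Otimes>\<^sub>M ?V) (\<lambda>(u, v). h (u * v))"
      by (rule P.P.integrable_const_bound[of _ H0]) (auto simp: split_beta' intro: b)
    from P.integral_snd[OF this] show ?thesis by (simp add: split_beta')
  qed
  also have "\<dots> = (\<integral>v. expectation (\<lambda>\<omega>. h (U \<omega> * v)) \<partial>?V)" unfolding inner ..
  finally have e: "expectation (\<lambda>\<omega>. h (U \<omega> * V \<omega>)) = (\<integral>v. expectation (\<lambda>\<omega>. h (U \<omega> * v)) \<partial>?V)" .
  show m [measurable]: "(\<lambda>v. expectation (\<lambda>\<omega>. h (U \<omega> * v))) \<in> borel_measurable borel"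
    unfolding inner[symmetric] by measurable
  show "expectation (\<lambda>\<omega>. h (U \<omega> * V \<omega>)) = expectation (\<lambda>\<omega>'. expectation (\<lambda>\<omega>. h (U \<omega> * V \<omega>')))"
    unfolding e by (subst Bochner_Integration.integral_distr) auto
qed

text \<open>The error of the expansion conditional on V = v grows like v^2, and this moment averages
  it exactly. In the sum of the a_i S, independence leaves only the squares of the a_i.\<close>

lemma (in normalised_sum) expectation_S_square:
  "integrable M (\<lambda>\<omega>. (S \<omega>)\<^sup>2)" "expectation (\<lambda>\<omega>. (S \<omega>)\<^sup>2) = 1"
proof -
  have ia: "integrable M (a i)" "integrable M (\<lambda>\<omega>. (a i \<omega>)\<^sup>2)" if "i \<in> I" for i
    using integrable_power_le4(1)[OF _ a_moments(1)[OF that], of 1]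
      integrable_power_le4(1)[OF _ a_moments(1)[OF that], of 2] indep_var_rv1[OF indep_a_B[OF that]] by auto
  have iB: "integrable M (B i)" for i unfolding B_def[abs_def] using ia by (intro Bochner_Integration.integrable_sum) auto
  have iaS: "integrable M (\<lambda>\<omega>. a i \<omega> * S \<omega>)" and eaS: "expectation (\<lambda>\<omega>. a i \<omega> * S \<omega>) = 1 / n" if i: "i \<in> I" for i
  proof -
    have eq: "a i \<omega> * S \<omega> = a i \<omega> * B i \<omega> + (a i \<omega>)\<^sup>2" for \<omega>
      using S_split[OF i] by (simp add: algebra_simps power2_eq_square)
    have iaB: "integrable M (\<lambda>\<omega>. a i \<omega> * B i \<omega>)"
      by (rule indep_var_integrable[OF indep_a_B[OF i] ia(1)[OF i] iB])
    then show "integrable M (\<lambda>\<omega>. a i \<omega> * S \<omega>)" unfolding eq using ia[OF i] by simp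
    show "expectation (\<lambda>\<omega>. a i \<omega> * S \<omega>) = 1 / n"
      unfolding eq using iaB ia[OF i] a_moments(2,3)[OF i]
        indep_var_lebesgue_integral[OF indep_a_B[OF i] ia(1)[OF i] iB] by simp
  qed
  have sq: "(S \<omega>)\<^sup>2 = (\<Sum>i\<in>I. a i \<omega> * S \<omega>)" for \<omega>
    by (simp add: sum_distrib_right[symmetric] S_eq[symmetric] power2_eq_square)
  show "integrable M (\<lambda>\<omega>. (S \<omega>)\<^sup>2)" unfolding sq using iaS by simp
  show "expectation (\<lambda>\<omega>. (S \<omega>)\<^sup>2) = 1"
    unfolding sq using iaS eaS n_ge_1 by (simp add: Bochner_Integration.integral_sum n_def)
qed

text \<open>The three terms on the right belong to replacing U given V, to replacing V, and to the
  skewness correction of the first replacement, which is E G(V) for an odd G and is itself estimated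
  by a normal approximation.\<close>

lemma product_approx:
  fixes h h1 h2 :: "real \<Rightarrow> real"
  assumes U: "normalised_sum M I X \<mu>3 \<beta>3 \<mu>4" and V: "normalised_sum M J Y \<nu>3 \<gamma>3 \<nu>4"
    and ind: "prob_space.indep_var M borel (normalised_sum.S I X) borel (normalised_sum.S J Y)"
    and h: "\<And>x. (h has_real_derivative h1 x) (at x)" "\<And>x. (h1 has_real_derivative h2 x) (at x)" "\<And>x. isCont h2 x"
    and b: "\<And>x. \<bar>h x\<bar> \<le> H0" "\<And>x. \<bar>h1 x\<bar> \<le> H1" "\<And>x. \<bar>h2 x\<bar> \<le> H2"
    and VG: "VG_expect h = 0"
  shows "\<bar>\<integral>\<omega>. h (normalised_sum.S I X \<omega> * normalised_sum.S J Y \<omega>) \<partial>M\<bar>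
    \<le> (H2 + 8 * H0) * (4 * \<mu>4 + 40 * \<bar>\<mu>3\<bar> * \<beta>3) / card I
      + (H2 + 4 * H0) * (4 * \<nu>4 + 40 * \<bar>\<nu>3\<bar> * \<gamma>3) / card J
      + \<bar>\<mu>3\<bar> * \<gamma>3 * (4 * H1 + 10 * H0) / sqrt (real (card I) * real (card J))"
proof -
  interpret U: normalised_sum M I X \<mu>3 \<beta>3 \<mu>4 by (rule U)
  interpret V: normalised_sum M J Y \<nu>3 \<gamma>3 \<nu>4 by (rule V)
  define m where "m = real (card I)"
  define n where "n = real (card J)"
  have mn: "m \<ge> 1" "n \<ge> 1" "U.n = m" "V.n = n"
    using U.n_ge_1 V.n_ge_1 by (simp_all add: m_def n_def U.n_def V.n_def)
  have H: "H0 \<ge> 0" "H1 \<ge> 0" "H2 \<ge> 0" using b(1)[of 0] b(2)[of 0] b(3)[of 0] by linarith+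
  have [measurable]: "h \<in> borel_measurable borel" "h1 \<in> borel_measurable borel" "h2 \<in> borel_measurable borel"
    using DERIV_isCont[OF h(1)] DERIV_isCont[OF h(2)] h(3)
    by (auto intro!: borel_measurable_continuous_onI simp: continuous_at_imp_continuous_on)
  define g where "g = (\<lambda>v. normal_expect (\<lambda>x. h (x * v)))"
  define G where "G = (\<lambda>v. normal_expect (\<lambda>x. He3 x * h (x * v)))"

  have g_bd: "\<bar>g v\<bar> \<le> H0" for v
    unfolding g_def by (rule abs_normal_expect_le) (use b in auto)
  have g1: "(g has_real_derivative normal_expect (\<lambda>x. x * h1 (x * v))) (at v)" for v
    using normal_expect_scaled_deriv[of "\<lambda>_. 1" 1 h h1 H0 H1 v] h b abs_power_le_sixth[of 1]
    by (simp add: g_def)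
  have g1_bd: "\<bar>normal_expect (\<lambda>x. x * h1 (x * v))\<bar> \<le> H1 / 2 + H1 / 2 + 3 * 0" for v
  proof (rule normal_expect_poly_bound)
    show "\<bar>x * h1 (x * v)\<bar> \<le> H1 / 2 + H1 / 2 * x\<^sup>2 + 0 * x ^ 4" for x
    proof -
      have "2 * \<bar>x\<bar> \<le> 1 + x\<^sup>2" using zero_le_power2[of "\<bar>x\<bar> - 1"] by (simp add: power2_diff)
      then have "\<bar>x\<bar> * \<bar>h1 (x * v)\<bar> \<le> (1 + x\<^sup>2) / 2 * H1" using b(2) by (intro mult_mono) auto
      then show ?thesis by (simp add: abs_mult field_simps)
    qed
  qed measurable
  have g2: "((\<lambda>v. normal_expect (\<lambda>x. x * h1 (x * v))) has_real_derivative normal_expect (\<lambda>x. x * x * h2 (x * v))) (at v)" for v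
    using normal_expect_scaled_deriv[of "\<lambda>x. x" 1 h1 h2 H1 H2 v] h b abs_power_le_sixth[of 1] abs_power_le_sixth[of 2]
    by (simp add: power2_eq_square)
  have g2_bd: "\<bar>normal_expect (\<lambda>x. x * x * h2 (x * v))\<bar> \<le> 0 + H2 + 3 * 0" for v
  proof (rule normal_expect_poly_bound)
    show "\<bar>x * x * h2 (x * v)\<bar> \<le> 0 + H2 * x\<^sup>2 + 0 * x ^ 4" for x
      using mult_left_mono[OF b(3)[of "x * v"], of "x\<^sup>2"] by (simp add: abs_mult power2_eq_square mult_ac)
  qed measurable
  have g2_cont: "isCont (\<lambda>v. normal_expect (\<lambda>x. x * x * h2 (x * v))) v" for v
    unfolding continuous_at_sequentially comp_def normal_expect_def
  proof (intro allI impI)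
    fix s :: "nat \<Rightarrow> real" assume s: "s \<longlonglongrightarrow> v"
    show "(\<lambda>k. \<integral>x. std_normal_density x * (x * x * h2 (x * s k)) \<partial>lborel)
        \<longlonglongrightarrow> (\<integral>x. std_normal_density x * (x * x * h2 (x * v)) \<partial>lborel)"
    proof (rule integral_dominated_convergence[where w = "\<lambda>x. H2 * (std_normal_density x * x ^ 2)"])
      show "integrable lborel (\<lambda>x. H2 * (std_normal_density x * x ^ 2))"
        by (intro integrable_mult_right integrable_std_normal_moment)
      show "AE x in lborel. (\<lambda>k. std_normal_density x * (x * x * h2 (x * s k))) \<longlonglongrightarrow> std_normal_density x * (x * x * h2 (x * v))"
        by (intro AE_I2 tendsto_intros isCont_tendsto_compose[OF h(3)] s)
      show "AE x in lborel. norm (std_normal_density x * (x * x * h2 (x * s k))) \<le> H2 * (std_normal_density x * x ^ 2)" for k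
      proof (rule AE_I2)
        fix x :: real
        have "(std_normal_density x * x\<^sup>2) * \<bar>h2 (x * s k)\<bar> \<le> (std_normal_density x * x\<^sup>2) * H2"
          by (intro mult_left_mono b) auto
        then show "norm (std_normal_density x * (x * x * h2 (x * s k))) \<le> H2 * (std_normal_density x * x ^ 2)"
          by (simp add: abs_mult power2_eq_square mult_ac)
      qed
    qed measurable
  qed

  have G1: "(G has_real_derivative normal_expect (\<lambda>x. He3 x * x * h1 (x * v))) (at v)" for v
    unfolding G_def
  proof (rule normal_expect_scaled_deriv[OF _ abs_He3_le _ h(1) _ b(1,2)])
    show "\<bar>He3 x * x\<bar> \<le> 4 * (1 + x ^ 6)" for x
      using abs_He3_bounds(2)[of x] abs_power_le_sixth[of 2 x] abs_power_le_sixth[of 4 x] by simp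
  qed measurable
  have G1_bd: "\<bar>normal_expect (\<lambda>x. He3 x * x * h1 (x * v))\<bar> \<le> 0 + 3 * H1 + 3 * H1" for v
  proof (rule normal_expect_poly_bound)
    show "\<bar>He3 x * x * h1 (x * v)\<bar> \<le> 0 + 3 * H1 * x\<^sup>2 + H1 * x ^ 4" for x
      using mult_mono[OF abs_He3_bounds(2)[of x] b(2)[of "x * v"]]
      by (simp add: abs_mult algebra_simps)
  qed measurable
  have G_bd: "\<bar>G v\<bar> \<le> 3 / 2 * H0 + 2 * H0 + 3 * (1 / 2 * H0)" for v
    unfolding G_def
  proof (rule normal_expect_poly_bound)
    show "\<bar>He3 x * h (x * v)\<bar> \<le> 3 / 2 * H0 + 2 * H0 * x\<^sup>2 + 1 / 2 * H0 * x ^ 4" for x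
      using mult_mono[OF abs_He3_bounds(1)[of x] b(1)[of "x * v"]]
      by (simp add: abs_mult algebra_simps)
  qed measurable
  have [measurable]: "g \<in> borel_measurable borel" "G \<in> borel_measurable borel"
    using DERIV_isCont[OF g1] DERIV_isCont[OF G1]
    by (auto intro!: borel_measurable_continuous_onI simp: continuous_at_imp_continuous_on)

  have g_even: "g (- v) = g v" for v
    unfolding g_def using normal_expect_reflect[of "\<lambda>x. h (x * v)"] by simp
  have G_odd: "G (- v) = - G v" for v
  proof -
    have "G v = normal_expect (\<lambda>x. He3 (- x) * h (- x * v))"
      unfolding G_def using normal_expect_reflect[of "\<lambda>x. He3 x * h (x * v)"] by simp
    also have "\<dots> = normal_expect (\<lambda>x. - (He3 x * h (x * - v)))"
      by (intro arg_cong[where f = normal_expect] ext) (simp add: He3_def left_diff_distrib)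
    also have "\<dots> = - G (- v)" unfolding G_def normal_expect_def by simp
    finally show ?thesis by simp
  qed
  have Eg: "normal_expect g = 0"
    using VG_expect_normal[of h H0] b VG by (simp add: g_def)
  have EG: "normal_expect G = 0" using G_odd by (rule normal_expect_odd)
  have EHg: "normal_expect (\<lambda>x. He3 x * g x) = 0"
    by (rule normal_expect_odd) (simp add: g_even He3_def left_diff_distrib)

  \<comment> \<open>Since the VG mean of h is 0, g has normal mean 0 and its centred bound is H0,
    not 2 H0; hence 4 H0 in this term.\<close>
  have Vg: "\<bar>U.expectation (\<lambda>\<omega>. g (V.S \<omega>))\<bar> \<le> (H2 + 4 * H0) * (4 * \<nu>4 + 40 * \<bar>\<nu>3\<bar> * \<gamma>3) / n"
    using V.normal_approx_second_order[OF g1 g2 g2_cont, of H0 "H1 / 2 + H1 / 2 + 3 * 0" H2] g_bd g1_bd g2_bd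
    by (simp add: Eg EHg mn)
  \<comment> \<open>The function G is bounded by 5 H0 with derivative at most 6 H1, so the
    first-order bound has 4 (6 H1 + 15 H0); the factor \<mu>3 / (6 sqrt m) reduces this to 4 H1 + 10
    H0.\<close>
  have VG3: "\<bar>U.expectation (\<lambda>\<omega>. G (V.S \<omega>))\<bar> \<le> 4 * (6 * H1 + 15 * H0) * \<gamma>3 / sqrt n"
    using V.normal_approx_first_order[OF G1, of "5 * H0" "6 * H1"] G_bd G1_bd by (simp add: EG mn)

  define D where "D v = U.expectation (\<lambda>\<omega>. h (U.S \<omega> * v)) - g v - \<mu>3 / (6 * sqrt m) * G v" for v
  define C where "C = (4 * \<mu>4 + 40 * \<bar>\<mu>3\<bar> * \<beta>3) / m"
  have C0: "C \<ge> 0" unfolding C_def using U.moment_bounds mn by auto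
  \<comment> \<open>For fixed v the test function u -> h(u v) deviates from its normal mean by at
    most 2 H0, hence 8 H0, and its second derivative is at most H2 v^2. The first-derivative bound
    H1 |v| does not appear in the conclusion of the expansion, so averaging over V takes only E
    V^2.\<close>
  have D_bd: "\<bar>D v\<bar> \<le> C * (H2 * v\<^sup>2 + 8 * H0)" for v
  proof -
    have k1: "((\<lambda>u. h (u * v)) has_real_derivative h1 (u * v) * v) (at u)" for u
      by (rule DERIV_chain2[OF h(1)]) (auto intro!: derivative_eq_intros)
    have k2: "((\<lambda>u. h1 (u * v) * v) has_real_derivative h2 (u * v) * v * v) (at u)" for u
      by (intro DERIV_cmult_right DERIV_chain2[OF h(2)]) (auto intro!: derivative_eq_intros)
    have kc: "isCont (\<lambda>u. h2 (u * v) * v * v) u" for u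
      by (intro continuous_intros isCont_o2[OF _ h(3)])
    have "\<bar>h (u * v) - normal_expect (\<lambda>u. h (u * v))\<bar> \<le> 2 * H0" for u
      using b(1)[of "u * v"] g_bd[of v] unfolding g_def by linarith
    moreover have "\<bar>h1 (u * v) * v\<bar> \<le> H1 * \<bar>v\<bar>" for u
      unfolding abs_mult using b(2) by (intro mult_right_mono) auto
    moreover have "\<bar>h2 (u * v) * v * v\<bar> \<le> H2 * v\<^sup>2" for u
      using mult_right_mono[OF b(3)[of "u * v"], of "v\<^sup>2"] by (simp add: abs_mult power2_eq_square mult_ac)
    ultimately have "\<bar>U.expectation (\<lambda>\<omega>. h (U.S \<omega> * v)) - normal_expect (\<lambda>u. h (u * v))
        - \<mu>3 / (6 * sqrt U.n) * normal_expect (\<lambda>u. He3 u * h (u * v))\<bar>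
        \<le> (H2 * v\<^sup>2 + 4 * (2 * H0)) * (4 * \<mu>4 + 40 * \<bar>\<mu>3\<bar> * \<beta>3) / U.n"
      by (rule U.normal_approx_second_order[OF k1 k2 kc])
    then show ?thesis by (simp add: D_def g_def G_def C_def mn mult_ac)
  qed
  note prod = U.expectation_indep_product[OF ind, of h H0]
  have hm: "(\<lambda>v. U.expectation (\<lambda>\<omega>. h (U.S \<omega> * v))) \<in> borel_measurable borel"
    by (rule prod(2)) (use b in auto)
  have h_bd: "\<bar>U.expectation (\<lambda>\<omega>. h (U.S \<omega> * v))\<bar> \<le> H0" for v
  proof -
    have "\<bar>U.expectation (\<lambda>\<omega>. h (U.S \<omega> * v))\<bar> \<le> U.expectation (\<lambda>\<omega>. H0)"
      by (rule abs_integral_le) (use b in \<open>auto intro!: U.integrable_const_bound[of _ H0]\<close>)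
    then show ?thesis by (simp add: U.prob_space)
  qed
  have ih: "integrable M (\<lambda>\<omega>'. U.expectation (\<lambda>\<omega>. h (U.S \<omega> * V.S \<omega>')))"
    by (rule U.integrable_bounded_comp[OF V.S_measurable hm h_bd])
  have ig: "integrable M (\<lambda>\<omega>. g (V.S \<omega>))" by (rule U.integrable_bounded_comp[OF _ _ g_bd]) measurable
  have iG: "integrable M (\<lambda>\<omega>. G (V.S \<omega>))" by (rule U.integrable_bounded_comp[OF _ _ G_bd]) measurable
  have iD: "integrable M (\<lambda>\<omega>. D (V.S \<omega>))" unfolding D_def using ih ig iG by simp
  have "\<bar>U.expectation (\<lambda>\<omega>. D (V.S \<omega>))\<bar> \<le> U.expectation (\<lambda>\<omega>. C * (H2 * (V.S \<omega>)\<^sup>2 + 8 * H0))"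
    by (rule abs_integral_le) (use iD D_bd V.expectation_S_square in auto)
  also have "\<dots> = C * (H2 + 8 * H0)"
    using V.expectation_S_square by (simp add: U.prob_space)
  finally have ED: "\<bar>U.expectation (\<lambda>\<omega>. D (V.S \<omega>))\<bar> \<le> C * (H2 + 8 * H0)" .
  have dec: "U.expectation (\<lambda>\<omega>. h (U.S \<omega> * V.S \<omega>)) =
      U.expectation (\<lambda>\<omega>. D (V.S \<omega>)) + U.expectation (\<lambda>\<omega>. g (V.S \<omega>)) + \<mu>3 / (6 * sqrt m) * U.expectation (\<lambda>\<omega>. G (V.S \<omega>))"
  proof -
    have "U.expectation (\<lambda>\<omega>. h (U.S \<omega> * V.S \<omega>)) = U.expectation (\<lambda>\<omega>'. U.expectation (\<lambda>\<omega>. h (U.S \<omega> * V.S \<omega>')))"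
      by (rule prod(1)) (use b in auto)
    then show ?thesis unfolding D_def using ih ig iG by simp
  qed
  have "\<bar>\<mu>3 / (6 * sqrt m) * U.expectation (\<lambda>\<omega>. G (V.S \<omega>))\<bar> \<le> \<bar>\<mu>3\<bar> / (6 * sqrt m) * (4 * (6 * H1 + 15 * H0) * \<gamma>3 / sqrt n)"
    unfolding abs_mult[of "\<mu>3 / (6 * sqrt m)"] using VG3 mn by (intro mult_mono) (auto simp: abs_mult)
  also have "\<dots> = \<bar>\<mu>3\<bar> * \<gamma>3 * (4 * H1 + 10 * H0) / sqrt (m * n)"
    using mn by (simp add: real_sqrt_mult field_simps)
  finally have VG3': "\<bar>\<mu>3 / (6 * sqrt m) * U.expectation (\<lambda>\<omega>. G (V.S \<omega>))\<bar>
      \<le> \<bar>\<mu>3\<bar> * \<gamma>3 * (4 * H1 + 10 * H0) / sqrt (m * n)" .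
  have ED': "\<bar>U.expectation (\<lambda>\<omega>. D (V.S \<omega>))\<bar> \<le> (H2 + 8 * H0) * (4 * \<mu>4 + 40 * \<bar>\<mu>3\<bar> * \<beta>3) / m"
    using ED by (simp add: C_def mult.commute)
  have tri: "\<bar>u + v + w\<bar> \<le> \<bar>u\<bar> + \<bar>v\<bar> + \<bar>w\<bar>" for u v w :: real by linarith
  show ?thesis
    unfolding dec m_def[symmetric] n_def[symmetric]
    by (rule order_trans[OF tri add_mono[OF add_mono[OF ED' Vg] VG3']])
qed

section \<open>Centring and comparison of constants\<close>

lemma sup_norm_ge: "bounded (range f) \<Longrightarrow> \<bar>f x\<bar> \<le> sup_norm f"
  unfolding sup_norm_def bounded_iff by (intro cSUP_upper) (auto simp: bdd_above_def)

text \<open>That \<open>VG_law\<close> has total mass 1 is inherited from the product representation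
  instead of being computed from the Bessel density.\<close>

lemma VG_expect_centred:
  assumes "h \<in> borel_measurable borel" and b: "\<And>x. \<bar>h x\<bar> \<le> K"
  shows "VG_expect (vg_centred h) = 0" and "bounded (range (vg_centred h))"
proof -
  interpret V: prob_space VG_law
  proof -
    interpret N: prob_space std_normal by (rule prob_space_normal_density) simp
    interpret P: pair_prob_space std_normal std_normal ..
    show "prob_space VG_law" unfolding VG_law_eq by (rule P.P.prob_space_distr) measurable
  qed
  have "integrable VG_law h"
    using assms by (intro V.integrable_const_bound[of _ K]) (auto simp: VG_law_def)
  then show "VG_expect (vg_centred h) = 0"
    by (simp add: VG_expect_def vg_centred_def V.prob_space)
  have "\<bar>vg_centred h x\<bar> \<le> K + \<bar>VG_expect h\<bar>" for x
    using b[of x] unfolding vg_centred_def by linarith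
  then show "bounded (range (vg_centred h))" by (auto simp: bounded_iff)
qed

text \<open>Here x3, y3 are absolute values of third moments, bx, b3 absolute third moments, and the
  other letters carry the order of their moment. Each of the four terms T1 to T4 on the left is
  matched with one summand on the right, where the extra moment factors and c are at least 1; the
  other summands on the right are nonnegative.\<close>

lemma combine_bounds:
  fixes m n H0 H1 H2 H3 c :: real
  assumes pos: "m > 0" "n > 0" "H0 \<ge> 0" "H1 \<ge> 0" "H2 \<ge> 0" "H3 \<ge> 0" "c \<ge> 1"
    and X: "x3 \<ge> 0" "bx \<ge> 1" "x4 \<ge> 1" and Y: "y3 \<ge> 0" "b3 \<ge> 1" "b3 \<le> y4" "y4 \<ge> 1" "b5 \<ge> 0" "y6 \<ge> 1"
  shows "(H2 + 8 * H0) * (4 * x4 + 40 * x3 * bx) / m + (H2 + 4 * H0) * (4 * y4 + 40 * y3 * b3) / n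
      + x3 * b3 * (4 * H1 + 10 * H0) / sqrt (m * n)
    \<le> (10 / n * y3 * b3 + 11 / sqrt (m * n) * x3 * y4) * (c * (3 * H1 + 4 * H0))
     + (9 / m * x4 * y4 + 30 / n * y3 * y4 + 85 / sqrt (m * n) * x3 * b5 + 46 / sqrt (m * n) * bx * y3 * y4)
         * (c * (5 * H2 + 18 * H1 + 19 * H0))
     + (1 / n * x4 * y4 * (1 + 15 * y3) + 284 / m * x3 * bx * y6 + 148 / n * x4 * y3 * b5
         + 135 / sqrt (m * n) * x3 * x4 * b3 + 248 / sqrt (m * n) * x4 * y3)
         * (c * (8 * H3 + 52 * H2 + 124 * H1 + 124 * H0))"
    (is "?T \<le> ?g1 * ?M2 + ?g2 * ?M3 + ?g3 * ?M4")
proof -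
  define s where "s = sqrt (m * n)"
  have s: "s > 0" using pos by (simp add: s_def)
  have c_le: "t \<le> c * t" if "t \<ge> 0" for t using mult_right_mono[OF pos(7) that] by simp
  have M3: "5 * H2 + 19 * H0 \<le> ?M3" and M4: "52 * H2 + 124 * H1 + 124 * H0 \<le> ?M4"
    by (rule order_trans[OF _ c_le]; use pos in simp)+
  have M2: "0 \<le> ?M2" using pos by simp
  have x4y4: "x4 \<le> x4 * y4" "y4 \<le> x4 * y4" using X Y mult_left_mono[of 1 y4 x4] mult_right_mono[of 1 x4 y4] by auto
  have x4b3: "b3 \<le> x4 * b3" using X Y mult_right_mono[of 1 x4 b3] by auto
  have T1: "(H2 + 8 * H0) * (4 * x4) / m \<le> 9 / m * x4 * y4 * ?M3"
  proof -
    have "4 * x4 * (H2 + 8 * H0) \<le> 9 * (x4 * y4) * ?M3"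
      by (rule mult_mono) (use x4y4 X Y pos M3 in auto)
    then have "4 * x4 * (H2 + 8 * H0) / m \<le> 9 * (x4 * y4) * ?M3 / m" using pos by (intro divide_right_mono) auto
    then show ?thesis by (simp add: mult_ac)
  qed
  have T2: "(H2 + 8 * H0) * (40 * x3 * bx) / m \<le> 284 / m * x3 * bx * y6 * ?M4"
  proof -
    have "x3 * bx * 1 \<le> x3 * bx * y6" using X Y by (intro mult_left_mono) auto
    moreover have "0 \<le> x3 * bx" using X by simp
    ultimately have "40 * (x3 * bx) \<le> 284 * (x3 * bx * y6)" by linarith
    then have "40 * (x3 * bx) * (H2 + 8 * H0) \<le> 284 * (x3 * bx * y6) * (3 * (H2 + 8 * H0))"
      by (rule mult_mono) (use X Y pos in auto)
    also have "\<dots> \<le> 284 * (x3 * bx * y6) * ?M4"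
      by (intro mult_left_mono) (use X Y pos M4 in auto)
    finally have "40 * (x3 * bx) * (H2 + 8 * H0) / m \<le> 284 * (x3 * bx * y6) * ?M4 / m"
      using pos by (intro divide_right_mono) auto
    then show ?thesis by (simp add: mult_ac)
  qed
  \<comment> \<open>The target summand has coefficient 1, so the factor 4 is moved to the norm
    factor, whose coefficients 52 and 124 absorb it. The inequality b3 \<le> y4 converts the mixed
    product, with 40 \<le> 60 = 4 * 15.\<close>
  have T3: "(H2 + 4 * H0) * (4 * y4 + 40 * y3 * b3) / n \<le> 1 / n * x4 * y4 * (1 + 15 * y3) * ?M4"
  proof -
    have "b3 \<le> x4 * y4" using x4y4(2) Y by linarith
    then have "y3 * b3 \<le> y3 * (x4 * y4)" using Y by (intro mult_left_mono) auto
    moreover have "0 \<le> y3 * (x4 * y4)" using X Y by simp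
    ultimately have "4 * y4 + 40 * (y3 * b3) \<le> 4 * (x4 * y4) + 60 * (y3 * (x4 * y4))"
      using x4y4(2) by linarith
    also have "\<dots> = 4 * (x4 * y4 * (1 + 15 * y3))" by (simp add: algebra_simps)
    finally have "4 * y4 + 40 * y3 * b3 \<le> 4 * (x4 * y4 * (1 + 15 * y3))" by simp
    then have "(4 * y4 + 40 * y3 * b3) * (H2 + 4 * H0) \<le> 4 * (x4 * y4 * (1 + 15 * y3)) * (H2 + 4 * H0)"
      using pos by (intro mult_right_mono) auto
    also have "\<dots> = (x4 * y4 * (1 + 15 * y3)) * (4 * (H2 + 4 * H0))" by simp
    also have "\<dots> \<le> (x4 * y4 * (1 + 15 * y3)) * ?M4"
      by (intro mult_left_mono) (use X Y pos M4 in auto)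
    finally have "(4 * y4 + 40 * y3 * b3) * (H2 + 4 * H0) / n \<le> (x4 * y4 * (1 + 15 * y3)) * ?M4 / n"
      using pos by (intro divide_right_mono) auto
    then show ?thesis by (simp add: mult_ac)
  qed
  have T4: "x3 * b3 * (4 * H1 + 10 * H0) / s \<le> 135 / s * x3 * x4 * b3 * ?M4"
  proof -
    have "x3 * b3 \<le> x3 * (x4 * b3)" using X x4b3 by (intro mult_left_mono) auto
    moreover have "0 \<le> x3 * (x4 * b3)" using X Y by simp
    ultimately have "x3 * b3 \<le> 135 * (x3 * (x4 * b3))" by linarith
    then have "x3 * b3 * (4 * H1 + 10 * H0) \<le> 135 * (x3 * (x4 * b3)) * ?M4"
      by (rule mult_mono) (use X Y pos M4 in auto)
    then have "x3 * b3 * (4 * H1 + 10 * H0) / s \<le> 135 * (x3 * (x4 * b3)) * ?M4 / s"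
      using s by (intro divide_right_mono) auto
    then show ?thesis by (simp add: mult_ac)
  qed
  have M34: "0 \<le> ?M3" "0 \<le> ?M4" using pos by auto
  have "?T = (H2 + 8 * H0) * (4 * x4) / m + (H2 + 8 * H0) * (40 * x3 * bx) / m
      + (H2 + 4 * H0) * (4 * y4 + 40 * y3 * b3) / n + x3 * b3 * (4 * H1 + 10 * H0) / s"
    by (simp add: s_def distrib_left add_divide_distrib)
  also have "\<dots> \<le> 9 / m * x4 * y4 * ?M3
      + (1 / n * x4 * y4 * (1 + 15 * y3) + 284 / m * x3 * bx * y6 + 135 / s * x3 * x4 * b3) * ?M4"
    using T1 T2 T3 T4 unfolding distrib_right by linarith
  also have "\<dots> \<le> ?g2 * ?M3 + ?g3 * ?M4"
  proof -
    have "0 \<le> 30 / n * y3 * y4" "0 \<le> 85 / s * x3 * b5" "0 \<le> 46 / s * bx * y3 * y4"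
      "0 \<le> 148 / n * x4 * y3 * b5" "0 \<le> 248 / s * x4 * y3"
      using X Y pos s by auto
    then have "9 / m * x4 * y4 \<le> ?g2"
      and "1 / n * x4 * y4 * (1 + 15 * y3) + 284 / m * x3 * bx * y6 + 135 / s * x3 * x4 * b3 \<le> ?g3"
      unfolding s_def[symmetric] by linarith+
    then show ?thesis by (intro add_mono[OF mult_right_mono mult_right_mono] M34)
  qed
  also have "\<dots> \<le> ?g1 * ?M2 + (?g2 * ?M3 + ?g3 * ?M4)"
  proof -
    have "0 \<le> ?g1 * ?M2"
      using X Y pos s M2 unfolding s_def[symmetric] by (intro mult_nonneg_nonneg add_nonneg_nonneg) auto
    then show ?thesis by linarith
  qed
  finally show ?thesis by (simp only: add.assoc)
qed

lemma (in prob_space) sixth_moment_ge_1: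
  fixes Y :: "'a \<Rightarrow> real"
  assumes "integrable M (\<lambda>\<omega>. (Y \<omega>)\<^sup>2)" "integrable M (\<lambda>\<omega>. Y \<omega> ^ 6)" "expectation (\<lambda>\<omega>. (Y \<omega>)\<^sup>2) = 1"
  shows "expectation (\<lambda>\<omega>. Y \<omega> ^ 6) \<ge> 1"
proof -
  have "expectation (\<lambda>\<omega>. 3 * (Y \<omega>)\<^sup>2 - 2) \<le> expectation (\<lambda>\<omega>. Y \<omega> ^ 6)"
  proof (rule integral_mono)
    show "3 * (Y \<omega>)\<^sup>2 - 2 \<le> Y \<omega> ^ 6" for \<omega>
    proof -
      have "(t\<^sup>2 - 1)\<^sup>2 * (t\<^sup>2 + 2) = t ^ 6 - 3 * t\<^sup>2 + 2" for t :: real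
        by (simp add: algebra_simps eval_nat_numeral)
      moreover have "0 \<le> ((Y \<omega>)\<^sup>2 - 1)\<^sup>2 * ((Y \<omega>)\<^sup>2 + 2)" by simp
      ultimately show ?thesis by simp
    qed
  qed (use assms in auto)
  then show ?thesis using assms by (simp add: prob_space)
qed

lemma (in prob_space) integrable_power_le6:
  fixes Y :: "'a \<Rightarrow> real"
  assumes [measurable]: "Y \<in> borel_measurable M" and i6: "integrable M (\<lambda>\<omega>. Y \<omega> ^ 6)" and j: "j \<le> 6"
  shows "integrable M (\<lambda>\<omega>. Y \<omega> ^ j)"
proof (rule Bochner_Integration.integrable_bound)
  show "integrable M (\<lambda>\<omega>. 1 + Y \<omega> ^ 6)" using i6 by simp
  show "AE \<omega> in M. norm (Y \<omega> ^ j) \<le> norm (1 + Y \<omega> ^ 6)"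
    using abs_power_le_sixth[OF j] by (auto simp: power_abs)
qed measurable

lemma (in prob_space) normalised_sum_of_copies:
  fixes X :: "'a \<Rightarrow> real" and Z :: "'i \<Rightarrow> 'a \<Rightarrow> real"
  assumes fin: "finite I" "I \<noteq> {}" and indep: "indep_vars (\<lambda>_. borel) Z I"
    and X [measurable]: "X \<in> borel_measurable M"
    and distr: "\<And>i. i \<in> I \<Longrightarrow> distr M borel (Z i) = distr M borel X"
    and i6: "integrable M (\<lambda>\<omega>. X \<omega> ^ 6)" and mean: "expectation X = 0" and var: "variance X = 1"
  shows "normalised_sum M I Z (moment M X 3) (abs_moment M X 3) (moment M X 4)"
proof
  have [measurable]: "Z i \<in> borel_measurable M" if "i \<in> I" for i
    using indep that by (auto simp: indep_vars_def)
  have trans: "expectation (\<lambda>\<omega>. f (Z i \<omega>)) = expectation (\<lambda>\<omega>. f (X \<omega>))"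
    if "i \<in> I" "f \<in> borel_measurable borel" for i and f :: "real \<Rightarrow> real"
    using that distr[OF that(1)] integral_distr[of "Z i" M borel f] integral_distr[of X M borel f] by simp
  show "integrable M (\<lambda>\<omega>. Z i \<omega> ^ 4)" if i: "i \<in> I" for i
  proof -
    have "integrable (distr M borel X) (\<lambda>x. x ^ 4)"
      using integrable_power_le6[OF X i6, of 4] by (simp add: integrable_distr_eq)
    then have "integrable (distr M borel (Z i)) (\<lambda>x. x ^ 4)" using distr[OF i] by simp
    then show ?thesis using i by (simp add: integrable_distr_eq)
  qed
  fix i assume i: "i \<in> I"
  show "expectation (Z i) = 0" using trans[OF i, of "\<lambda>x. x"] mean by simp
  show "expectation (\<lambda>\<omega>. (Z i \<omega>)\<^sup>2) = 1" using trans[OF i, of "\<lambda>x. x\<^sup>2"] var mean by simp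
  show "expectation (\<lambda>\<omega>. Z i \<omega> ^ 3) = moment M X 3" using trans[OF i, of "\<lambda>x. x ^ 3"] by (simp add: moment_def)
  show "expectation (\<lambda>\<omega>. \<bar>Z i \<omega>\<bar> ^ 3) = abs_moment M X 3"
    using trans[OF i, of "\<lambda>x. \<bar>x\<bar> ^ 3"] by (simp add: abs_moment_def power_abs)
  show "expectation (\<lambda>\<omega>. Z i \<omega> ^ 4) = moment M X 4" using trans[OF i, of "\<lambda>x. x ^ 4"] by (simp add: moment_def)
qed (use fin indep in auto)

theorem theorem4p1:
  fixes M :: "'a measure"
    and m n :: nat
    and X Y :: "'a \<Rightarrow> real"
    and Xs Ys :: "nat \<Rightarrow> 'a \<Rightarrow> real"
    and W :: "'a \<Rightarrow> real"
    and h :: "real \<Rightarrow> real"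
  assumes "prob_space M"
    and "m \<ge> 1" and "n \<ge> 1"
    and indep: "prob_space.indep_vars M (\<lambda>_. borel) (joint_family X Xs Y Ys)
                  ({IX, IY} \<union> IXs ` {1..m} \<union> IYs ` {1..n})"
    and "\<And>i. i \<in> {1..m} \<Longrightarrow> distr M borel (Xs i) = distr M borel X"
    and "\<And>j. j \<in> {1..n} \<Longrightarrow> distr M borel (Ys j) = distr M borel Y"
    and "integrable M (\<lambda>\<omega>. X \<omega> ^ 6)" and "integrable M (\<lambda>\<omega>. Y \<omega> ^ 6)"
    and "prob_space.expectation M X = 0" and "prob_space.expectation M Y = 0"
    and "prob_space.variance M X = 1" and "prob_space.variance M Y = 1"
    and W_def: "W = (\<lambda>\<omega>. 1 / sqrt (real m * real n) * (\<Sum>i=1..m. \<Sum>j=1..n. Xs i \<omega> * Ys j \<omega>))"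
    and "h \<in> C_b 3"
  shows "\<bar>prob_space.expectation M (\<lambda>\<omega>. h (W \<omega>)) - VG_expect h\<bar>
           \<le> gamma1 M m n X Y * vg_M2 h + gamma2 M m n X Y * vg_M3 h + gamma3 M m n X Y * vg_M4 h"
proof -
  interpret prob_space M by fact
  let ?F = "joint_family X Xs Y Ys" and ?I = "IXs ` {1..m}" and ?J = "IYs ` {1..n}"
  have meas: "?F i \<in> borel_measurable M" if "i \<in> {IX, IY} \<union> ?I \<union> ?J" for i
    using indep that by (auto simp: indep_vars_def)
  have [measurable]: "X \<in> borel_measurable M" "Y \<in> borel_measurable M"
    using meas[of IX] meas[of IY] by auto
  have card: "card ?I = m" "card ?J = n" by (auto simp: card_image inj_on_def)
  have U: "normalised_sum M ?I ?F (moment M X 3) (abs_moment M X 3) (moment M X 4)"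
    by (rule normalised_sum_of_copies) (use assms in \<open>auto intro: indep_vars_subset[OF indep]\<close>)
  have V: "normalised_sum M ?J ?F (moment M Y 3) (abs_moment M Y 3) (moment M Y 4)"
    by (rule normalised_sum_of_copies) (use assms in \<open>auto intro: indep_vars_subset[OF indep]\<close>)
  interpret U: normalised_sum M ?I ?F "moment M X 3" "abs_moment M X 3" "moment M X 4" by (rule U)
  interpret V: normalised_sum M ?J ?F "moment M Y 3" "abs_moment M Y 3" "moment M Y 4" by (rule V)
  have US: "U.S \<omega> = (\<Sum>i=1..m. Xs i \<omega>) / sqrt m" for \<omega>
    unfolding U.S_def U.n_def card by (subst sum.reindex) (auto simp: inj_on_def)
  have VS: "V.S \<omega> = (\<Sum>j=1..n. Ys j \<omega>) / sqrt n" for \<omega>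
    unfolding V.S_def V.n_def card by (subst sum.reindex) (auto simp: inj_on_def)
  have ind: "indep_var borel U.S borel V.S"
  proof -
    \<comment> \<open>Disjoint blocks of an independent family are independent, and each sum depends
      only on the restriction of the family to its block.\<close>
    have r: "indep_var (PiM ?I (\<lambda>_. borel)) (\<lambda>\<omega>. restrict (\<lambda>i. ?F i \<omega>) ?I) (PiM ?J (\<lambda>_. borel)) (\<lambda>\<omega>. restrict (\<lambda>i. ?F i \<omega>) ?J)"
      by (rule indep_var_restrict[OF indep]) auto
    have "indep_var borel ((\<lambda>x. (\<Sum>i\<in>?I. x i) / sqrt U.n) \<circ> (\<lambda>\<omega>. restrict (\<lambda>i. ?F i \<omega>) ?I))
        borel ((\<lambda>x. (\<Sum>i\<in>?J. x i) / sqrt V.n) \<circ> (\<lambda>\<omega>. restrict (\<lambda>i. ?F i \<omega>) ?J))"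
      by (rule indep_var_compose[OF r]) measurable
    moreover have "(\<lambda>x. (\<Sum>i\<in>?I. x i) / sqrt U.n) \<circ> (\<lambda>\<omega>. restrict (\<lambda>i. ?F i \<omega>) ?I) = U.S"
      unfolding U.S_def[abs_def] comp_def by (intro ext arg_cong2[where f = "(/)"] sum.cong refl) auto
    moreover have "(\<lambda>x. (\<Sum>i\<in>?J. x i) / sqrt V.n) \<circ> (\<lambda>\<omega>. restrict (\<lambda>i. ?F i \<omega>) ?J) = V.S"
      unfolding V.S_def[abs_def] comp_def by (intro ext arg_cong2[where f = "(/)"] sum.cong refl) auto
    ultimately show ?thesis by simp
  qed
  have W_eq: "W \<omega> = U.S \<omega> * V.S \<omega>" for \<omega>
    unfolding W_def US VS real_sqrt_mult by (simp only: sum_product times_divide_times_eq) simp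

  have C: "(deriv ^^ j) h differentiable (at x)" if "j < 3" for j x
    using \<open>h \<in> C_b 3\<close> that by (auto simp: C_b_def)
  have Cb: "continuous_on UNIV ((deriv ^^ j) h)" "bounded (range ((deriv ^^ j) h))" if "j \<le> 3" for j
    using \<open>h \<in> C_b 3\<close> that by (auto simp: C_b_def)
  have d: "((deriv ^^ j) h has_real_derivative (deriv ^^ Suc j) h x) (at x)" if "j < 3" for j x
    using C[OF that, of x] by (simp add: DERIV_deriv_iff_real_differentiable)
  \<comment> \<open>Centring provides the mean 0 that \<open>product_approx\<close> requires, keeps
    the derivatives, and makes H0 the norm of the centred function that occurs in the constants of
    the theorem.\<close>
  define hc where "hc = vg_centred h"
  define H0 where "H0 = sup_norm (vg_centred h)"
  define H1 where "H1 = sup_norm (deriv h)"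
  define H2 where "H2 = sup_norm ((deriv ^^ 2) h)"
  define H3 where "H3 = sup_norm ((deriv ^^ 3) h)"
  have hm: "h \<in> borel_measurable borel"
    using Cb(1)[of 0] by (simp add: borel_measurable_continuous_onI)
  obtain K where K: "\<And>x. \<bar>h x\<bar> \<le> K" using Cb(2)[of 0] by (auto simp: bounded_iff)
  note vg = VG_expect_centred[OF hm K]
  have b: "\<bar>hc x\<bar> \<le> H0" "\<bar>deriv h x\<bar> \<le> H1" "\<bar>(deriv ^^ 2) h x\<bar> \<le> H2" "\<bar>(deriv ^^ 3) h x\<bar> \<le> H3" for x
    using vg(2) Cb(2)[of 1] Cb(2)[of 2] Cb(2)[of 3]
    unfolding hc_def H0_def H1_def H2_def H3_def by (auto intro!: sup_norm_ge)
  have H: "H0 \<ge> 0" "H1 \<ge> 0" "H2 \<ge> 0" "H3 \<ge> 0"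
    using b[of 0] by linarith+
  have h1: "(hc has_real_derivative deriv h x) (at x)" for x
    using DERIV_diff[OF d[of 0 x] DERIV_const[of "VG_expect h"]] by (simp add: hc_def vg_centred_def[abs_def])
  have h2: "(deriv h has_real_derivative (deriv ^^ 2) h x) (at x)" for x
    using d[of 1 x] by (simp add: numeral_2_eq_2)
  have h2c: "isCont ((deriv ^^ 2) h) x" for x
    using Cb(1)[of 2] by (simp add: continuous_on_eq_continuous_at)
  have "\<bar>expectation (\<lambda>\<omega>. hc (U.S \<omega> * V.S \<omega>))\<bar>
    \<le> (H2 + 8 * H0) * (4 * moment M X 4 + 40 * \<bar>moment M X 3\<bar> * abs_moment M X 3) / card ?I
      + (H2 + 4 * H0) * (4 * moment M Y 4 + 40 * \<bar>moment M Y 3\<bar> * abs_moment M Y 3) / card ?J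
      + \<bar>moment M X 3\<bar> * abs_moment M Y 3 * (4 * H1 + 10 * H0) / sqrt (real (card ?I) * real (card ?J))"
    by (rule product_approx[OF U V ind h1 h2 h2c b(1-3) vg(1)[folded hc_def]])
  also have "\<dots> \<le> gamma1 M m n X Y * vg_M2 h + gamma2 M m n X Y * vg_M3 h + gamma3 M m n X Y * vg_M4 h"
    unfolding gamma1_def gamma2_def gamma3_def vg_M2_def vg_M3_def vg_M4_def card
      H0_def[symmetric] H1_def[symmetric] H2_def[symmetric] H3_def[symmetric]
  proof (rule combine_bounds)
    show "vg_c \<ge> 1" by (simp add: vg_c_def)
    have "integrable M (\<lambda>\<omega>. (Y \<omega>)\<^sup>2)" by (rule integrable_power_le6) (use assms in auto)
    moreover have "expectation (\<lambda>\<omega>. (Y \<omega>)\<^sup>2) = 1" using assms by simp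
    ultimately show "moment M Y 6 \<ge> 1" unfolding moment_def using assms by (intro sixth_moment_ge_1) auto
    show "abs_moment M Y 5 \<ge> 0" unfolding abs_moment_def by (rule Bochner_Integration.integral_nonneg) simp
  qed (use H assms U.moment_bounds V.moment_bounds in auto)
  also have "expectation (\<lambda>\<omega>. hc (U.S \<omega> * V.S \<omega>)) = expectation (\<lambda>\<omega>. h (W \<omega>)) - VG_expect h"
  proof -
    have "W \<in> borel_measurable M" unfolding W_eq[abs_def] by measurable
    then have "integrable M (\<lambda>\<omega>. h (W \<omega>))" by (rule integrable_bounded_comp[OF _ hm K])
    then show ?thesis unfolding hc_def vg_centred_def W_eq[symmetric] by (simp add: prob_space)
  qed
  finally show ?thesis .
qed

end
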